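(* Let $X=\mathbb{P}^1_{\mathbb{Z}}$ and let $\mathcal{E}$ be a locally free sheaf of rank two on $X$ with associated triple $(a,b,Z)$; that is, $a\geq b$ are integers, $Z$ is a local complete intersection of codimension two in $X$, and there is an exact sequence $0\to\mathcal{O}_X(a)\to\mathcal{E}\to\mathcal{I}_Z(b)\to 0$. Then $\mathcal{E}$ is indecomposable if and only if $Z$ is not empty.
   Context: A local complete intersection of codimension two in $X$ is a closed subscheme $Z\subset X$ (possibly empty) whose ideal sheaf $\mathcal{I}_Z\subset\mathcal{O}_X$ is, at every point of $Z$, generated by a regular sequence of length two; $\mathcal{I}_Z(b):=\mathcal{I}_Z\otimes\mathcal{O}_X(b)$, and $\mathcal{I}_\emptyset=\mathcal{O}_X$. Every locally free sheaf of rank two on $X$ sits in an exact sequence of the stated form, with $a\ge b$. A rank two locally free sheaf is decomposable if it is isomorphic to a direct sum of two line bundles $\mathcal{O}_X(r)\oplus\mathcal{O}_X(s)$, $r,s\in\mathbb{Z}$, and indecomposable otherwise. *)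

theory Defs
  imports
    "HOL-Computational_Algebra.Polynomial"
    "HOL-Computational_Algebra.Fraction_Field"
    "HOL-Algebra.Ideal"
    "HOL-Algebra.Module"
    "HOL-Algebra.Free_Abelian_Groups"
    "HOL-Analysis.Abstract_Topology"
begin

section \<open>The projective line over the integers\<close>

text \<open>
  The projective line is Proj of the graded ring Z[x,y]. An element of Z[x,y] is a polynomial in y
  whose coefficients are polynomials in x. As Z[x,y] is a domain, all its (graded) localizations
  are realized inside its fraction field.
\<close>

type_synonym zxy = "int poly poly"
type_synonym rat_fun = "zxy fract"
type_synonym pt = "zxy set"
type_synonym fn = "pt \<Rightarrow> rat_fun"

definition Zxy :: "zxy ring" where
  "Zxy = \<lparr>carrier = UNIV, monoid.mult = (*), monoid.one = 1, ring.zero = 0, ring.add = (+)\<rparr>"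

text \<open>Forms of degree d, the zero polynomial included.\<close>
definition form :: "nat \<Rightarrow> zxy set" where
  "form d = {f. \<forall>i j. coeff (coeff f i) j \<noteq> 0 \<longrightarrow> i + j = d}"

definition homogeneous_ideal :: "zxy set \<Rightarrow> bool" where
  "homogeneous_ideal J \<longleftrightarrow> ideal J Zxy \<and> J = Idl\<^bsub>Zxy\<^esub> (J \<inter> (\<Union>d. form d))"

definition irrelevant_ideal :: "zxy set" where
  "irrelevant_ideal = Idl\<^bsub>Zxy\<^esub> (\<Union>d\<in>{0<..}. form d)"

definition P1 :: "pt set" where
  "P1 = {p. primeideal p Zxy \<and> homogeneous_ideal p \<and> \<not> irrelevant_ideal \<subseteq> p}"

definition vanishing_locus :: "zxy set \<Rightarrow> pt set" where
  "vanishing_locus T = {p \<in> P1. T \<subseteq> p}"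

definition zariski_open :: "pt set \<Rightarrow> bool" where
  "zariski_open U \<longleftrightarrow> (\<exists>T \<subseteq> (\<Union>d. form d). U = P1 - vanishing_locus T)"

definition zariski :: "pt topology" where
  "zariski = topology zariski_open"

lemma form_mult: assumes f: "f \<in> form d" and g: "g \<in> form e" shows "f * g \<in> form (d + e)"
  unfolding form_def
proof (safe)
  fix i j assume "coeff (coeff (f * g) i) j \<noteq> 0"
  then have "(\<Sum>k\<le>i. \<Sum>l\<le>j. coeff (coeff f k) l * coeff (coeff g (i-k)) (j-l)) \<noteq> 0"
    by (simp add: coeff_mult coeff_sum)
  then obtain k l where kl: "k \<le> i" "l \<le> j" "coeff (coeff f k) l * coeff (coeff g (i-k)) (j-l) \<noteq> 0"
    by (metis (no_types, lifting) atMost_iff sum.not_neutral_contains_not_neutral)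
  then have "coeff (coeff f k) l \<noteq> 0" "coeff (coeff g (i-k)) (j-l) \<noteq> 0" by auto
  then have "k + l = d" "i - k + (j - l) = e" using f g by (auto simp: form_def)
  then show "i + j = d + e" using kl by auto
qed

lemma istopology_zariski_open: "istopology zariski_open"
  unfolding istopology_def
proof (intro conjI allI impI)
  fix U V assume "zariski_open U" "zariski_open V"
  then obtain S T where S: "S \<subseteq> (\<Union>d. form d)" "U = P1 - vanishing_locus S"
    and T: "T \<subseteq> (\<Union>d. form d)" "V = P1 - vanishing_locus T"
    unfolding zariski_open_def by metis
  let ?P = "{s * t |s t. s \<in> S \<and> t \<in> T}"
  have "?P \<subseteq> (\<Union>d. form d)"
  proof safe
    fix s t assume "s \<in> S" "t \<in> T"
    then obtain d e where "s \<in> form d" "t \<in> form e" using S(1) T(1) by blast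
    then show "s * t \<in> (\<Union>d. form d)" using form_mult by blast
  qed
  have iff: "?P \<subseteq> p \<longleftrightarrow> S \<subseteq> p \<or> T \<subseteq> p" if "p \<in> P1" for p
  proof
    have pr: "primeideal p Zxy" using that by (simp add: P1_def)
    interpret primeideal p Zxy by (rule pr)
    show "S \<subseteq> p \<or> T \<subseteq> p" if "?P \<subseteq> p"
    proof (rule ccontr)
      assume "\<not> (S \<subseteq> p \<or> T \<subseteq> p)"
      then obtain s t where st: "s \<in> S" "s \<notin> p" "t \<in> T" "t \<notin> p" by blast
      then have "s * t \<in> p" using that by blast
      then show False using I_prime[of s t] st by (simp add: Zxy_def)
    qed
    show "?P \<subseteq> p" if "S \<subseteq> p \<or> T \<subseteq> p"
    proof safe
      fix s t assume "s \<in> S" "t \<in> T"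
      then have "s \<in> p \<or> t \<in> p" using that by blast
      then show "s * t \<in> p" using I_l_closed[of t s] I_r_closed[of s t] by (auto simp: Zxy_def)
    qed
  qed
  have "U \<inter> V = P1 - vanishing_locus ?P"
  proof (rule Set.set_eqI)
    fix p
    have "p \<in> U \<inter> V \<longleftrightarrow> p \<in> P1 \<and> \<not> (S \<subseteq> p \<or> T \<subseteq> p)"
      unfolding S(2) T(2) vanishing_locus_def by blast
    also have "\<dots> \<longleftrightarrow> p \<in> P1 \<and> \<not> ?P \<subseteq> p" using iff[of p] by argo
    finally show "p \<in> U \<inter> V \<longleftrightarrow> p \<in> P1 - vanishing_locus ?P"
      unfolding vanishing_locus_def by (simp only: mem_Collect_eq Diff_iff) argo
  qed
  with \<open>?P \<subseteq> (\<Union>d. form d)\<close> show "zariski_open (U \<inter> V)" unfolding zariski_open_def by blast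
next
  fix K assume "\<forall>U\<in>K. zariski_open U"
  then obtain T where T: "\<forall>U\<in>K. T U \<subseteq> (\<Union>d. form d) \<and> U = P1 - vanishing_locus (T U)"
    unfolding zariski_open_def by metis
  have "\<Union>K = P1 - vanishing_locus (\<Union>(T ` K))"
  proof -
    have "\<Union>K = (\<Union>U\<in>K. P1 - vanishing_locus (T U))" using T by auto
    then show ?thesis unfolding vanishing_locus_def by auto
  qed
  then show "zariski_open (\<Union>K)" using T unfolding zariski_open_def
    by (metis (no_types, lifting) UN_least)
qed

lemma openin_zariski: "openin zariski U \<longleftrightarrow> zariski_open U"
  using istopology_zariski_open by (simp add: zariski_def)

text \<open>The local ring at p: the fractions of degree 0 whose denominator is not in p.\<close>
definition local_ring :: "pt \<Rightarrow> rat_fun ring" where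
  "local_ring p =
    \<lparr>carrier = {Fract h f |h f. \<exists>d. h \<in> form d \<and> f \<in> form d \<and> f \<notin> p},
     monoid.mult = (*), monoid.one = 1, ring.zero = 0, ring.add = (+)\<rparr>"

text \<open>
  Sections over U of the sheaf associated with the graded module Z[x,y](n): functions which near
  every point are given by a fraction of degree n with nowhere vanishing denominator.
  Sections are undefined outside U.
\<close>
definition twist_sections :: "int \<Rightarrow> pt set \<Rightarrow> fn set" where
  "twist_sections n U = {s \<in> extensional U. \<forall>p\<in>U. \<exists>V. openin zariski V \<and> p \<in> V \<and> V \<subseteq> U \<and>
     (\<exists>d e h f. h \<in> form e \<and> f \<in> form d \<and> int e = int d + n \<and>
        (\<forall>q\<in>V. f \<notin> q \<and> s q = Fract h f))}"

definition OX :: "pt set \<Rightarrow> fn ring" where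
  "OX U =
    \<lparr>carrier = twist_sections 0 U,
     monoid.mult = (\<lambda>s t. \<lambda>p\<in>U. s p * t p), monoid.one = (\<lambda>p\<in>U. 1),
     ring.zero = (\<lambda>p\<in>U. 0), ring.add = (\<lambda>s t. \<lambda>p\<in>U. s p + t p)\<rparr>"


section \<open>Sheaves of modules over the structure sheaf\<close>

text \<open>
  A module record extends a ring record; its fields mult and one play no role for modules
  and are left unspecified throughout.
\<close>
record 'm omod =
  sec :: "pt set \<Rightarrow> (fn, 'm) module"
  res :: "pt set \<Rightarrow> pt set \<Rightarrow> 'm \<Rightarrow> 'm"  \<comment> \<open>res F U V restricts from U to V\<close>

definition presheaf_of_modules :: "'m omod \<Rightarrow> bool" where
  "presheaf_of_modules F \<longleftrightarrow>
     (\<forall>U. openin zariski U \<longrightarrow> Module.module (OX U) (sec F U)) \<and>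
     (\<forall>U V. openin zariski U \<and> openin zariski V \<and> V \<subseteq> U \<longrightarrow>
        res F U V \<in> carrier (sec F U) \<rightarrow> carrier (sec F V) \<and>
        (\<forall>s\<in>carrier (sec F U). \<forall>t\<in>carrier (sec F U).
           res F U V (s \<oplus>\<^bsub>sec F U\<^esub> t) = res F U V s \<oplus>\<^bsub>sec F V\<^esub> res F U V t) \<and>
        (\<forall>r\<in>carrier (OX U). \<forall>s\<in>carrier (sec F U).
           res F U V (r \<odot>\<^bsub>sec F U\<^esub> s) = restrict r V \<odot>\<^bsub>sec F V\<^esub> res F U V s)) \<and>
     (\<forall>U. openin zariski U \<longrightarrow> (\<forall>s\<in>carrier (sec F U). res F U U s = s)) \<and>
     (\<forall>U V W. openin zariski U \<and> openin zariski V \<and> openin zariski W \<and> W \<subseteq> V \<and> V \<subseteq> U \<longrightarrow>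
        (\<forall>s\<in>carrier (sec F U). res F V W (res F U V s) = res F U W s))"

definition sheaf_of_modules :: "'m omod \<Rightarrow> bool" where
  "sheaf_of_modules F \<longleftrightarrow> presheaf_of_modules F \<and>
     (\<forall>\<C>. (\<forall>V\<in>\<C>. openin zariski V) \<longrightarrow>
        (\<forall>s\<in>carrier (sec F (\<Union>\<C>)). \<forall>t\<in>carrier (sec F (\<Union>\<C>)).
           (\<forall>V\<in>\<C>. res F (\<Union>\<C>) V s = res F (\<Union>\<C>) V t) \<longrightarrow> s = t) \<and>
        (\<forall>\<sigma>. (\<forall>V\<in>\<C>. \<sigma> V \<in> carrier (sec F V)) \<and>
             (\<forall>V\<in>\<C>. \<forall>W\<in>\<C>. res F V (V \<inter> W) (\<sigma> V) = res F W (V \<inter> W) (\<sigma> W)) \<longrightarrow>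
           (\<exists>s\<in>carrier (sec F (\<Union>\<C>)). \<forall>V\<in>\<C>. res F (\<Union>\<C>) V s = \<sigma> V)))"

text \<open>Morphisms from the restriction of F to W into the restriction of G to W, for W open.\<close>
definition morphism_on :: "pt set \<Rightarrow> 'm omod \<Rightarrow> 'n omod \<Rightarrow> (pt set \<Rightarrow> 'm \<Rightarrow> 'n) \<Rightarrow> bool" where
  "morphism_on W F G \<phi> \<longleftrightarrow>
     (\<forall>U. openin zariski U \<and> U \<subseteq> W \<longrightarrow>
        \<phi> U \<in> carrier (sec F U) \<rightarrow> carrier (sec G U) \<and>
        (\<forall>s\<in>carrier (sec F U). \<forall>t\<in>carrier (sec F U).
           \<phi> U (s \<oplus>\<^bsub>sec F U\<^esub> t) = \<phi> U s \<oplus>\<^bsub>sec G U\<^esub> \<phi> U t) \<and>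
        (\<forall>r\<in>carrier (OX U). \<forall>s\<in>carrier (sec F U).
           \<phi> U (r \<odot>\<^bsub>sec F U\<^esub> s) = r \<odot>\<^bsub>sec G U\<^esub> \<phi> U s)) \<and>
     (\<forall>U V. openin zariski U \<and> openin zariski V \<and> V \<subseteq> U \<and> U \<subseteq> W \<longrightarrow>
        (\<forall>s\<in>carrier (sec F U). \<phi> V (res F U V s) = res G U V (\<phi> U s)))"

definition isomorphic_on :: "pt set \<Rightarrow> 'm omod \<Rightarrow> 'n omod \<Rightarrow> bool" where
  "isomorphic_on W F G \<longleftrightarrow> (\<exists>\<phi>. morphism_on W F G \<phi> \<and>
     (\<forall>U. openin zariski U \<and> U \<subseteq> W \<longrightarrow> bij_betw (\<phi> U) (carrier (sec F U)) (carrier (sec G U))))"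

definition kernel_sections :: "'m omod \<Rightarrow> 'n omod \<Rightarrow> (pt set \<Rightarrow> 'm \<Rightarrow> 'n) \<Rightarrow> pt set \<Rightarrow> 'm set" where
  "kernel_sections F G \<phi> U = {s \<in> carrier (sec F U). \<phi> U s = \<zero>\<^bsub>sec G U\<^esub>}"

text \<open>Sections of the image sheaf: those which locally come from F.\<close>
definition image_sections :: "'m omod \<Rightarrow> 'n omod \<Rightarrow> (pt set \<Rightarrow> 'm \<Rightarrow> 'n) \<Rightarrow> pt set \<Rightarrow> 'n set" where
  "image_sections F G \<phi> U = {t \<in> carrier (sec G U). \<forall>x\<in>U. \<exists>V. openin zariski V \<and> x \<in> V \<and> V \<subseteq> U \<and>
     res G U V t \<in> \<phi> V ` carrier (sec F V)}"

text \<open>Existence of an exact sequence 0 \<open>\<rightarrow>\<close> F \<open>\<rightarrow>\<close> G \<open>\<rightarrow>\<close> H \<open>\<rightarrow>\<close> 0.\<close>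
definition short_exact_sequence :: "'m omod \<Rightarrow> 'n omod \<Rightarrow> 'k omod \<Rightarrow> bool" where
  "short_exact_sequence F G H \<longleftrightarrow> (\<exists>\<phi> \<psi>. morphism_on P1 F G \<phi> \<and> morphism_on P1 G H \<psi> \<and>
     (\<forall>U. openin zariski U \<longrightarrow>
        kernel_sections F G \<phi> U = {\<zero>\<^bsub>sec F U\<^esub>} \<and>
        image_sections F G \<phi> U = kernel_sections G H \<psi> U \<and>
        image_sections G H \<psi> U = carrier (sec H U)))"

definition twist :: "int \<Rightarrow> fn omod" where  \<comment> \<open>the line bundle O(n)\<close>
  "twist n = \<lparr>sec = (\<lambda>U.
      \<lparr>carrier = twist_sections n U, monoid.mult = undefined, monoid.one = undefined,
       ring.zero = (\<lambda>p\<in>U. 0), ring.add = (\<lambda>s t. \<lambda>p\<in>U. s p + t p), smult = (\<lambda>r s. \<lambda>p\<in>U. r p * s p)\<rparr>),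
     res = (\<lambda>U V s. restrict s V)\<rparr>"

definition direct_sum :: "'m omod \<Rightarrow> 'n omod \<Rightarrow> ('m \<times> 'n) omod" where
  "direct_sum F G = \<lparr>sec = (\<lambda>U.
      \<lparr>carrier = carrier (sec F U) \<times> carrier (sec G U),
       monoid.mult = undefined, monoid.one = undefined,
       ring.zero = (\<zero>\<^bsub>sec F U\<^esub>, \<zero>\<^bsub>sec G U\<^esub>),
       ring.add = (\<lambda>(s, t) (s', t'). (s \<oplus>\<^bsub>sec F U\<^esub> s', t \<oplus>\<^bsub>sec G U\<^esub> t')),
       smult = (\<lambda>r (s, t). (r \<odot>\<^bsub>sec F U\<^esub> s, r \<odot>\<^bsub>sec G U\<^esub> t))\<rparr>),
     res = (\<lambda>U V. map_prod (res F U V) (res G U V))\<rparr>"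

definition locally_free_rank_two :: "'m omod \<Rightarrow> bool" where
  "locally_free_rank_two E \<longleftrightarrow> sheaf_of_modules E \<and>
     (\<forall>x\<in>P1. \<exists>W. openin zariski W \<and> x \<in> W \<and> isomorphic_on W E (direct_sum (twist 0) (twist 0)))"

definition decomposable :: "'m omod \<Rightarrow> bool" where
  "decomposable E \<longleftrightarrow> (\<exists>r s. isomorphic_on P1 E (direct_sum (twist r) (twist s)))"

abbreviation indecomposable :: "'m omod \<Rightarrow> bool" where
  "indecomposable E \<equiv> \<not> decomposable E"


section \<open>Tensor products\<close>

text \<open>
  The tensor product of two modules is the free abelian group on the pairs (m,n) modulo the
  subgroup generated by the bilinearity and balancing relations.
\<close>
definition tensor_relations :: "'r ring \<Rightarrow> ('r, 'm) module \<Rightarrow> ('r, 'n) module \<Rightarrow> ('m \<times> 'n \<Rightarrow>\<^sub>0 int) set" where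
  "tensor_relations R M N = generate (free_Abelian_group (carrier M \<times> carrier N))
     ({frag_of (m \<oplus>\<^bsub>M\<^esub> m', n) - frag_of (m, n) - frag_of (m', n) |m m' n.
         m \<in> carrier M \<and> m' \<in> carrier M \<and> n \<in> carrier N} \<union>
      {frag_of (m, n \<oplus>\<^bsub>N\<^esub> n') - frag_of (m, n) - frag_of (m, n') |m n n'.
         m \<in> carrier M \<and> n \<in> carrier N \<and> n' \<in> carrier N} \<union>
      {frag_of (r \<odot>\<^bsub>M\<^esub> m, n) - frag_of (m, r \<odot>\<^bsub>N\<^esub> n) |r m n.
         r \<in> carrier R \<and> m \<in> carrier M \<and> n \<in> carrier N})"

definition tensor_group :: "'r ring \<Rightarrow> ('r, 'm) module \<Rightarrow> ('r, 'n) module \<Rightarrow> ('m \<times> 'n \<Rightarrow>\<^sub>0 int) set monoid" where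
  "tensor_group R M N =
     free_Abelian_group (carrier M \<times> carrier N) Mod tensor_relations R M N"

text \<open>
  The map of tensor products induced by a map f on pairs of generators; the cosets in the union
  all coincide when f respects the relations.
\<close>
definition tensor_lift ::
    "'r ring \<Rightarrow> ('r, 'm) module \<Rightarrow> ('r, 'n) module \<Rightarrow> ('k \<Rightarrow> 'm \<times> 'n) \<Rightarrow>
     ('k \<Rightarrow>\<^sub>0 int) set \<Rightarrow> ('m \<times> 'n \<Rightarrow>\<^sub>0 int) set" where
  "tensor_lift R M N f C = (\<Union>c\<in>C. tensor_relations R M N
     #>\<^bsub>free_Abelian_group (carrier M \<times> carrier N)\<^esub> frag_extend (\<lambda>k. frag_of (f k)) c)"

definition tensor_module ::
    "'r ring \<Rightarrow> ('r, 'm) module \<Rightarrow> ('r, 'n) module \<Rightarrow> ('r, ('m \<times> 'n \<Rightarrow>\<^sub>0 int) set) module" where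
  "tensor_module R M N =
     \<lparr>carrier = carrier (tensor_group R M N), monoid.mult = undefined, monoid.one = undefined,
      ring.zero = \<one>\<^bsub>tensor_group R M N\<^esub>, ring.add = monoid.mult (tensor_group R M N),
      smult = (\<lambda>r. tensor_lift R M N (\<lambda>(m, n). (r \<odot>\<^bsub>M\<^esub> m, n)))\<rparr>"

definition tensor_presheaf :: "'m omod \<Rightarrow> 'n omod \<Rightarrow> ('m \<times> 'n \<Rightarrow>\<^sub>0 int) set omod" where
  "tensor_presheaf F G =
     \<lparr>sec = (\<lambda>U. tensor_module (OX U) (sec F U) (sec G U)),
      res = (\<lambda>U V. tensor_lift (OX V) (sec F V) (sec G V) (map_prod (res F U V) (res G U V)))\<rparr>"

text \<open>The germ at x of a section s over U, as a class of pairs (neighbourhood of x, section).\<close>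
definition germ :: "'m omod \<Rightarrow> pt \<Rightarrow> pt set \<Rightarrow> 'm \<Rightarrow> (pt set \<times> 'm) set" where
  "germ F x U s = {(V, t). openin zariski V \<and> x \<in> V \<and> t \<in> carrier (sec F V) \<and>
     (\<exists>W. openin zariski W \<and> x \<in> W \<and> W \<subseteq> U \<inter> V \<and> res F U W s = res F V W t)}"

text \<open>
  Sum and scalar multiple of germs; the germs in the unions do not depend on the representatives.
\<close>
definition germ_add ::
    "'m omod \<Rightarrow> pt \<Rightarrow> (pt set \<times> 'm) set \<Rightarrow> (pt set \<times> 'm) set \<Rightarrow> (pt set \<times> 'm) set" where
  "germ_add F x A B = (\<Union>(V, s)\<in>A. \<Union>(W, t)\<in>B.
     germ F x (V \<inter> W) (res F V (V \<inter> W) s \<oplus>\<^bsub>sec F (V \<inter> W)\<^esub> res F W (V \<inter> W) t))"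

definition germ_smult ::
    "'m omod \<Rightarrow> pt \<Rightarrow> pt set \<Rightarrow> fn \<Rightarrow> (pt set \<times> 'm) set \<Rightarrow> (pt set \<times> 'm) set" where
  "germ_smult F x U r A = (\<Union>(V, s)\<in>A.
     germ F x (U \<inter> V) (restrict r (U \<inter> V) \<odot>\<^bsub>sec F (U \<inter> V)\<^esub> res F V (U \<inter> V) s))"

definition sheafification :: "'m omod \<Rightarrow> (pt \<Rightarrow> (pt set \<times> 'm) set) omod" where
  "sheafification F = \<lparr>sec = (\<lambda>U.
      \<lparr>carrier = {\<sigma> \<in> extensional U. \<forall>x\<in>U. \<exists>V. openin zariski V \<and> x \<in> V \<and> V \<subseteq> U \<and>
         (\<exists>s\<in>carrier (sec F V). \<forall>y\<in>V. \<sigma> y = germ F y V s)},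
       monoid.mult = undefined, monoid.one = undefined,
       ring.zero = (\<lambda>x\<in>U. germ F x U \<zero>\<^bsub>sec F U\<^esub>),
       ring.add = (\<lambda>\<sigma> \<tau>. \<lambda>x\<in>U. germ_add F x (\<sigma> x) (\<tau> x)),
       smult = (\<lambda>r \<sigma>. \<lambda>x\<in>U. germ_smult F x U r (\<sigma> x))\<rparr>),
     res = (\<lambda>U V \<sigma>. restrict \<sigma> V)\<rparr>"

definition tensor_sheaf ::
    "'m omod \<Rightarrow> 'n omod \<Rightarrow> (pt \<Rightarrow> (pt set \<times> ('m \<times> 'n \<Rightarrow>\<^sub>0 int) set) set) omod" where
  "tensor_sheaf F G = sheafification (tensor_presheaf F G)"


section \<open>Closed subschemes\<close>

text \<open>
  A closed subscheme Z is given by its ideal sheaf I, a sheaf of ideals which is locally generated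
  by sections (equivalently, is quasi-coherent). The underlying set of Z is the
  support of O/I, and its structure sheaf is O/I.
\<close>
type_synonym subscheme = "pt set \<Rightarrow> fn set"

definition sheaf_of_ideals :: "subscheme \<Rightarrow> bool" where
  "sheaf_of_ideals I \<longleftrightarrow>
     (\<forall>U. openin zariski U \<longrightarrow> ideal (I U) (OX U)) \<and>
     (\<forall>U V. openin zariski U \<and> openin zariski V \<and> V \<subseteq> U \<longrightarrow> (\<forall>s\<in>I U. restrict s V \<in> I V)) \<and>
     (\<forall>U. openin zariski U \<longrightarrow> (\<forall>s\<in>carrier (OX U).
        (\<forall>x\<in>U. \<exists>V. openin zariski V \<and> x \<in> V \<and> V \<subseteq> U \<and> restrict s V \<in> I V) \<longrightarrow> s \<in> I U))"

text \<open>
  The stalk of I at x inside the local ring at x. The germ at x of a regular function is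
  determined by its value at x in the fraction field.
\<close>
definition ideal_stalk :: "subscheme \<Rightarrow> pt \<Rightarrow> rat_fun set" where
  "ideal_stalk I x = {s x |s U. openin zariski U \<and> x \<in> U \<and> s \<in> I U}"

definition closed_subscheme :: "subscheme \<Rightarrow> bool" where
  "closed_subscheme I \<longleftrightarrow> sheaf_of_ideals I \<and>
     (\<forall>x\<in>P1. \<exists>W. openin zariski W \<and> x \<in> W \<and>
        (\<exists>S \<subseteq> I W. \<forall>y\<in>W. ideal_stalk I y = Idl\<^bsub>local_ring y\<^esub> ((\<lambda>s. s y) ` S)))"

definition points :: "subscheme \<Rightarrow> pt set" where
  "points I = {x \<in> P1. ideal_stalk I x \<noteq> carrier (local_ring x)}"

definition regular_sequence :: "'r ring \<Rightarrow> 'r list \<Rightarrow> bool" where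
  "regular_sequence R fs \<longleftrightarrow> set fs \<subseteq> carrier R \<and>
     (\<forall>i<length fs. \<forall>h\<in>carrier R.
        fs ! i \<otimes>\<^bsub>R\<^esub> h \<in> Idl\<^bsub>R\<^esub> (set (take i fs)) \<longrightarrow> h \<in> Idl\<^bsub>R\<^esub> (set (take i fs))) \<and>
     Idl\<^bsub>R\<^esub> (set fs) \<noteq> carrier R"

definition lci_codim_two :: "subscheme \<Rightarrow> bool" where
  "lci_codim_two I \<longleftrightarrow> closed_subscheme I \<and>
     (\<forall>x\<in>points I. \<exists>f g. regular_sequence (local_ring x) [f, g] \<and>
        ideal_stalk I x = Idl\<^bsub>local_ring x\<^esub> {f, g})"

definition ideal_sheaf :: "subscheme \<Rightarrow> fn omod" where
  "ideal_sheaf I = \<lparr>sec = (\<lambda>U. (sec (twist 0) U)\<lparr>carrier := I U\<rparr>), res = res (twist 0)\<rparr>"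

definition twisted_ideal_sheaf where  \<comment> \<open>the sheaf \<open>I\<^sub>Z(b)\<close>\<close>
  "twisted_ideal_sheaf I b = tensor_sheaf (ideal_sheaf I) (twist b)"

definition associated_triple :: "'m omod \<Rightarrow> int \<Rightarrow> int \<Rightarrow> subscheme \<Rightarrow> bool" where
  "associated_triple E a b Z \<longleftrightarrow> a \<ge> b \<and> lci_codim_two Z \<and>
     short_exact_sequence (twist a) E (twisted_ideal_sheaf Z b)"

end

theory Submission
  imports Defs "HOL-Computational_Algebra.Polynomial_Factorial"
begin

text \<open>
  The zero ideal is a point lying in every nonempty open set, so sections of O(n) are elements of
  the fraction field of Z[x,y] that are regular of degree n at every point of the open set, and
  morphisms O(m) \<open>\<rightarrow>\<close> O(n) are multiplications by forms of degree n - m.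

  If Z is empty, E is an extension of O(b) by O(a), and it splits since the first cohomology of
  O(a - b) vanishes: the differences of local lifts of generators of O(b) form a Cousin problem in
  the fraction field, solved on the charts x \<open>\<noteq>\<close> 0 and y \<open>\<noteq>\<close> 0 by partitions of unity; the two
  solutions differ by h / (xy)^N, which splits as a - b \<open>\<ge>\<close> -1.

  Conversely let E be O(r) + O(s), with O(a) \<open>\<rightarrow>\<close> E given by (f, g) and E \<open>\<rightarrow>\<close> O(b) by (p, q), so that
  pf + qg = 0. If p or q is zero, the ideal of Z is locally principal. Otherwise f, g, p, q are
  nonzero, whence a \<open>\<le>\<close> r \<open>\<le>\<close> b \<open>\<le>\<close> a, likewise for s, so p and q are integers and the ideal is again
  locally principal. An ideal generated by a regular sequence of length two is not principal.
\<close>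

text \<open>Over a field the last step of the converse would be immediate, because nonzero constants
  are units. Over the integers \<open>p\<close> and \<open>q\<close> may be constants without being
  units at the point in question, and it is Bezout's identity in Z that makes the ideal they
  generate principal.

  Factoriality of Z[x,y] controls denominators: in lowest terms, a prime factor of the denominator
  of a rational function marks a point at which the function is not regular. So a function regular
  on the open set f \<noteq> 0 has a power of f as denominator, and a function regular everywhere is
  a polynomial.

  The sheaf I_Z(b) is a sheafified quotient of free abelian groups. To make exactness usable it is
  first embedded into O(b): a tensor of m and e has the value m e in the fraction field, and this
  value determines the germ. The quotient map of the extension then becomes an ordinary morphism
  from E to O(b), whose image is described by local products.\<close>

abbreviation "zopen \<equiv> openin zariski"


section \<open>Forms\<close>

lemma zero_form [simp]: "0 \<in> form d" by (simp add: form_def)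

lemma add_form: "f \<in> form d \<Longrightarrow> g \<in> form d \<Longrightarrow> f + g \<in> form d"
  unfolding form_def by (auto, metis add.right_neutral add_0)

lemma uminus_form: "f \<in> form d \<Longrightarrow> - f \<in> form d"
  by (simp add: form_def)

lemma const_form: "[:[:c:]:] \<in> form 0"
  by (auto simp: form_def coeff_pCons split: nat.splits)

lemma one_form [simp]: "1 \<in> form 0"
  using const_form[of 1] by (simp add: one_pCons)

lemma form_0_const: "f \<in> form 0 \<Longrightarrow> f = [:[:coeff (coeff f 0) 0:]:]"
  by (rule poly_eqI, rule poly_eqI) (auto simp: form_def coeff_pCons split: nat.splits)

lemma power_form: "f \<in> form d \<Longrightarrow> f ^ n \<in> form (n * d)"
  by (induction n) (auto dest: form_mult)

lemma form_degree_unique: "f \<in> form d \<Longrightarrow> f \<in> form e \<Longrightarrow> f \<noteq> 0 \<Longrightarrow> d = e"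
proof -
  assume f: "f \<in> form d" "f \<in> form e" "f \<noteq> 0"
  obtain i where "coeff f i \<noteq> 0" using f(3) by (metis leading_coeff_0_iff)
  then obtain j where "coeff (coeff f i) j \<noteq> 0" by (metis leading_coeff_0_iff)
  with f(1,2) show ?thesis by (auto simp: form_def)
qed

definition xv :: zxy where "xv = [:[:0, 1:]:]"
definition yv :: zxy where "yv = [:0, 1:]"

lemma xv_form: "xv \<in> form 1" and yv_form: "yv \<in> form 1"
  by (auto simp: form_def xv_def yv_def coeff_pCons one_pCons split: nat.splits)

lemma xv_nz [simp]: "xv \<noteq> 0" and yv_nz [simp]: "yv \<noteq> 0"
  by (auto simp: xv_def yv_def)

section \<open>Homogeneous components\<close>

definition hcomp :: "nat \<Rightarrow> zxy \<Rightarrow> zxy" where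
  "hcomp d f = (\<Sum>i\<le>d. monom (monom (coeff (coeff f i) (d - i)) (d - i)) i)"

lemma coeff_hcomp: "coeff (coeff (hcomp d f) i) j = (if i + j = d then coeff (coeff f i) j else 0)"
proof -
  have *: "coeff (coeff (monom (monom (coeff (coeff f k) (d - k)) (d - k)) k) i) j
     = (if k = i then (if d - i = j then coeff (coeff f i) j else 0) else 0)" for k
    by (auto simp: coeff_monom)
  have "coeff (coeff (hcomp d f) i) j =
     (\<Sum>k\<le>d. if k = i then (if d - i = j then coeff (coeff f i) j else 0) else 0)"
    by (simp add: hcomp_def coeff_sum * cong: sum.cong)
  also have "\<dots> = (if i + j = d then coeff (coeff f i) j else 0)"
    by (subst sum.delta) auto
  finally show ?thesis .
qed

lemma hcomp_form: "hcomp d f \<in> form d"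
  by (auto simp: form_def coeff_hcomp split: if_splits)

lemma hcomp_of_form: "f \<in> form d \<Longrightarrow> hcomp e f = (if e = d then f else 0)"
  by (rule poly_eqI, rule poly_eqI) (auto simp: form_def coeff_hcomp)

lemma hcomp_add: "hcomp d (f + g) = hcomp d f + hcomp d g"
  by (rule poly_eqI, rule poly_eqI) (simp add: coeff_hcomp)

lemma hcomp_0 [simp]: "hcomp d 0 = 0"
  by (rule poly_eqI, rule poly_eqI) (simp add: coeff_hcomp)

lemma hcomp_sum: "hcomp d (sum f A) = (\<Sum>a\<in>A. hcomp d (f a))"
  by (induction A rule: infinite_finite_induct) (auto simp: hcomp_add)

text \<open>Valid for all large \<open>M\<close> rather than for one bound, so that two polynomials
  can be expanded over the same range.\<close>

lemma sum_hcomp: "\<exists>N. \<forall>M\<ge>N. f = (\<Sum>d\<le>M. hcomp d f)"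
proof -
  define N where "N = degree f + (\<Sum>i\<le>degree f. degree (coeff f i))"
  have "f = (\<Sum>d\<le>M. hcomp d f)" if "M \<ge> N" for M
  proof (rule poly_eqI, rule poly_eqI)
    fix i j
    have "coeff (coeff (\<Sum>d\<le>M. hcomp d f) i) j = (\<Sum>d\<le>M. if d = i + j then coeff (coeff f i) j else 0)"
      by (simp add: coeff_sum coeff_hcomp eq_commute)
    also have "\<dots> = (if i + j \<le> M then coeff (coeff f i) j else 0)" by (subst sum.delta) auto
    also have "\<dots> = coeff (coeff f i) j"
    proof (cases "coeff (coeff f i) j = 0")
      case False
      then have "i \<le> degree f" by (metis coeff_0 le_degree)
      moreover have "j \<le> degree (coeff f i)" using False le_degree by blast
      moreover have "degree (coeff f i) \<le> (\<Sum>i\<le>degree f. degree (coeff f i))"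
        using \<open>i \<le> degree f\<close> by (intro member_le_sum) auto
      ultimately have "i + j \<le> N" unfolding N_def by linarith
      then show ?thesis using that by simp
    qed auto
    finally show "coeff (coeff f i) j = coeff (coeff (\<Sum>d\<le>M. hcomp d f) i) j" by simp
  qed
  then show ?thesis by blast
qed

lemma hcomp_mult: "hcomp n (f * g) = (\<Sum>k\<le>n. hcomp k f * hcomp (n - k) g)"
proof -
  obtain N1 where N1: "\<forall>M\<ge>N1. f = (\<Sum>d\<le>M. hcomp d f)" using sum_hcomp by blast
  obtain N2 where N2: "\<forall>M\<ge>N2. g = (\<Sum>d\<le>M. hcomp d g)" using sum_hcomp by blast
  \<comment> \<open>\<open>M\<close> exceeds both expansion bounds, and M \<ge> n keeps each
    complementary index \<open>n - a\<close> inside the range of the second sum.\<close>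
  define M where "M = n + N1 + N2"
  have f: "f = (\<Sum>d\<le>M. hcomp d f)" and g: "g = (\<Sum>d\<le>M. hcomp d g)"
    using N1 N2 by (auto simp: M_def)
  have fg: "hcomp a f * hcomp b g \<in> form (a + b)" for a b by (intro form_mult hcomp_form)
  have "f * g = (\<Sum>a\<le>M. \<Sum>b\<le>M. hcomp a f * hcomp b g)"
    using arg_cong2[OF f g, of "(*)"] by (simp add: sum_product)
  then have "hcomp n (f * g) = (\<Sum>a\<le>M. \<Sum>b\<le>M. if n = a + b then hcomp a f * hcomp b g else 0)"
    by (simp add: hcomp_sum hcomp_of_form[OF fg])
  also have "\<dots> = (\<Sum>a\<le>M. if a \<le> n then hcomp a f * hcomp (n - a) g else 0)"
  proof (rule sum.cong[OF refl])
    fix a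
    show "(\<Sum>b\<le>M. if n = a + b then hcomp a f * hcomp b g else 0)
       = (if a \<le> n then hcomp a f * hcomp (n - a) g else 0)"
    proof (cases "a \<le> n")
      case True
      then have "(\<Sum>b\<le>M. if n = a + b then hcomp a f * hcomp b g else 0)
        = (\<Sum>b\<le>M. if b = n - a then hcomp a f * hcomp b g else 0)"
        by (intro sum.cong) auto
      also have "\<dots> = hcomp a f * hcomp (n - a) g"
        by (subst sum.delta) (auto simp: M_def)
      finally show ?thesis using True by simp
    qed auto
  qed
  also have "\<dots> = (\<Sum>a\<in>{..M} \<inter> {a. a \<le> n}. hcomp a f * hcomp (n - a) g)"
    by (subst sum.inter_restrict) auto
  also have "{..M} \<inter> {a. a \<le> n} = {..n}" by (auto simp: M_def)
  finally show ?thesis .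
qed

lemma hcomp_nonzero: "f \<noteq> 0 \<Longrightarrow> \<exists>d. hcomp d f \<noteq> 0"
  using sum_hcomp[of f] by (metis (no_types, lifting) order_refl sum.neutral)

lemma finite_hcomp: "finite {d. hcomp d f \<noteq> 0}"
proof -
  obtain N where N: "\<forall>M\<ge>N. f = (\<Sum>d\<le>M. hcomp d f)" using sum_hcomp by blast
  have "hcomp d f = 0" if "d > N" for d
  proof -
    have "hcomp d f = hcomp d (\<Sum>d\<le>N. hcomp d f)" using N by auto
    also have "\<dots> = 0" using that by (simp add: hcomp_sum hcomp_of_form[OF hcomp_form])
    finally show ?thesis .
  qed
  then have "{d. hcomp d f \<noteq> 0} \<subseteq> {..N}" by (auto simp: not_less[symmetric])
  then show ?thesis using finite_subset by blast
qed

lemma form_iff_hcomp: "f \<in> form d \<longleftrightarrow> (\<forall>e. e \<noteq> d \<longrightarrow> hcomp e f = 0)"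
proof
  assume *: "\<forall>e. e \<noteq> d \<longrightarrow> hcomp e f = 0"
  show "f \<in> form d" unfolding form_def
  proof safe
    fix i j assume "coeff (coeff f i) j \<noteq> 0"
    then have "hcomp (i + j) f \<noteq> 0" using coeff_hcomp[of "i + j" f i j] by auto
    then show "i + j = d" using * by blast
  qed
qed (simp add: hcomp_of_form)

text \<open>The products of the lowest and of the highest components of the factors are components of
  the product, which has just one.\<close>
lemma form_factors:
  assumes "f * g \<in> form n" "f * g \<noteq> 0"
  shows "\<exists>i j. f \<in> form i \<and> g \<in> form j \<and> i + j = n"
proof -
  define A where "A = {d. hcomp d f \<noteq> 0}"
  define B where "B = {d. hcomp d g \<noteq> 0}"
  have fin: "finite A" "finite B" by (simp_all add: A_def B_def finite_hcomp)
  have ne: "A \<noteq> {}" "B \<noteq> {}" using hcomp_nonzero assms(2) by (fastforce simp: A_def B_def)+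
  \<comment> \<open>If no other pair of occurring degrees has the sum i + j, then the component of
    \<open>f * g\<close> in this degree is a single product of nonzero elements of a domain. It
    survives, which forces i + j = n.\<close>
  have extremal: "i + j = n" if ij: "i \<in> A" "j \<in> B" and
    ext: "\<And>a b. a \<in> A \<Longrightarrow> b \<in> B \<Longrightarrow> a + b = i + j \<Longrightarrow> a = i" for i j
  proof -
    have "hcomp (i + j) (f * g) = (\<Sum>k\<le>i+j. if k = i then hcomp i f * hcomp j g else 0)"
      unfolding hcomp_mult
    proof (rule sum.cong[OF refl])
      fix k assume k: "k \<in> {..i + j}"
      show "hcomp k f * hcomp (i + j - k) g = (if k = i then hcomp i f * hcomp j g else 0)"
      proof (cases "k = i")
        case False
        then have "k \<notin> A \<or> i + j - k \<notin> B" using ext[of k "i + j - k"] k by auto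
        then show ?thesis using False by (auto simp: A_def B_def)
      qed auto
    qed
    also have "\<dots> = hcomp i f * hcomp j g" by (subst sum.delta) auto
    finally have "hcomp (i + j) (f * g) \<noteq> 0" using ij by (auto simp: A_def B_def)
    then show ?thesis using assms(1) by (metis hcomp_of_form)
  qed
  have "Min A + Min B = n"
  proof (rule extremal)
    fix a b assume "a \<in> A" "b \<in> B" "a + b = Min A + Min B"
    moreover have "Min A \<le> a" "Min B \<le> b" using fin calculation by auto
    ultimately show "a = Min A" by linarith
  qed (use fin ne in auto)
  moreover have "Max A + Max B = n"
  proof (rule extremal)
    fix a b assume "a \<in> A" "b \<in> B" "a + b = Max A + Max B"
    moreover have "Max A \<ge> a" "Max B \<ge> b" using fin calculation by auto
    ultimately show "a = Max A" by linarith
  qed (use fin ne in auto)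
  moreover have "Min A \<le> Max A" "Min B \<le> Max B" using fin ne by (auto intro: Min_le Max_in)
  \<comment> \<open>The two minima and the two maxima have the same sum n, which leaves no gap
    between minimum and maximum.\<close>
  ultimately have eq: "Min A = Max A" "Min B = Max B" by linarith+
  have "f \<in> form (Min A)" unfolding form_iff_hcomp
  proof safe
    fix e assume "e \<noteq> Min A"
    then have "e \<notin> A" using eq fin by (metis Max_ge Min_le order_antisym)
    then show "hcomp e f = 0" by (simp add: A_def)
  qed
  moreover have "g \<in> form (Min B)" unfolding form_iff_hcomp
  proof safe
    fix e assume "e \<noteq> Min B"
    then have "e \<notin> B" using eq fin by (metis Max_ge Min_le order_antisym)
    then show "hcomp e g = 0" by (simp add: B_def)
  qed
  ultimately show ?thesis using \<open>Min A + Min B = n\<close> by blast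
qed

text \<open>There is no constant term: split off the part divisible by y, and the rest is divisible
  by x. Hence an ideal containing x and y contains all forms of positive degree.\<close>

lemma form_pos_decomp:
  assumes "f \<in> form d" "d > 0"
  shows "\<exists>g h. f = xv * g + yv * h"
proof -
  obtain c h where f: "f = pCons c h" by (cases f)
  obtain n c' where c: "c = pCons n c'" by (cases c)
  have "coeff (coeff f 0) 0 = 0" using assms unfolding form_def by fastforce
  then have "n = 0" by (simp add: f c)
  then have "f = xv * [:c':] + yv * h" by (simp add: f c xv_def yv_def)
  then show ?thesis by blast
qed

text \<open>A monomial x^j y^i with i, j < N has degree at most 2N - 2, so none of them occurs in
  \<open>h\<close>. \<open>B\<close> collects the monomials with i \<ge> N and \<open>A\<close>
  those with i < N, each divided by its power. For m = 2N + n this is the vanishing of the first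
  cohomology of O(n), and the bound n \<ge> -1 comes from here.\<close>

lemma form_split:
  assumes h: "h \<in> form m" and m: "2 * N \<le> m + 1"
  shows "\<exists>A B. A \<in> form (m - N) \<and> B \<in> form (m - N) \<and> h = xv ^ N * A + yv ^ N * B"
proof -
  define A :: zxy where "A = map_poly (poly_shift N) (poly_cutoff N h)"
  define B where "B = poly_shift N h"
  have xN: "xv ^ N = [:monom 1 N:]"
    by (induction N) (auto simp: xv_def monom_Suc one_pCons monom_0)
  have yN: "yv ^ N = monom 1 N"
    by (simp add: yv_def monom_altdef)
  have "B \<in> form (m - N)" using h by (fastforce simp: form_def B_def coeff_poly_shift)
  moreover have "A \<in> form (m - N)" using h
    by (fastforce simp: form_def A_def coeff_poly_shift coeff_map_poly coeff_poly_cutoff split: if_splits)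
  moreover have "h = xv ^ N * A + yv ^ N * B"
  proof (rule poly_eqI, rule poly_eqI)
    fix i j
    have 1: "coeff (coeff (xv ^ N * A) i) j =
        (if N \<le> j \<and> i < N then coeff (coeff h i) j else 0)"
      unfolding xN by (auto simp: A_def coeff_map_poly coeff_poly_cutoff coeff_monom_mult coeff_poly_shift)
    have 2: "coeff (coeff (yv ^ N * B) i) j = (if N \<le> i then coeff (coeff h i) j else 0)"
      unfolding yN by (auto simp: B_def coeff_monom_mult coeff_poly_shift)
    have "coeff (coeff h i) j = 0" if "i < N" "j < N"
      using h m that by (force simp: form_def)
    then show "coeff (coeff h i) j = coeff (coeff (xv ^ N * A + yv ^ N * B) i) j"
      by (auto simp: 1 2)
  qed
  ultimately show ?thesis by blast
qed


section \<open>Points\<close>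

lemma cring_Zxy: "cring Zxy"
proof (rule cringI)
  show "abelian_group Zxy"
    by (rule abelian_groupI) (auto simp: Zxy_def intro: exI[of _ "- _"] ab_left_minus)
  show "Group.comm_monoid Zxy"
    by (rule comm_monoidI) (auto simp: Zxy_def)
qed (auto simp: Zxy_def algebra_simps)

lemma Zxy_simps [simp]: "carrier Zxy = UNIV" "\<zero>\<^bsub>Zxy\<^esub> = 0" "\<one>\<^bsub>Zxy\<^esub> = 1"
   "f \<oplus>\<^bsub>Zxy\<^esub> g = f + g" "f \<otimes>\<^bsub>Zxy\<^esub> g = f * g"
  by (simp_all add: Zxy_def)

lemma a_inv_Zxy [simp]: "\<ominus>\<^bsub>Zxy\<^esub> f = - f"
proof -
  interpret cring Zxy by (rule cring_Zxy)
  show ?thesis using minus_equality[of "- f" f] by simp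
qed

lemma ideal_ZxyI:
  assumes "0 \<in> J" "\<And>f g. f \<in> J \<Longrightarrow> g \<in> J \<Longrightarrow> f + g \<in> J" "\<And>f g. f \<in> J \<Longrightarrow> g * f \<in> J"
  shows "ideal J Zxy"
proof -
  interpret cring Zxy by (rule cring_Zxy)
  have "- f \<in> J" if "f \<in> J" for f using assms(3)[OF that, of "-1"] by simp
  then have "subgroup J (add_monoid Zxy)"
    using assms by (intro add.subgroupI) (auto simp: a_inv_def[symmetric])
  then show ?thesis using assms(3)
    by (intro idealI ring_axioms) (auto simp: mult.commute)
qed

lemma ideal_Zxy_add: "ideal J Zxy \<Longrightarrow> f \<in> J \<Longrightarrow> g \<in> J \<Longrightarrow> f + g \<in> J"
  using additive_subgroup.a_closed[OF ideal.axioms(1), of J Zxy f g] by simp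

lemma ideal_Zxy_mult: "ideal J Zxy \<Longrightarrow> f \<in> J \<Longrightarrow> g * f \<in> J"
  using ideal.I_l_closed[of J Zxy f g] by simp

lemma ideal_Zxy_sum:
  assumes "ideal J Zxy" "\<And>a. a \<in> A \<Longrightarrow> f a \<in> J" shows "sum f A \<in> J"
  using assms(2)
proof (induction A rule: infinite_finite_induct)
  case empty
  show ?case using additive_subgroup.zero_closed[OF ideal.axioms(1)[OF assms(1)]] by simp
next
  case (infinite A)
  show ?case using infinite(1) additive_subgroup.zero_closed[OF ideal.axioms(1)[OF assms(1)]] by simp
qed (auto intro: ideal_Zxy_add[OF assms(1)])

lemma pt_ideal: "p \<in> P1 \<Longrightarrow> ideal p Zxy"
  by (simp add: P1_def primeideal_def)

lemma pt_add: "p \<in> P1 \<Longrightarrow> f \<in> p \<Longrightarrow> g \<in> p \<Longrightarrow> f + g \<in> p"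
  using ideal_Zxy_add pt_ideal by blast

lemma pt_mult: "p \<in> P1 \<Longrightarrow> f \<in> p \<Longrightarrow> g * f \<in> p"
  using ideal_Zxy_mult pt_ideal by blast

lemma pt_zero: "p \<in> P1 \<Longrightarrow> 0 \<in> p"
  using additive_subgroup.zero_closed[OF ideal.axioms(1)[OF pt_ideal]] by simp

lemma pt_prime: "p \<in> P1 \<Longrightarrow> f \<notin> p \<Longrightarrow> g \<notin> p \<Longrightarrow> f * g \<notin> p"
  using primeideal.I_prime[of p Zxy f g] by (auto simp: P1_def)

lemma pt_one: "p \<in> P1 \<Longrightarrow> 1 \<notin> p"
proof
  assume p: "p \<in> P1" "1 \<in> p"
  then have "p = UNIV" using pt_mult[of p 1] by force
  moreover have "carrier Zxy \<noteq> p" using p(1) by (auto simp: P1_def intro: primeideal.I_notcarr)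
  ultimately show False by simp
qed

lemma pt_power: "p \<in> P1 \<Longrightarrow> f \<notin> p \<Longrightarrow> f ^ n \<notin> p"
  by (induction n) (auto simp: pt_one pt_prime)

text \<open>A prime containing x and y would contain the irrelevant ideal, which \<open>P1\<close>
  excludes. So the two charts cover the line.\<close>

lemma pt_chart: assumes p: "p \<in> P1" shows "xv \<notin> p \<or> yv \<notin> p"
proof (rule ccontr)
  assume *: "\<not> ?thesis"
  interpret cring Zxy by (rule cring_Zxy)
  have "f \<in> p" if "f \<in> form d" "d > 0" for f d
    using form_pos_decomp[OF that] * p pt_add pt_mult by (metis mult.commute)
  then have "irrelevant_ideal \<subseteq> p" unfolding irrelevant_ideal_def
    by (intro genideal_minimal pt_ideal[OF p]) auto
  with p show False by (simp add: P1_def)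
qed

text \<open>Homogeneity is phrased through finite sums of multiples of forms in \<open>p\<close>,
  which keeps generated ideals out of the applications. The linear form \<open>l\<close> outside
  \<open>p\<close> yields properness and excludes the irrelevant ideal at once.\<close>

lemma P1I:
  assumes "0 \<in> p" "\<And>f g. f \<in> p \<Longrightarrow> g \<in> p \<Longrightarrow> f + g \<in> p" "\<And>f g. f \<in> p \<Longrightarrow> g * f \<in> p"
    and "\<And>f g. f * g \<in> p \<Longrightarrow> f \<in> p \<or> g \<in> p"
    and hom: "\<And>f. f \<in> p \<Longrightarrow> \<exists>A. finite A \<and> (\<forall>a\<in>A. fst a \<in> p \<inter> (\<Union>d. form d)) \<and> f = (\<Sum>a\<in>A. snd a * fst a)"
    and l: "l \<in> form 1" "l \<notin> p"
  shows "p \<in> P1"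
proof -
  interpret cring Zxy by (rule cring_Zxy)
  have id: "ideal p Zxy" using assms(1-3) by (rule ideal_ZxyI)
  have "p = Idl\<^bsub>Zxy\<^esub> (p \<inter> (\<Union>d. form d))" (is "_ = ?I")
  proof
    show "?I \<subseteq> p" by (intro genideal_minimal id) auto
    have I: "ideal ?I Zxy" by (rule genideal_ideal) auto
    have sub: "p \<inter> (\<Union>d. form d) \<subseteq> ?I" by (rule genideal_self) auto
    show "p \<subseteq> ?I"
    proof
      fix f assume "f \<in> p"
      from hom[OF this] obtain A where
        A: "\<forall>a\<in>A. fst a \<in> p \<inter> (\<Union>d. form d)" "f = (\<Sum>a\<in>A. snd a * fst a)" by blast
      show "f \<in> ?I" unfolding A(2)
        by (intro ideal_Zxy_sum[OF I] ideal_Zxy_mult[OF I]) (use A(1) sub in blast)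
    qed
  qed
  then have h: "homogeneous_ideal p" using id by (simp add: homogeneous_ideal_def)
  have pr: "primeideal p Zxy"
    by (rule primeidealI[OF id cring_Zxy]) (use l assms(4) in auto)
  have "l \<in> irrelevant_ideal" unfolding irrelevant_ideal_def
  proof -
    have "(\<Union>d\<in>{0<..}. form d) \<subseteq> Idl\<^bsub>Zxy\<^esub> (\<Union>d\<in>{0<..}. form d)" by (rule genideal_self) auto
    then show "l \<in> Idl\<^bsub>Zxy\<^esub> (\<Union>d\<in>{0<..}. form d)" using l(1) by fastforce
  qed
  then show ?thesis using h pr l(2) by (auto simp: P1_def)
qed

definition gpt :: pt where "gpt = {0}"

text \<open>The case \<pi> = 0 is the generic point. The prime forms give points of codimension one,
  at which denominators are tested later.\<close>

lemma principal_prime_P1: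
  assumes "\<pi> = 0 \<or> prime_elem \<pi>" "\<pi> \<in> form d"
  shows "{f. \<pi> dvd f} \<in> P1"
proof -
  have "\<exists>l. l \<in> form 1 \<and> \<not> \<pi> dvd l"
  proof (rule ccontr)
    assume *: "\<not> ?thesis"
    then have x: "\<pi> dvd xv" and y: "\<pi> dvd yv" using xv_form yv_form by blast+
    then have nz: "\<pi> \<noteq> 0" by auto
    obtain k where k: "xv = \<pi> * k" using x by blast
    then have "k \<noteq> 0" by auto
    \<comment> \<open>A divisor of x does not involve y; if it divides y as well, it divides the
      coefficient 1 of y and is a unit.\<close>
    have "degree \<pi> + degree k = 0" using degree_mult_eq[OF nz \<open>k \<noteq> 0\<close>] k by (simp add: xv_def)
    then obtain c where c: "\<pi> = [:c:]" by (metis add_is_0 degree_eq_zeroE)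
    then have "c dvd coeff yv 1" using y by (simp add: const_poly_dvd_iff)
    then have "\<pi> dvd 1" by (simp add: c yv_def is_unit_const_poly_iff)
    then show False using assms(1) nz by (auto simp: prime_elem_def)
  qed
  then obtain l where l: "l \<in> form 1" "\<not> \<pi> dvd l" by blast
  show ?thesis
  proof (rule P1I[OF _ _ _ _ _ l(1)])
    fix f g assume "f * g \<in> {f. \<pi> dvd f}"
    then show "f \<in> {f. \<pi> dvd f} \<or> g \<in> {f. \<pi> dvd f}"
      using assms(1) by (auto simp: prime_elem_dvd_mult_iff)
  next
    fix f assume "f \<in> {f. \<pi> dvd f}"
    then obtain g where "f = g * \<pi>" by (metis dvdE mem_Collect_eq mult.commute)
    then show "\<exists>A. finite A \<and> (\<forall>a\<in>A. fst a \<in> {f. \<pi> dvd f} \<inter> (\<Union>d. form d)) \<and> f = (\<Sum>a\<in>A. snd a * fst a)"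
      using assms(2) by (intro exI[of _ "{(\<pi>, g)}"]) auto
  qed (use l in auto)
qed

lemma gpt_P1: "gpt \<in> P1"
  using principal_prime_P1[of 0 0] by (simp add: gpt_def)

section \<open>Basic open sets and the generic point\<close>

definition basic :: "zxy \<Rightarrow> pt set" where "basic f = {p \<in> P1. f \<notin> p}"

lemma basic_openin: "f \<in> form d \<Longrightarrow> zopen (basic f)"
  unfolding openin_zariski zariski_open_def
  by (intro exI[of _ "{f}"]) (auto simp: basic_def vanishing_locus_def)

lemma openin_sub: "zopen U \<Longrightarrow> U \<subseteq> P1"
  by (auto simp: openin_zariski zariski_open_def)

lemma openin_basic:
  assumes "zopen U" "p \<in> U"
  shows "\<exists>f d. f \<in> form d \<and> p \<in> basic f \<and> basic f \<subseteq> U"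
proof -
  obtain T where T: "T \<subseteq> (\<Union>d. form d)" "U = P1 - vanishing_locus T"
    using assms(1) by (auto simp: openin_zariski zariski_open_def)
  then obtain f where f: "f \<in> T" "f \<notin> p" "p \<in> P1"
    using assms(2) by (auto simp: vanishing_locus_def)
  then obtain d where "f \<in> form d" using T(1) by blast
  moreover have "basic f \<subseteq> U" using f(1) by (auto simp: T(2) basic_def vanishing_locus_def)
  ultimately show ?thesis using f by (auto simp: basic_def)
qed

lemma openin_P1 [simp]: "zopen P1"
proof -
  have "basic 1 = P1" by (auto simp: basic_def pt_one)
  then show ?thesis using basic_openin[OF one_form] by simp
qed

lemma gpt_in_open: "zopen U \<Longrightarrow> p \<in> U \<Longrightarrow> gpt \<in> U"
proof -
  assume "zopen U" "p \<in> U"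
  then obtain f where f: "p \<in> basic f" "basic f \<subseteq> U" using openin_basic by blast
  then have "f \<noteq> 0" using pt_zero by (auto simp: basic_def)
  then show ?thesis using f(2) gpt_P1 by (auto simp: basic_def gpt_def)
qed

lemma chartE:
  assumes "p \<in> P1"
  obtains l where "l = xv \<or> l = yv" "l \<in> form 1" "l \<noteq> 0" "l \<notin> p" "p \<in> basic l"
  using pt_chart[OF assms] assms that[of xv] that[of yv] xv_form yv_form by (auto simp: basic_def)


section \<open>Regular rational functions\<close>

text \<open>The stalk of O(n) at \<open>p\<close>, inside the fraction field. No neighbourhood is
  mentioned, because one fraction serves wherever its denominator does not vanish
  (\<open>reg_open\<close>).\<close>

definition reg :: "int \<Rightarrow> pt \<Rightarrow> rat_fun \<Rightarrow> bool" where
  "reg n p r \<longleftrightarrow> (\<exists>d e h f. h \<in> form e \<and> f \<in> form d \<and> int e = int d + n \<and> f \<notin> p \<and> r = Fract h f)"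

lemma regI: "h \<in> form e \<Longrightarrow> f \<in> form d \<Longrightarrow> int e = int d + n \<Longrightarrow> f \<notin> p \<Longrightarrow> r = Fract h f \<Longrightarrow> reg n p r"
  unfolding reg_def by blast

lemma reg_zero [simp]: assumes p: "p \<in> P1" shows "reg n p 0"
proof -
  obtain l where l: "l \<in> form 1" "l \<notin> p" using chartE[OF p] by metis
  \<comment> \<open>The degree |n| of the denominator makes the degree |n| + n of the numerator
    nonnegative.\<close>
  show ?thesis
    by (rule regI[of 0 "nat (int (nat \<bar>n\<bar>) + n)" "l ^ nat \<bar>n\<bar>" "nat \<bar>n\<bar>"])
      (use l power_form[OF l(1), of "nat \<bar>n\<bar>"] pt_power[OF p] in \<open>auto simp: Fract_conv_to_fract\<close>)
qed

lemma reg_of_form: "p \<in> P1 \<Longrightarrow> h \<in> form e \<Longrightarrow> reg (int e) p (to_fract h)"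
  by (rule regI[of h e 1 0]) (auto simp: pt_one Fract_conv_to_fract)

lemma reg_one [simp]: "p \<in> P1 \<Longrightarrow> reg 0 p 1"
  using reg_of_form[of p 1 0] by simp

lemma reg_inverse_form: "p \<in> P1 \<Longrightarrow> f \<in> form d \<Longrightarrow> f \<notin> p \<Longrightarrow> reg (- int d) p (1 / to_fract f)"
  by (rule regI[of 1 0 f d]) (auto simp: Fract_conv_to_fract)

lemma reg_add: assumes p: "p \<in> P1" and "reg n p r" "reg n p s" shows "reg n p (r + s)"
proof -
  obtain d e h f where 1: "h \<in> form e" "f \<in> form d" "int e = int d + n" "f \<notin> p" "r = Fract h f"
    using assms(2) by (auto simp: reg_def)
  obtain d' e' h' f' where 2: "h' \<in> form e'" "f' \<in> form d'" "int e' = int d' + n" "f' \<notin> p" "s = Fract h' f'"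
    using assms(3) by (auto simp: reg_def)
  have nz: "f \<noteq> 0" "f' \<noteq> 0" using 1(4) 2(4) pt_zero[OF p] by auto
  have e: "e' + d = e + d'" using 1(3) 2(3) by linarith
  show ?thesis
  proof (rule regI[of "h * f' + h' * f" "e + d'" "f * f'" "d + d'"])
    show "h * f' + h' * f \<in> form (e + d')"
      using form_mult[OF 1(1) 2(2)] form_mult[OF 2(1) 1(2)] e by (auto intro: add_form)
  qed (use 1 2 nz e pt_prime[OF p] in \<open>auto intro: form_mult\<close>)
qed

lemma reg_mult: assumes p: "p \<in> P1" and "reg n p r" "reg m p s" shows "reg (n + m) p (r * s)"
proof -
  obtain d e h f where 1: "h \<in> form e" "f \<in> form d" "int e = int d + n" "f \<notin> p" "r = Fract h f"
    using assms(2) by (auto simp: reg_def)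
  obtain d' e' h' f' where 2: "h' \<in> form e'" "f' \<in> form d'" "int e' = int d' + m" "f' \<notin> p" "s = Fract h' f'"
    using assms(3) by (auto simp: reg_def)
  show ?thesis
    by (rule regI[of "h * h'" "e + e'" "f * f'" "d + d'"])
      (use 1 2 pt_prime[OF p] in \<open>auto intro: form_mult\<close>)
qed

text \<open>The degree of the product is a variable of its own, so that integer arithmetic becomes a
  side goal instead of an obstacle to unification.\<close>

lemma reg_mult': "p \<in> P1 \<Longrightarrow> reg n p r \<Longrightarrow> reg m p s \<Longrightarrow> k = n + m \<Longrightarrow> reg k p (r * s)"
  using reg_mult by blast

lemma reg_uminus: "p \<in> P1 \<Longrightarrow> reg n p r \<Longrightarrow> reg n p (- r)"
  using reg_mult[of p 0 "-1" n r] reg_of_form[of p "-1" 0] uminus_form[OF one_form] by simp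

lemma reg_diff: "p \<in> P1 \<Longrightarrow> reg n p r \<Longrightarrow> reg n p s \<Longrightarrow> reg n p (r - s)"
  using reg_add[of p n r "- s"] reg_uminus by simp

lemma reg_sum: "p \<in> P1 \<Longrightarrow> (\<And>a. a \<in> A \<Longrightarrow> reg n p (f a)) \<Longrightarrow> reg n p (sum f A)"
  by (induction A rule: infinite_finite_induct) (auto intro: reg_add)

lemma reg_open:
  assumes "p \<in> P1" "reg n p r" shows "\<exists>V. zopen V \<and> p \<in> V \<and> (\<forall>q\<in>V. reg n q r)"
proof -
  obtain d e h f where 1: "h \<in> form e" "f \<in> form d" "int e = int d + n" "f \<notin> p" "r = Fract h f"
    using assms(2) by (auto simp: reg_def)
  show ?thesis
    by (rule exI[of _ "basic f"]) (use 1 assms(1) basic_openin in \<open>auto simp: basic_def intro: regI\<close>)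
qed

text \<open>A generator of the twist of degree b near any point outside the zero locus of l.\<close>
definition lpow :: "zxy \<Rightarrow> int \<Rightarrow> rat_fun" where "lpow l b = to_fract l powi b"

lemma lpow_nz: "l \<noteq> 0 \<Longrightarrow> lpow l b \<noteq> 0"
  by (simp add: lpow_def power_int_eq_0_iff)

lemma lpow_add: "l \<noteq> 0 \<Longrightarrow> lpow l (a + b) = lpow l a * lpow l b"
  by (simp add: lpow_def power_int_add)

lemma lpow_uminus: "lpow l (- b) = 1 / lpow l b"
  by (simp add: lpow_def power_int_minus_divide)

lemma lpow_nat: "lpow l (int n) = to_fract l ^ n"
  by (simp add: lpow_def)

lemma lpow_0 [simp]: "lpow l 0 = 1"
  by (simp add: lpow_def)

lemma to_fract_power: "to_fract f ^ n = to_fract (f ^ n)"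
  by (induction n) auto

lemma reg_lpow: assumes "p \<in> P1" "l \<in> form 1" "l \<notin> p" shows "reg b p (lpow l b)"
proof (cases b)
  case (nonneg n)
  then show ?thesis using reg_of_form[OF assms(1) power_form[OF assms(2), of n]]
    by (simp add: lpow_nat to_fract_power)
next
  case (neg n)
  show ?thesis using reg_inverse_form[OF assms(1) power_form[OF assms(2), of "Suc n"] pt_power[OF assms(1,3)]]
    unfolding neg lpow_uminus lpow_nat to_fract_power by simp
qed

lemma reg_div_lpow:
  assumes "p \<in> P1" "l \<in> form 1" "l \<notin> p" "reg n p r" "k = n - b" shows "reg k p (r / lpow l b)"
  using reg_mult[OF assms(1) assms(4) reg_lpow[OF assms(1-3), of "-b"]] assms(5)
  by (simp add: lpow_uminus)

section \<open>Denominators and unique factorization\<close>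

lemma form_of_Fract:
  assumes "reg n p r" "p \<in> P1" "r * to_fract g = to_fract h" "g \<in> form d" "g \<noteq> 0" "r \<noteq> 0"
  shows "\<exists>e. h \<in> form e \<and> int e = int d + n"
proof -
  obtain d1 e1 h1 f1 where 1: "h1 \<in> form e1" "f1 \<in> form d1" "int e1 = int d1 + n" "f1 \<notin> p" "r = Fract h1 f1"
    using assms(1) by (auto simp: reg_def)
  have f1: "f1 \<noteq> 0" using 1(4) pt_zero[OF assms(2)] by auto
  have "to_fract (h1 * g) = to_fract (h * f1)"
    using assms(3) f1 unfolding 1(5) Fract_conv_to_fract by (simp add: field_simps)
  \<comment> \<open>So \<open>h\<close> is a factor of a nonzero form and is itself a form. For r =
    0 this would break down: the degree d + n could be negative.\<close>
  then have eq: "h1 * g = h * f1" by (simp only: to_fract_eq_iff)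
  have "h1 \<noteq> 0" using 1(5) assms(6) by (auto simp: Fract_conv_to_fract)
  then have nz: "h * f1 \<noteq> 0" using eq assms(5) by (metis mult_eq_0_iff)
  have "h * f1 \<in> form (e1 + d)" using form_mult[OF 1(1) assms(4)] eq by simp
  from form_factors[OF this nz] obtain i j where ij: "h \<in> form i" "f1 \<in> form j" "i + j = e1 + d" by blast
  have "j = d1" using form_degree_unique[OF ij(2) 1(2) f1] .
  then show ?thesis using ij 1(3) by (intro exI[of _ i]) auto
qed

text \<open>Take for \<open>N\<close> the number of prime factors of \<open>f\<close> with
  multiplicity, and match each of them with one factor \<open>g\<close>.\<close>

lemma dvd_power_of_prime_divisors:
  fixes f g :: "'a :: factorial_semiring"
  assumes "f \<noteq> 0" "\<And>\<pi>. prime \<pi> \<Longrightarrow> \<pi> dvd f \<Longrightarrow> \<pi> dvd g"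
  shows "\<exists>N. f dvd g ^ N"
proof -
  have *: "prod_mset A dvd g ^ size A" if "\<And>\<pi>. \<pi> \<in># A \<Longrightarrow> \<pi> dvd g" for A
    using that by (induction A) (auto intro!: mult_dvd_mono)
  have "prod_mset (prime_factorization f) dvd g ^ size (prime_factorization f)"
    by (rule *) (use assms in \<open>auto simp: in_prime_factors_iff\<close>)
  then show ?thesis using assms(1) by (metis normalize_dvd_iff prod_mset_prime_factorization_weak)
qed

text \<open>Write r in lowest terms h / f. A prime divisor of f not dividing g generates a point of
  \<open>basic g\<close>; there r has another denominator, not divisible by this prime, which
  contradicts lowest terms. So all prime divisors of f divide g, and f divides a power of g.\<close>

lemma reg_basic_denominator:
  assumes g: "g \<in> form m" "g \<noteq> 0" and r: "\<And>p. p \<in> basic g \<Longrightarrow> reg n p r"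
  shows "\<exists>N h. r * to_fract (g ^ N) = to_fract h"
proof (cases "r = 0")
  case True then show ?thesis by (intro exI[of _ 0]) auto
next
  case False
  have "gpt \<in> basic g" using g(2) gpt_P1 by (simp add: gpt_def basic_def)
  from r[OF this] obtain d0 e0 h0 f0 where 0: "h0 \<in> form e0" "f0 \<in> form d0" "f0 \<notin> gpt" "r = Fract h0 f0"
    by (auto simp: reg_def)
  have f0: "f0 \<noteq> 0" using 0(3) by (simp add: gpt_def)
  define c where "c = gcd h0 f0"
  have c: "c \<noteq> 0" using f0 by (simp add: c_def)
  obtain h f where hf: "h0 = h * c" "f0 = f * c" "coprime h f"
    using gcd_coprime_exists[of h0 f0] c unfolding c_def by (metis)
  have f: "f \<noteq> 0" using hf f0 by auto
  have r': "r * to_fract f = to_fract h" using c f by (simp add: 0(4) hf Fract_conv_to_fract)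
  obtain df where df: "f \<in> form df" using form_factors[of f c d0] 0(2) f0 hf by auto
  have "\<pi> dvd g" if pi: "prime \<pi>" "\<pi> dvd f" for \<pi>
  proof (rule ccontr)
    assume ng: "\<not> \<pi> dvd g"
    obtain k where k: "f = \<pi> * k" using pi(2) by blast
    then obtain i where i: "\<pi> \<in> form i" using form_factors[of \<pi> k df] df f by auto
    have P: "{f. \<pi> dvd f} \<in> P1" using pi by (intro principal_prime_P1[OF _ i]) auto
    then have "{f. \<pi> dvd f} \<in> basic g" using ng by (simp add: basic_def)
    from r[OF this] obtain d1 e1 h1 f1 where 1: "\<not> \<pi> dvd f1" "r = Fract h1 f1"
      by (auto simp: reg_def)
    have f1: "f1 \<noteq> 0" using 1(1) by auto
    have "to_fract (h1 * f) = to_fract (h * f1)"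
      using r' f1 unfolding 1(2) Fract_conv_to_fract by (simp add: field_simps)
    then have "h1 * f = h * f1" by (simp only: to_fract_eq_iff)
    then have "\<pi> dvd h * f1" using pi(2) by (metis dvd_mult)
    then have "\<pi> dvd h" using 1(1) pi(1) by (simp add: prime_dvd_mult_iff)
    then show False using hf(3) pi by (meson coprime_common_divisor not_prime_unit)
  qed
  then obtain N where "f dvd g ^ N" using dvd_power_of_prime_divisors[OF f] by blast
  then obtain k where k: "g ^ N = f * k" by blast
  have "r * to_fract (g ^ N) = to_fract (h * k)"
    unfolding k using r' by (simp add: mult.assoc[symmetric])
  then show ?thesis by blast
qed

text \<open>For g = 1 all denominators are powers of 1. That a nonzero global section forces n \<ge>
  0 is the source of the inequalities between a, r, s and b.\<close>

lemma reg_global: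
  assumes r: "\<And>p. p \<in> P1 \<Longrightarrow> reg n p r"
  shows "\<exists>h. r = to_fract h \<and> (r \<noteq> 0 \<longrightarrow> n \<ge> 0 \<and> h \<in> form (nat n))"
proof -
  obtain N h where h: "r * to_fract (1 ^ N) = to_fract h"
    using reg_basic_denominator[OF one_form, of n r] r by (auto simp: basic_def)
  then have rh: "r = to_fract h" by simp
  moreover have "n \<ge> 0 \<and> h \<in> form (nat n)" if "r \<noteq> 0"
    using form_of_Fract[OF r[OF gpt_P1] gpt_P1 h, of 0] that by auto
  ultimately show ?thesis by blast
qed


section \<open>Vanishing of the first cohomology\<close>

lemma basic_mult_subset: "basic (f * g) \<subseteq> basic f" "basic (f * g) \<subseteq> basic g"
  using pt_mult[of _ f g] pt_mult[of _ g f] by (auto simp: basic_def mult.commute)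

text \<open>The functions on a chart form a subset \<open>R\<close> of the fraction field and not a
  type of their own, so the usual argument is carried out for subsets: Zorn's lemma gives a maximal
  proper ideal of \<open>R\<close> above \<open>J\<close>, and a maximal ideal is prime.\<close>

lemma maximal_ideal_in_subring:
  fixes R J :: "'a :: comm_ring_1 set"
  assumes R: "1 \<in> R" "\<And>a b. a \<in> R \<Longrightarrow> b \<in> R \<Longrightarrow> a + b \<in> R" "\<And>a b. a \<in> R \<Longrightarrow> b \<in> R \<Longrightarrow> a * b \<in> R"
    and J: "J \<subseteq> R" "0 \<in> J" "\<And>a b. a \<in> J \<Longrightarrow> b \<in> J \<Longrightarrow> a + b \<in> J" "\<And>a r. a \<in> J \<Longrightarrow> r \<in> R \<Longrightarrow> r * a \<in> J" "1 \<notin> J"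
  shows "\<exists>M. J \<subseteq> M \<and> 0 \<in> M \<and> (\<forall>a\<in>M. \<forall>b\<in>M. a + b \<in> M) \<and> (\<forall>a\<in>M. \<forall>r\<in>R. r * a \<in> M) \<and> 1 \<notin> M \<and>
    (\<forall>a\<in>R. \<forall>b\<in>R. a * b \<in> M \<longrightarrow> a \<in> M \<or> b \<in> M)"
proof -
  define I where "I = {M. J \<subseteq> M \<and> M \<subseteq> R \<and> (\<forall>a\<in>M. \<forall>b\<in>M. a + b \<in> M) \<and> (\<forall>a\<in>M. \<forall>r\<in>R. r * a \<in> M) \<and> 1 \<notin> M}"
  have JI: "J \<in> I" using J by (auto simp: I_def)
  have "\<exists>M\<in>I. \<forall>X\<in>I. M \<subseteq> X \<longrightarrow> X = M"
  proof (rule subset_Zorn)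
    fix C assume C: "subset.chain I C"
    then have CI: "C \<subseteq> I" and lin: "\<And>X Y. X \<in> C \<Longrightarrow> Y \<in> C \<Longrightarrow> X \<subseteq> Y \<or> Y \<subseteq> X"
      by (auto simp: subset_chain_def)
    show "\<exists>U\<in>I. \<forall>X\<in>C. X \<subseteq> U"
    proof (cases "C = {}")
      case True then show ?thesis using JI by auto
    next
      case False
      have "\<Union>C \<in> I" unfolding I_def
      proof (safe, goal_cases)
        case (1 a)
        obtain X where "X \<in> C" using False by blast
        then have "J \<subseteq> X" using CI by (auto simp: I_def)
        then show ?case using 1 \<open>X \<in> C\<close> by blast
      next
        case (2 a) then show ?case using CI by (auto simp: I_def)
      next
        case (3 a X b Y)
        then obtain Z where "Z \<in> C" "a \<in> Z" "b \<in> Z" using lin[of X Y] by blast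
        then have "a + b \<in> Z" using CI by (auto simp: I_def)
        then show ?case using \<open>Z \<in> C\<close> by blast
      next
        case (4 a X r) then have "r * a \<in> X" using CI by (auto simp: I_def)
        then show ?case using 4 by blast
      next
        case 5 then show ?case using CI by (auto simp: I_def)
      qed
      then show ?thesis by blast
    qed
  qed
  then obtain M where M: "M \<in> I" and max: "\<And>X. X \<in> I \<Longrightarrow> M \<subseteq> X \<Longrightarrow> X = M" by blast
  have M': "J \<subseteq> M" "M \<subseteq> R" "\<And>a b. a \<in> M \<Longrightarrow> b \<in> M \<Longrightarrow> a + b \<in> M"
    "\<And>a r. a \<in> M \<Longrightarrow> r \<in> R \<Longrightarrow> r * a \<in> M" "1 \<notin> M" using M by (auto simp: I_def)
  have 0: "0 \<in> M" using M' J by auto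
  have R0: "0 \<in> R" using J by auto
  \<comment> \<open>Otherwise the ideal generated by \<open>M\<close> and \<open>a\<close> would be
    a larger member of \<open>I\<close>.\<close>
  have one: "\<exists>u\<in>M. \<exists>r\<in>R. 1 = u + r * a" if a: "a \<in> R" "a \<notin> M" for a
  proof (rule ccontr)
    assume no: "\<not> ?thesis"
    define X where "X = {u + r * a |u r. u \<in> M \<and> r \<in> R}"
    have MX: "M \<subseteq> X"
    proof
      fix u assume "u \<in> M"
      moreover have "u = u + 0 * a" by simp
      ultimately show "u \<in> X" using R0 unfolding X_def by blast
    qed
    have "X \<in> I" unfolding I_def
    proof (safe, goal_cases)
      case (1 b) then show ?case using MX M' by auto
    next
      case (2 b) then show ?case using M' R a by (auto simp: X_def)
    next
      case (3 b c)
      then obtain u r v s where "u \<in> M" "r \<in> R" "v \<in> M" "s \<in> R" "b = u + r * a" "c = v + s * a"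
        by (auto simp: X_def)
      then have "b + c = (u + v) + (r + s) * a" "u + v \<in> M" "r + s \<in> R"
        using M' R by (auto simp: algebra_simps)
      then show ?case unfolding X_def by blast
    next
      case (4 b s)
      then obtain u r where "u \<in> M" "r \<in> R" "b = u + r * a" by (auto simp: X_def)
      then have "s * b = s * u + (s * r) * a" "s * u \<in> M" "s * r \<in> R"
        using M'(4) R(3) 4 by (auto simp: distrib_left mult.assoc)
      then show ?case unfolding X_def by blast
    next
      case 5 then show ?case using no by (auto simp: X_def)
    qed
    then have "X = M" using max MX by blast
    moreover have "a = 0 + 1 * a" by simp
    then have "a \<in> X" unfolding X_def using 0 R(1) by blast
    ultimately show False using a(2) by simp
  qed
  have "a \<in> M \<or> b \<in> M" if ab: "a \<in> R" "b \<in> R" "a * b \<in> M" for a b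
  proof (rule ccontr)
    assume "\<not> ?thesis"
    then have na: "a \<notin> M" "b \<notin> M" by auto
    obtain u r where ur: "u \<in> M" "r \<in> R" "u + r * a = 1" using one[OF ab(1) na(1)] by metis
    obtain v s where vs: "v \<in> M" "s \<in> R" "v + s * b = 1" using one[OF ab(2) na(2)] by metis
    \<comment> \<open>After expansion every term contains \<open>u\<close>, \<open>v\<close> or
      \<open>a * b\<close>, all of which lie in \<open>M\<close>.\<close>
    have "1 = (u + r * a) * (v + s * b)" by (simp only: ur(3) vs(3) mult_1)
    also have "\<dots> = v * u + (s * b) * u + (r * a) * v + (r * s) * (a * b)"
      by (simp only: distrib_left distrib_right) (simp only: ac_simps)
    also have "\<dots> \<in> M"
    proof -
      have "v \<in> R" using vs(1) M'(2) by blast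
      then show ?thesis
        by (intro M'(3) M'(4)[OF ur(1)] M'(4)[OF vs(1)] M'(4)[OF ab(3)] R(3) ur(2) vs(2) ab(1,2))
    qed
    finally show False using M'(5) by simp
  qed
  note prime = this
  show ?thesis
    by (intro exI[of _ M] conjI ballI impI M'(1) M'(3-5) 0; (rule prime)?) assumption+
qed

section \<open>Partitions of unity on an affine chart\<close>

inductive_set combination :: "zxy \<Rightarrow> 'i set \<Rightarrow> ('i \<Rightarrow> zxy) \<Rightarrow> ('i \<Rightarrow> nat) \<Rightarrow> rat_fun set"
  for l A f d where
  zero: "0 \<in> combination l A f d"
| step: "r \<in> combination l A f d \<Longrightarrow> z \<in> A \<Longrightarrow> (\<forall>p\<in>basic l. reg (- int (d z)) p w) \<Longrightarrow>
    r + w * to_fract (f z) \<in> combination l A f d"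

lemma combination_add:
  assumes "r \<in> combination l A f d" "s \<in> combination l A f d" shows "r + s \<in> combination l A f d"
  using assms(2,1) by induction (auto simp: add.assoc[symmetric] intro: combination.step)

lemma combination_mult:
  assumes "r \<in> combination l A f d" "\<forall>p\<in>basic l. reg 0 p s" shows "s * r \<in> combination l A f d"
  using assms(1)
proof induction
  case zero show ?case by (simp add: combination.zero)
next
  case (step r z w)
  have "\<forall>p\<in>basic l. reg (- int (d z)) p (s * w)"
    using reg_mult'[of _ 0 s "- int (d z)" w] assms(2) step(3) by (auto simp: basic_def)
  from combination.step[OF step(4,2) this] show ?case by (simp add: algebra_simps)
qed

lemma combination_sum:
  assumes "r \<in> combination l A f d"
  shows "\<exists>F u. finite F \<and> F \<subseteq> A \<and> r = (\<Sum>z\<in>F. u z * to_fract (f z)) \<and>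
    (\<forall>z\<in>F. \<forall>p\<in>basic l. reg (- int (d z)) p (u z))"
  using assms
proof induction
  case zero show ?case by (intro exI[of _ "{}"]) auto
next
  case (step r z w)
  then obtain F u where F: "finite F" "F \<subseteq> A" "r = (\<Sum>z\<in>F. u z * to_fract (f z))"
    "\<forall>z\<in>F. \<forall>p\<in>basic l. reg (- int (d z)) p (u z)" by blast
  \<comment> \<open>The index \<open>z\<close> may have occurred before. Adding up its coefficients
    turns the sequence of steps into a sum over a set.\<close>
  define u' where "u' = u(z := (if z \<in> F then u z + w else w))"
  have "(\<Sum>y\<in>insert z F. u' y * to_fract (f y)) = r + w * to_fract (f z)"
  proof (cases "z \<in> F")
    case True
    then show ?thesis unfolding F(3) using F(1)
      by (simp add: insert_absorb sum.remove[of F z] u'_def algebra_simps)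
  next
    case False
    then have "(\<Sum>y\<in>F. u' y * to_fract (f y)) = r" unfolding F(3) by (intro sum.cong) (auto simp: u'_def)
    then show ?thesis using False F(1) by (simp add: u'_def)
  qed
  moreover have "\<forall>y\<in>insert z F. \<forall>p\<in>basic l. reg (- int (d y)) p (u' y)"
    using F(4) step(3) reg_add by (auto simp: u'_def basic_def)
  ultimately show ?case using F(1,2) step(2) by (intro exI[of _ "insert z F"] exI[of _ u']) auto
qed

text \<open>Otherwise the combinations form a proper ideal of the ring of regular functions on the affine
  chart. The forms whose dehomogenizations lie in a maximal ideal above it generate a point of the
  chart at which all f vanish.\<close>
lemma one_in_combination:
  assumes l: "l \<in> form 1" "l \<noteq> 0" and f: "\<And>z. z \<in> A \<Longrightarrow> f z \<in> form (d z)"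
    and cover: "\<And>p. p \<in> basic l \<Longrightarrow> \<exists>z\<in>A. f z \<notin> p"
  shows "1 \<in> combination l A f d"
proof (rule ccontr)
  assume no: "1 \<notin> combination l A f d"
  define R where "R = {r. \<forall>p\<in>basic l. reg 0 p r}"
  have R: "1 \<in> R" "\<And>a b. a \<in> R \<Longrightarrow> b \<in> R \<Longrightarrow> a + b \<in> R" "\<And>a b. a \<in> R \<Longrightarrow> b \<in> R \<Longrightarrow> a * b \<in> R"
    using reg_add reg_mult[of _ 0 _ 0] by (auto simp: R_def basic_def)
  have sub: "combination l A f d \<subseteq> R"
  proof
    fix r assume "r \<in> combination l A f d"
    then show "r \<in> R"
    proof induction
      case zero then show ?case by (auto simp: R_def basic_def)
    next
      case (step r z w)
      have "reg 0 p (w * to_fract (f z))" if "p \<in> basic l" for p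
        using reg_mult'[of p "- int (d z)" w "int (d z)" "to_fract (f z)" 0] step(3) that reg_of_form[OF _ f[OF step(2)]]
        by (auto simp: basic_def)
      then show ?case using step(4) R(2) by (auto simp: R_def)
    qed
  qed
  have mul: "r * a \<in> combination l A f d" if "a \<in> combination l A f d" "r \<in> R" for a r
    using combination_mult[of a l A f d r] that by (auto simp: R_def)
  have "\<exists>M. combination l A f d \<subseteq> M \<and> 0 \<in> M \<and> (\<forall>a\<in>M. \<forall>b\<in>M. a + b \<in> M) \<and>
    (\<forall>a\<in>M. \<forall>r\<in>R. r * a \<in> M) \<and> 1 \<notin> M \<and> (\<forall>a\<in>R. \<forall>b\<in>R. a * b \<in> M \<longrightarrow> a \<in> M \<or> b \<in> M)"
    by (rule maximal_ideal_in_subring) (fact R sub mul no combination.zero combination_add)+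
  then obtain M where "combination l A f d \<subseteq> M \<and> 0 \<in> M \<and> (\<forall>a\<in>M. \<forall>b\<in>M. a + b \<in> M) \<and>
    (\<forall>a\<in>M. \<forall>r\<in>R. r * a \<in> M) \<and> 1 \<notin> M \<and> (\<forall>a\<in>R. \<forall>b\<in>R. a * b \<in> M \<longrightarrow> a \<in> M \<or> b \<in> M)"
    by (elim exE)
  then have M: "combination l A f d \<subseteq> M" "0 \<in> M" "\<And>a b. a \<in> M \<Longrightarrow> b \<in> M \<Longrightarrow> a + b \<in> M"
    "\<And>a r. a \<in> M \<Longrightarrow> r \<in> R \<Longrightarrow> r * a \<in> M" "1 \<notin> M"
    "\<And>a b. a \<in> R \<Longrightarrow> b \<in> R \<Longrightarrow> a * b \<in> M \<Longrightarrow> a \<in> M \<or> b \<in> M"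
    by simp_all
  have Msum: "sum g B \<in> M" if "\<And>b. b \<in> B \<Longrightarrow> g b \<in> M" for g :: "nat \<Rightarrow> rat_fun" and B
    using that M(2,3) by (induction B rule: infinite_finite_induct) auto
  \<comment> \<open>The component of degree k, turned into a function on the chart by division by
    the k-th power of \<open>l\<close>.\<close>
  define q where "q k g = to_fract (hcomp k g) / lpow l (int k)" for k g
  have qR: "q k g \<in> R" for k g
    unfolding q_def R_def using reg_div_lpow[OF _ l(1) _ reg_of_form[OF _ hcomp_form], of _ 0 k "int k" g]
    by (auto simp: basic_def)
  have qform: "q k g = (if k = e then to_fract g / lpow l (int e) else 0)" if "g \<in> form e" for k e g
    using hcomp_of_form[OF that, of k] by (simp add: q_def)
  have qadd: "q k (g + h) = q k g + q k h" for k g h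
    by (simp add: q_def hcomp_add add_divide_distrib)
  have qmult: "q n (g * h) = (\<Sum>k\<le>n. q k g * q (n - k) h)" for n g h
  proof -
    have "q n (g * h) = (\<Sum>k\<le>n. to_fract (hcomp k g) * to_fract (hcomp (n - k) h) / lpow l (int n))"
      by (simp add: q_def hcomp_mult sum_divide_distrib)
    also have "\<dots> = (\<Sum>k\<le>n. q k g * q (n - k) h)"
    proof (rule sum.cong[OF refl])
      fix k assume "k \<in> {..n}"
      then have "lpow l (int n) = lpow l (int k) * lpow l (int (n - k))"
        using lpow_add[OF l(2), of "int k" "int (n - k)"] by simp
      then show "to_fract (hcomp k g) * to_fract (hcomp (n - k) h) / lpow l (int n) = q k g * q (n - k) h"
        by (simp add: q_def)
    qed
    finally show ?thesis .
  qed
  \<comment> \<open>The condition is imposed on each component separately, which makes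
    \<open>p\<close> homogeneous by construction.\<close>
  define p where "p = {g. \<forall>k. q k g \<in> M}"
  have "p \<in> P1"
  proof (rule P1I[OF _ _ _ _ _ l(1)])
    show "0 \<in> p" using M(2) by (simp add: p_def q_def)
    show "g + h \<in> p" if "g \<in> p" "h \<in> p" for g h using that M(3) by (simp add: p_def qadd)
    show "h * g \<in> p" if "g \<in> p" for g h using that M(4) qR by (auto simp: p_def qmult intro!: Msum)
    show "g \<in> p \<or> h \<in> p" if gh: "g * h \<in> p" for g h
    proof (rule ccontr)
      assume "\<not> ?thesis"
      then obtain i' j' where ij': "q i' g \<notin> M" "q j' h \<notin> M" by (auto simp: p_def)
      define i where "i = (LEAST i. q i g \<notin> M)"
      define j where "j = (LEAST j. q j h \<notin> M)"
      have i: "q i g \<notin> M" "\<And>k. k < i \<Longrightarrow> q k g \<in> M"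
        using LeastI[of "\<lambda>i. q i g \<notin> M", OF ij'(1)] not_less_Least unfolding i_def by blast+
      have j: "q j h \<notin> M" "\<And>k. k < j \<Longrightarrow> q k h \<in> M"
        using LeastI[of "\<lambda>i. q i h \<notin> M", OF ij'(2)] not_less_Least unfolding j_def by blast+
      \<comment> \<open>Since i and j are the least degrees with a component outside
        \<open>M\<close>, every other term of this sum has a factor in \<open>M\<close>. Then
        \<open>q i g * q j h\<close> lies in \<open>M\<close> too, against primality.\<close>
      have eq: "q (i + j) (g * h) = q i g * q j h + (\<Sum>k\<in>{..i+j}-{i}. q k g * q (i + j - k) h)"
        unfolding qmult by (subst sum.remove[of _ i]) auto
      have S: "(\<Sum>k\<in>{..i+j}-{i}. q k g * q (i + j - k) h) \<in> M"
      proof (rule Msum)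
        fix k assume k: "k \<in> {..i + j} - {i}"
        show "q k g * q (i + j - k) h \<in> M"
        proof (cases "k < i")
          case True
          show ?thesis using M(4)[OF i(2)[OF True] qR[of "i + j - k" h]] by (simp only: mult.commute)
        next
          case False
          then have "i + j - k < j" using k by auto
          then show ?thesis by (intro M(4) j(2) qR)
        qed
      qed
      have prod: "q (i + j) (g * h) \<in> M" using gh by (simp add: p_def)
      have "- 1 \<in> R" using reg_uminus[OF _ reg_one] by (auto simp: R_def basic_def)
      then have "- 1 * (\<Sum>k\<in>{..i+j}-{i}. q k g * q (i + j - k) h) \<in> M" using M(4)[OF S] by blast
      from M(3)[OF prod this] have "q i g * q j h \<in> M" by (simp add: eq)
      then show False using M(6) qR i(1) j(1) by blast
    qed
    show "l \<notin> p"
      using M(5) qform[OF l(1), of 1] l(2) lpow_nz[OF l(2), of 1] by (auto simp: p_def lpow_def intro!: exI[of _ 1])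
    show "\<exists>B. finite B \<and> (\<forall>a\<in>B. fst a \<in> p \<inter> (\<Union>d. form d)) \<and> g = (\<Sum>a\<in>B. snd a * fst a)"
      if g: "g \<in> p" for g
    proof -
      obtain N where N: "g = (\<Sum>d\<le>N. hcomp d g)" using sum_hcomp[of g] by blast
      have inp: "hcomp k g \<in> p" for k
      proof -
        have "q e (hcomp k g) = (if e = k then q k g else 0)" for e
          using qform[OF hcomp_form[of k g], of e] by (simp add: q_def)
        then show ?thesis using g M(2) by (simp add: p_def)
      qed
      \<comment> \<open>Zero components are left out: they coincide with each other and would spoil
        injectivity. Nonzero ones are told apart by their degrees.\<close>
      have inj: "inj_on (\<lambda>k. (hcomp k g, 1::zxy)) {k. k \<le> N \<and> hcomp k g \<noteq> 0}"
      proof (rule inj_onI)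
        fix k k' assume "k \<in> {k. k \<le> N \<and> hcomp k g \<noteq> 0}" "(hcomp k g, 1::zxy) = (hcomp k' g, 1)"
        then show "k = k'" using form_degree_unique[OF hcomp_form[of k g], of k'] hcomp_form[of k' g] by auto
      qed
      have "g = (\<Sum>k\<in>{k. k \<le> N \<and> hcomp k g \<noteq> 0}. hcomp k g)"
        by (subst N, intro sum.mono_neutral_right) auto
      also have "\<dots> = (\<Sum>a\<in>(\<lambda>k. (hcomp k g, 1::zxy)) ` {k. k \<le> N \<and> hcomp k g \<noteq> 0}. snd a * fst a)"
        by (subst sum.reindex[OF inj]) simp
      finally show ?thesis
        by (intro exI[of _ "(\<lambda>k. (hcomp k g, 1::zxy)) ` {k. k \<le> N \<and> hcomp k g \<noteq> 0}"])
          (use inp hcomp_form in auto)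
    qed
  qed
  moreover have "l \<notin> p"
    using M(5) qform[OF l(1), of 1] l(2) by (auto simp: p_def lpow_def intro!: exI[of _ 1])
  ultimately have pl: "p \<in> basic l" by (simp add: basic_def)
  from cover[OF this] obtain z where z: "z \<in> A" "f z \<notin> p" by blast
  \<comment> \<open>The dehomogenization of \<open>f z\<close> is itself a combination and so lies
    in \<open>M\<close>. This puts \<open>f z\<close> into \<open>p\<close>, although it was chosen
    not to vanish there.\<close>
  have "0 + lpow l (- int (d z)) * to_fract (f z) \<in> combination l A f d"
    by (rule combination.step[OF combination.zero z(1)]) (use reg_lpow l in \<open>auto simp: basic_def\<close>)
  then have "to_fract (f z) / lpow l (int (d z)) \<in> M" using M(1) by (auto simp: lpow_uminus)
  then have "f z \<in> p" using M(2) by (simp add: p_def qform[OF f[OF z(1)]])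
  then show False using z by simp
qed

lemma partition_of_unity:
  assumes "l \<in> form 1" "l \<noteq> 0" "\<And>z. z \<in> A \<Longrightarrow> f z \<in> form (d z)"
    and "\<And>p. p \<in> basic l \<Longrightarrow> \<exists>z\<in>A. f z \<notin> p"
  obtains F u where "finite F" "F \<subseteq> A" "1 = (\<Sum>z\<in>F. u z * to_fract (f z))"
    "\<And>z p. z \<in> F \<Longrightarrow> p \<in> basic l \<Longrightarrow> reg (- int (d z)) p (u z)"
  using combination_sum[OF one_in_combination[OF assms]] by blast

text \<open>If all \<open>f z\<close> were in \<open>p\<close>, a common denominator would exhibit 1
  as a fraction with numerator in \<open>p\<close> and denominator outside. Hence the finitely many
  terms of a partition of unity still cover; this is how quasi-compactness of the chart
  enters.\<close>

lemma sum_reg_mult_nonvanishing: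
  assumes p: "p \<in> P1" and F: "finite F" "1 = (\<Sum>z\<in>F. u z * to_fract (f z))" "\<And>z. z \<in> F \<Longrightarrow> reg (k z) p (u z)"
  shows "\<exists>z\<in>F. f z \<notin> p"
proof (rule ccontr)
  assume *: "\<not> ?thesis"
  have "\<exists>h g. h \<in> p \<and> g \<notin> p \<and> (\<Sum>z\<in>F. u z * to_fract (f z)) = Fract h g"
    using F(1) F(3) *
  proof (induction F)
    case empty
    show ?case using pt_zero[OF p] pt_one[OF p]
      by (intro exI[of _ 0] exI[of _ 1]) (auto simp: Fract_conv_to_fract)
  next
    case (insert z F)
    then obtain h g where 1: "h \<in> p" "g \<notin> p" "(\<Sum>z\<in>F. u z * to_fract (f z)) = Fract h g" by auto
    obtain h' g' where 2: "g' \<notin> p" "u z = Fract h' g'" using insert(4)[of z] by (auto simp: reg_def)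
    have nz: "g \<noteq> 0" "g' \<noteq> 0" using 1 2 pt_zero[OF p] by auto
    have "(\<Sum>z\<in>insert z F. u z * to_fract (f z)) = Fract (h' * f z * g + h * g') (g' * g)"
      using insert(1,2) nz by (simp add: 1(3) 2(2) Fract_conv_to_fract field_simps)
    moreover have "f z \<in> p" using insert(5) by auto
    then have "h' * f z * g + h * g' \<in> p"
      using pt_add[OF p pt_mult[OF p, of "f z" "h' * g"] pt_mult[OF p 1(1), of g']] by (simp add: mult_ac)
    ultimately show ?case using pt_prime[OF p 2(1) 1(2)] by blast
  qed
  then obtain h g where h: "h \<in> p" "g \<notin> p" "1 = Fract h g" using F(2) by auto
  then have "g \<noteq> 0" using pt_zero[OF p] by auto
  then have "to_fract h = to_fract g" using h(3) by (simp add: Fract_conv_to_fract)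
  then show False using h by (simp only: to_fract_eq_iff)
qed

text \<open>For a partition of unity with coefficients v z of the powers (f z)^N, let t be the sum
  of the v z (f z)^N \<tau> z. Then \<tau> w - t is the sum of the v z (f z)^N (\<tau> w - \<tau>
  z), and for large N the factor (f z)^N leaves only a power of f w in the denominator, which is
  harmless on \<open>basic (f w)\<close>.\<close>

lemma cousin_chart:
  assumes l: "l \<in> form 1" "l \<noteq> 0" and U: "\<And>z. z \<in> basic l \<Longrightarrow> zopen (U z) \<and> z \<in> U z"
    and \<tau>: "\<And>z w p. z \<in> basic l \<Longrightarrow> w \<in> basic l \<Longrightarrow> p \<in> U z \<Longrightarrow> p \<in> U w \<Longrightarrow> reg n p (\<tau> z - \<tau> w)"
  shows "\<exists>t. \<forall>p\<in>basic l. reg n p (\<tau> p - t)"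
proof -
  have "\<forall>z\<in>basic l. \<exists>f d. f \<in> form d \<and> z \<in> basic f \<and> basic f \<subseteq> U z"
    using openin_basic U by blast
  then obtain f d where f: "\<And>z. z \<in> basic l \<Longrightarrow> f z \<in> form (d z)" "\<And>z. z \<in> basic l \<Longrightarrow> z \<in> basic (f z)"
    "\<And>z. z \<in> basic l \<Longrightarrow> basic (f z) \<subseteq> U z" by metis
  have fz: "f z \<noteq> 0" if "z \<in> basic l" for z using f(2)[OF that] pt_zero by (auto simp: basic_def)
  \<comment> \<open>This first partition serves to extract a finite subcover, without which a common
    exponent need not exist.\<close>
  obtain F u where F: "finite F" "F \<subseteq> basic l" "1 = (\<Sum>z\<in>F. u z * to_fract (f z))"
    "\<And>z p. z \<in> F \<Longrightarrow> p \<in> basic l \<Longrightarrow> reg (- int (d z)) p (u z)"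
  proof (rule partition_of_unity[OF l, of "basic l" f d])
    show "\<exists>z\<in>basic l. f z \<notin> p" if "p \<in> basic l" for p using f(2)[OF that] that by (auto simp: basic_def)
  qed (use f in auto)
  have cover: "\<exists>z\<in>F. f z \<notin> p" if "p \<in> basic l" for p
    using sum_reg_mult_nonvanishing[OF _ F(1,3), of p "\<lambda>z. - int (d z)"] F(4) that by (auto simp: basic_def)
  have "\<exists>N h. (\<tau> z - \<tau> w) * to_fract ((f z * f w) ^ N) = to_fract h" if "z \<in> F" "w \<in> F" for z w
  proof (rule reg_basic_denominator)
    have zw: "z \<in> basic l" "w \<in> basic l" using that F(2) by auto
    show "f z * f w \<in> form (d z + d w)" using f(1) zw by (intro form_mult) auto
    show "f z * f w \<noteq> 0" using fz zw by simp
    fix p assume "p \<in> basic (f z * f w)"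
    then have "p \<in> basic (f z)" "p \<in> basic (f w)" using basic_mult_subset by blast+
    then show "reg n p (\<tau> z - \<tau> w)" using \<tau> zw f(3) by blast
  qed
  then obtain M where M: "\<And>z w. z \<in> F \<Longrightarrow> w \<in> F \<Longrightarrow> \<exists>h. (\<tau> z - \<tau> w) * to_fract ((f z * f w) ^ M z w) = to_fract h"
    by metis
  \<comment> \<open>Summing over all pairs gives an exponent that works for each of them.\<close>
  define N where "N = (\<Sum>z\<in>F. \<Sum>w\<in>F. M z w)"
  have N: "\<exists>h. (\<tau> z - \<tau> w) * to_fract ((f z * f w) ^ N) = to_fract h" if zw: "z \<in> F" "w \<in> F" for z w
  proof -
    have "M z w \<le> (\<Sum>w\<in>F. M z w)" using zw F(1) by (intro member_le_sum) auto
    also have "\<dots> \<le> N" unfolding N_def using zw F(1) by (intro member_le_sum[of z F "\<lambda>z. \<Sum>w\<in>F. M z w"]) auto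
    finally obtain k where k: "N = M z w + k" using le_Suc_ex by blast
    obtain h where "(\<tau> z - \<tau> w) * to_fract ((f z * f w) ^ M z w) = to_fract h" using M zw by blast
    then have "(\<tau> z - \<tau> w) * to_fract ((f z * f w) ^ N) = to_fract (h * (f z * f w) ^ k)"
      unfolding k power_add to_fract_mult mult.assoc[symmetric] by simp
    then show ?thesis by blast
  qed
  have R: "reg (n + int (N * d z)) p (to_fract (f z ^ N) * (\<tau> w - \<tau> z))"
    if zw: "z \<in> F" "w \<in> F" and p: "p \<in> basic (f w)" for z w p
  proof (cases "\<tau> w - \<tau> z = 0")
    case True
    then show ?thesis using p by (simp add: basic_def)
  next
    case False
    have zwl: "z \<in> basic l" "w \<in> basic l" using zw F(2) by auto
    obtain h where h: "(\<tau> w - \<tau> z) * to_fract ((f w * f z) ^ N) = to_fract h" using N zw by blast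
    \<comment> \<open>Regularity of the difference at the generic point fixes the degree of its
      numerator \<open>h\<close>.\<close>
    have g: "gpt \<in> U w" "gpt \<in> U z" using U zwl gpt_in_open by blast+
    obtain e where e: "h \<in> form e" "int e = int (N * (d w + d z)) + n"
      using form_of_Fract[OF \<tau>[OF zwl(2,1) g] gpt_P1 h power_form[OF form_mult[OF f(1)[OF zwl(2)] f(1)[OF zwl(1)]]] _ False] fz zwl by auto
    show ?thesis
    proof (rule regI[OF e(1) power_form[OF f(1)[OF zwl(2)], of N]])
      show "int e = int (N * d w) + (n + int (N * d z))" using e(2) by (simp add: algebra_simps)
      show "f w ^ N \<notin> p" using p pt_power by (auto simp: basic_def)
      show "to_fract (f z ^ N) * (\<tau> w - \<tau> z) = Fract h (f w ^ N)"
        using fz[OF zwl(2)] unfolding Fract_conv_to_fract h[symmetric] power_mult_distrib to_fract_mult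
        by (simp add: field_simps)
    qed
  qed
  \<comment> \<open>The powers cover the chart as well, by primality of the points, so they have a
    partition of unity of their own.\<close>
  obtain G v where G: "finite G" "G \<subseteq> F" "1 = (\<Sum>z\<in>G. v z * to_fract (f z ^ N))"
    "\<And>z p. z \<in> G \<Longrightarrow> p \<in> basic l \<Longrightarrow> reg (- int (N * d z)) p (v z)"
  proof (rule partition_of_unity[OF l, of F "\<lambda>z. f z ^ N" "\<lambda>z. N * d z"])
    show "f z ^ N \<in> form (N * d z)" if "z \<in> F" for z using f(1) F(2) that by (blast intro: power_form)
    show "\<exists>z\<in>F. f z ^ N \<notin> p" if "p \<in> basic l" for p
      using cover[OF that] pt_power that by (auto simp: basic_def)
  qed (rule that)
  define t where "t = (\<Sum>z\<in>G. v z * to_fract (f z ^ N) * \<tau> z)"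
  have "reg n p (\<tau> p - t)" if p: "p \<in> basic l" for p
  proof -
    have p': "p \<in> P1" using p by (simp add: basic_def)
    obtain w where w: "w \<in> F" "p \<in> basic (f w)" using cover[OF p] p by (auto simp: basic_def)
    then have wl: "w \<in> basic l" using F(2) by blast
    have "\<tau> w - t = (\<Sum>z\<in>G. v z * (to_fract (f z ^ N) * (\<tau> w - \<tau> z)))"
    proof -
      have "(\<Sum>z\<in>G. v z * (to_fract (f z ^ N) * (\<tau> w - \<tau> z))) =
          (\<Sum>z\<in>G. v z * to_fract (f z ^ N)) * \<tau> w - t"
        unfolding t_def sum_distrib_right sum_subtractf[symmetric]
        by (intro sum.cong refl) (simp only: right_diff_distrib mult.assoc)
      then show ?thesis unfolding G(3)[symmetric] by simp
    qed
    also have "reg n p \<dots>"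
    proof (rule reg_sum[OF p'])
      fix z assume z: "z \<in> G"
      then have "z \<in> F" using G(2) by blast
      show "reg n p (v z * (to_fract (f z ^ N) * (\<tau> w - \<tau> z)))"
        by (rule reg_mult'[OF p' G(4)[OF z p] R[OF \<open>z \<in> F\<close> w]]) simp
    qed
    finally have 1: "reg n p (\<tau> w - t)" .
    have "p \<in> U w" using w f(3)[OF wl] by blast
    then have "reg n p (\<tau> p - \<tau> w)" using \<tau>[OF p wl] U[OF p] by blast
    from reg_add[OF p' this 1] show ?thesis by simp
  qed
  then show ?thesis by blast
qed

lemma cousin:
  assumes n: "n \<ge> -1" and U: "\<And>z. z \<in> P1 \<Longrightarrow> zopen (U z) \<and> z \<in> U z"
    and \<tau>: "\<And>z w p. z \<in> P1 \<Longrightarrow> w \<in> P1 \<Longrightarrow> p \<in> U z \<Longrightarrow> p \<in> U w \<Longrightarrow> reg n p (\<tau> z - \<tau> w)"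
  shows "\<exists>t. \<forall>p\<in>P1. reg n p (\<tau> p - t)"
proof -
  have "\<exists>t. \<forall>p\<in>basic xv. reg n p (\<tau> p - t)"
    by (rule cousin_chart[OF xv_form xv_nz, of U]) (use U \<tau> in \<open>auto simp: basic_def\<close>)
  then obtain tx where tx: "\<And>p. p \<in> basic xv \<Longrightarrow> reg n p (\<tau> p - tx)" by blast
  have "\<exists>t. \<forall>p\<in>basic yv. reg n p (\<tau> p - t)"
    by (rule cousin_chart[OF yv_form yv_nz, of U]) (use U \<tau> in \<open>auto simp: basic_def\<close>)
  then obtain ty where ty: "\<And>p. p \<in> basic yv \<Longrightarrow> reg n p (\<tau> p - ty)" by blast
  \<comment> \<open>\<open>B\<close> is regular on the chart x \<noteq> 0 and \<open>A\<close> on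
    the chart y \<noteq> 0, so subtracting \<open>B\<close> from \<open>tx\<close> and adding
    \<open>A\<close> to \<open>ty\<close> keeps them solutions on their charts and makes them
    equal.\<close>
  have "\<exists>A B. tx - B = ty + A \<and> (\<forall>p\<in>basic xv. reg n p B) \<and> (\<forall>p\<in>basic yv. reg n p A)"
  proof (cases "tx - ty = 0")
    case True
    then show ?thesis by (intro exI[of _ 0]) (auto simp: basic_def)
  next
    case False
    have xy: "xv * yv \<in> form 2" using form_mult[OF xv_form yv_form] by (simp add: numeral_2_eq_2)
    have r: "reg n p (tx - ty)" if "p \<in> basic (xv * yv)" for p
    proof -
      have p: "p \<in> P1" "p \<in> basic xv" "p \<in> basic yv" using that basic_mult_subset[of xv yv] by (auto simp: basic_def)
      show ?thesis using reg_diff[OF p(1) ty[OF p(3)] tx[OF p(2)]] by simp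
    qed
    obtain N h where h: "(tx - ty) * to_fract ((xv * yv) ^ N) = to_fract h"
      using reg_basic_denominator[OF xy _ r] by auto
    have "gpt \<in> basic (xv * yv)" using gpt_P1 by (simp add: basic_def gpt_def)
    from form_of_Fract[OF r[OF this] gpt_P1 h power_form[OF xy] _ False]
    obtain e where e: "h \<in> form e" "int e = int (N * 2) + n" by auto
    \<comment> \<open>The degree of \<open>h\<close> is 2N + n, so n \<ge> -1 is just the bound that
      \<open>form_split\<close> asks for.\<close>
    have "2 * N \<le> e + 1" using e(2) n by linarith
    from form_split[OF e(1) this] obtain A B where
      AB: "A \<in> form (e - N)" "B \<in> form (e - N)" "h = xv ^ N * A + yv ^ N * B" by blast
    \<comment> \<open>The subtraction is one of natural numbers and does not truncate: for N > 0 the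
      degree e is at least 2N - 1 and hence at least N.\<close>
    have eN: "int (e - N) = int (N * 1) + n" using e(2) n by (cases "N = 0") auto
    have "tx - ty = Fract A (yv ^ N) + Fract B (xv ^ N)"
    proof -
      have "(tx - ty) * (to_fract (xv ^ N) * to_fract (yv ^ N)) =
          to_fract (xv ^ N) * to_fract A + to_fract (yv ^ N) * to_fract B"
        using h AB(3) by (simp add: power_mult_distrib)
      moreover have "to_fract (xv ^ N) \<noteq> 0" "to_fract (yv ^ N) \<noteq> 0" by auto
      ultimately show ?thesis unfolding Fract_conv_to_fract by (simp add: field_simps)
    qed
    moreover have "reg n p (Fract B (xv ^ N))" if "p \<in> basic xv" for p
      using that pt_power by (intro regI[OF AB(2) power_form[OF xv_form] eN]) (auto simp: basic_def)
    moreover have "reg n p (Fract A (yv ^ N))" if "p \<in> basic yv" for p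
      using that pt_power by (intro regI[OF AB(1) power_form[OF yv_form] eN]) (auto simp: basic_def)
    ultimately show ?thesis
      by (intro exI[of _ "Fract A (yv ^ N)"] exI[of _ "Fract B (xv ^ N)"]) (auto simp: algebra_simps)
  qed
  then obtain A B where AB: "tx - B = ty + A" "\<And>p. p \<in> basic xv \<Longrightarrow> reg n p B" "\<And>p. p \<in> basic yv \<Longrightarrow> reg n p A"
    by blast
  have "reg n p (\<tau> p - (tx - B))" if p: "p \<in> P1" for p
  proof (cases "xv \<in> p")
    case False
    then have "p \<in> basic xv" using p by (simp add: basic_def)
    then show ?thesis using reg_add[OF p tx AB(2)] by (simp add: algebra_simps)
  next
    case True
    then have "p \<in> basic yv" using p pt_chart[OF p] by (simp add: basic_def)
    then show ?thesis unfolding AB(1) using reg_diff[OF p ty AB(3)] by (simp add: algebra_simps)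
  qed
  then show ?thesis by blast
qed


section \<open>Sections of twists\<close>

definition cst :: "pt set \<Rightarrow> rat_fun \<Rightarrow> fn" where "cst U r = (\<lambda>p\<in>U. r)"

lemma cst_apply [simp]: "p \<in> U \<Longrightarrow> cst U r p = r" by (simp add: cst_def)

lemma restrict_cst [simp]: "V \<subseteq> U \<Longrightarrow> restrict (cst U r) V = cst V r"
  by (auto simp: cst_def restrict_def fun_eq_iff)

lemma cst_inject: "p \<in> U \<Longrightarrow> cst U r = cst U s \<longleftrightarrow> r = s"
  by (metis cst_apply)

lemma restrict_cst_binop [simp]: "(\<lambda>p\<in>U. cst U r p + cst U s p) = cst U (r + s)"
  "(\<lambda>p\<in>U. cst U r p * cst U s p) = cst U (r * s)"
  by (auto simp: cst_def restrict_def fun_eq_iff)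

lemma cst_twist: assumes U: "zopen U" and r: "\<And>p. p \<in> U \<Longrightarrow> reg n p r" shows "cst U r \<in> twist_sections n U"
  unfolding twist_sections_def
proof (safe)
  show "cst U r \<in> extensional U" by (simp add: cst_def)
  fix p assume p: "p \<in> U"
  obtain d e h f where 1: "h \<in> form e" "f \<in> form d" "int e = int d + n" "f \<notin> p" "r = Fract h f"
    using r[OF p] by (auto simp: reg_def)
  show "\<exists>V. zopen V \<and> p \<in> V \<and> V \<subseteq> U \<and> (\<exists>d e h f. h \<in> form e \<and> f \<in> form d \<and>
      int e = int d + n \<and> (\<forall>q\<in>V. f \<notin> q \<and> cst U r q = Fract h f))"
  proof (intro exI[of _ "U \<inter> basic f"] conjI)
    show "zopen (U \<inter> basic f)" using U basic_openin[OF 1(2)] by blast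
    show "p \<in> U \<inter> basic f" using p 1 openin_sub[OF U] by (auto simp: basic_def)
    show "\<exists>d e h f'. h \<in> form e \<and> f' \<in> form d \<and> int e = int d + n \<and>
        (\<forall>q\<in>U \<inter> basic f. f' \<notin> q \<and> cst U r q = Fract h f')"
      using 1 by (intro exI[of _ d] exI[of _ e] exI[of _ h] exI[of _ f]) (auto simp: basic_def)
  qed auto
qed

text \<open>Near each point the section is one fraction on a neighbourhood, and this neighbourhood
  contains \<open>gpt\<close>, so all values equal the one at \<open>gpt\<close>. Over the empty set
  any \<open>r\<close> fits, which is why \<open>cst_inject\<close> asks for a point.\<close>

lemma twist_sectionE:
  assumes U: "zopen U" and s: "s \<in> twist_sections n U"
  obtains r where "s = cst U r" "\<And>p. p \<in> U \<Longrightarrow> reg n p r"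
proof
  have *: "s p = s gpt \<and> reg n p (s gpt)" if "p \<in> U" for p
  proof -
    have "\<exists>V. zopen V \<and> p \<in> V \<and> V \<subseteq> U \<and> (\<exists>d e h f. h \<in> form e \<and> f \<in> form d \<and>
        int e = int d + n \<and> (\<forall>q\<in>V. f \<notin> q \<and> s q = Fract h f))"
      using s \<open>p \<in> U\<close> by (simp add: twist_sections_def)
    then obtain V d e h f where V: "zopen V" "p \<in> V" "h \<in> form e" "f \<in> form d" "int e = int d + n"
      "\<forall>q\<in>V. f \<notin> q \<and> s q = Fract h f"
      by (elim exE conjE)
    have "gpt \<in> V" using gpt_in_open V by blast
    then show ?thesis using V by (auto intro: regI)
  qed
  show "s = cst U (s gpt)"
  proof
    fix p show "s p = cst U (s gpt) p"
      using * s by (cases "p \<in> U") (auto simp: cst_def twist_sections_def extensional_def)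
  qed
  show "reg n p (s gpt)" if "p \<in> U" for p using * that by blast
qed

lemma twist_cst: "zopen U \<Longrightarrow> s \<in> twist_sections n U \<Longrightarrow> \<exists>r. s = cst U r"
  by (erule (1) twist_sectionE) blast

lemma cst_twist_iff: "zopen U \<Longrightarrow> cst U r \<in> twist_sections n U \<longleftrightarrow> (\<forall>p\<in>U. reg n p r)"
  using cst_twist[of U n r] twist_sectionE[of U "cst U r" n] by (metis cst_apply)

lemma twist_simps [simp]:
  "carrier (sec (twist n) U) = twist_sections n U"
  "\<zero>\<^bsub>sec (twist n) U\<^esub> = cst U 0"
  "cst U r \<oplus>\<^bsub>sec (twist n) U\<^esub> cst U s = cst U (r + s)"
  "cst U r \<odot>\<^bsub>sec (twist n) U\<^esub> cst U s = cst U (r * s)"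
  "res (twist n) U V = (\<lambda>s. restrict s V)"
  by (auto simp: twist_def) (simp add: cst_def)

lemma OX_simps [simp]:
  "carrier (OX U) = twist_sections 0 U"
  "\<zero>\<^bsub>OX U\<^esub> = cst U 0" "\<one>\<^bsub>OX U\<^esub> = cst U 1"
  "cst U r \<oplus>\<^bsub>OX U\<^esub> cst U s = cst U (r + s)"
  "cst U r \<otimes>\<^bsub>OX U\<^esub> cst U s = cst U (r * s)"
  by (auto simp: OX_def) (simp_all add: cst_def)


section \<open>Morphisms\<close>

lemma morphism_closed: "morphism_on W F G \<phi> \<Longrightarrow> zopen U \<Longrightarrow> U \<subseteq> W \<Longrightarrow> s \<in> carrier (sec F U) \<Longrightarrow>
    \<phi> U s \<in> carrier (sec G U)"
  by (simp add: morphism_on_def Pi_iff)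

lemma morphism_add: "morphism_on W F G \<phi> \<Longrightarrow> zopen U \<Longrightarrow> U \<subseteq> W \<Longrightarrow> s \<in> carrier (sec F U) \<Longrightarrow>
    t \<in> carrier (sec F U) \<Longrightarrow> \<phi> U (s \<oplus>\<^bsub>sec F U\<^esub> t) = \<phi> U s \<oplus>\<^bsub>sec G U\<^esub> \<phi> U t"
  by (simp add: morphism_on_def)

lemma morphism_smult: "morphism_on W F G \<phi> \<Longrightarrow> zopen U \<Longrightarrow> U \<subseteq> W \<Longrightarrow> s \<in> carrier (sec F U) \<Longrightarrow>
    r \<in> carrier (OX U) \<Longrightarrow> \<phi> U (r \<odot>\<^bsub>sec F U\<^esub> s) = r \<odot>\<^bsub>sec G U\<^esub> \<phi> U s"
  by (simp add: morphism_on_def del: OX_simps)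

lemma morphism_res: "morphism_on W F G \<phi> \<Longrightarrow> zopen U \<Longrightarrow> zopen V \<Longrightarrow> V \<subseteq> U \<Longrightarrow> U \<subseteq> W \<Longrightarrow>
    s \<in> carrier (sec F U) \<Longrightarrow> \<phi> V (res F U V s) = res G U V (\<phi> U s)"
  by (simp add: morphism_on_def)

lemma morphism_onI:
  assumes "\<And>U s. zopen U \<Longrightarrow> U \<subseteq> W \<Longrightarrow> s \<in> carrier (sec F U) \<Longrightarrow> \<phi> U s \<in> carrier (sec G U)"
    "\<And>U s t. zopen U \<Longrightarrow> U \<subseteq> W \<Longrightarrow> s \<in> carrier (sec F U) \<Longrightarrow> t \<in> carrier (sec F U) \<Longrightarrow>
      \<phi> U (s \<oplus>\<^bsub>sec F U\<^esub> t) = \<phi> U s \<oplus>\<^bsub>sec G U\<^esub> \<phi> U t"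
    "\<And>U r s. zopen U \<Longrightarrow> U \<subseteq> W \<Longrightarrow> r \<in> carrier (OX U) \<Longrightarrow> s \<in> carrier (sec F U) \<Longrightarrow>
      \<phi> U (r \<odot>\<^bsub>sec F U\<^esub> s) = r \<odot>\<^bsub>sec G U\<^esub> \<phi> U s"
    "\<And>U V s. zopen U \<Longrightarrow> zopen V \<Longrightarrow> V \<subseteq> U \<Longrightarrow> U \<subseteq> W \<Longrightarrow> s \<in> carrier (sec F U) \<Longrightarrow>
      \<phi> V (res F U V s) = res G U V (\<phi> U s)"
  shows "morphism_on W F G \<phi>"
  using assms by (simp add: morphism_on_def Pi_iff del: OX_simps)


section \<open>Tensor products\<close>

text \<open>The additive map from the free abelian group to the fraction field that extends
  \<open>v\<close> from the basis. It is the means by which classes of tensors are told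
  apart.\<close>

definition frag_eval :: "('k \<Rightarrow> rat_fun) \<Rightarrow> ('k \<Rightarrow>\<^sub>0 int) \<Rightarrow> rat_fun" where
  "frag_eval v c = (\<Sum>k\<in>Poly_Mapping.keys c. of_int (Poly_Mapping.lookup c k) * v k)"

lemma frag_eval_superset:
  "finite S \<Longrightarrow> Poly_Mapping.keys c \<subseteq> S \<Longrightarrow>
    frag_eval v c = (\<Sum>k\<in>S. of_int (Poly_Mapping.lookup c k) * v k)"
  unfolding frag_eval_def by (rule sum.mono_neutral_left) (auto simp: in_keys_iff)

lemma frag_eval_zero [simp]: "frag_eval v 0 = 0"
  by (simp add: frag_eval_def)

lemma frag_eval_of [simp]: "frag_eval v (frag_of k) = v k"
  by (simp add: frag_eval_def keys_frag_of)

lemma frag_eval_diff: "frag_eval v (c - d) = frag_eval v c - frag_eval v d"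
proof -
  let ?S = "Poly_Mapping.keys c \<union> Poly_Mapping.keys d"
  have "frag_eval v (c - d) = (\<Sum>k\<in>?S. of_int (Poly_Mapping.lookup (c - d) k) * v k)"
    by (rule frag_eval_superset) (use keys_diff[of c d] in auto)
  also have "\<dots> = (\<Sum>k\<in>?S. of_int (Poly_Mapping.lookup c k) * v k) - (\<Sum>k\<in>?S. of_int (Poly_Mapping.lookup d k) * v k)"
    by (simp add: lookup_minus left_diff_distrib sum_subtractf)
  also have "\<dots> = frag_eval v c - frag_eval v d"
    by (simp add: frag_eval_superset[of ?S])
  finally show ?thesis .
qed

lemma frag_eval_uminus: "frag_eval v (- c) = - frag_eval v c"
  using frag_eval_diff[of v 0 c] by simp

lemma frag_eval_add: "frag_eval v (c + d) = frag_eval v c + frag_eval v d"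
  using frag_eval_diff[of v c "- d"] by (simp add: frag_eval_uminus)

definition frag_map :: "('k \<Rightarrow> 'l) \<Rightarrow> ('k \<Rightarrow>\<^sub>0 int) \<Rightarrow> ('l \<Rightarrow>\<^sub>0 int)" where
  "frag_map f = frag_extend (\<lambda>k. frag_of (f k))"

lemma frag_map_simps [simp]: "frag_map f 0 = 0" "frag_map f (frag_of k) = frag_of (f k)"
  by (simp_all add: frag_map_def)

lemma frag_map_add: "frag_map f (c + d) = frag_map f c + frag_map f d"
  and frag_map_diff: "frag_map f (c - d) = frag_map f c - frag_map f d"
  and frag_map_uminus: "frag_map f (- c) = - frag_map f c"
  by (simp_all add: frag_map_def frag_extend_add frag_extend_diff frag_extend_minus)

lemma keys_frag_map: "Poly_Mapping.keys (frag_map f c) \<subseteq> f ` Poly_Mapping.keys c"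
  using keys_frag_extend[of "\<lambda>k. frag_of (f k)" c] by (auto simp: frag_map_def keys_frag_of)

lemma frag_eval_map: "frag_eval v (frag_map f c) = frag_eval (\<lambda>k. v (f k)) c"
proof (rule frag_induction[of c UNIV])
  fix a b assume "frag_eval v (frag_map f a) = frag_eval (\<lambda>k. v (f k)) a"
    "frag_eval v (frag_map f b) = frag_eval (\<lambda>k. v (f k)) b"
  then show "frag_eval v (frag_map f (a - b)) = frag_eval (\<lambda>k. v (f k)) (a - b)"
    by (simp only: frag_map_diff frag_eval_diff)
qed auto

lemma frag_eval_cong: "(\<And>k. k \<in> Poly_Mapping.keys c \<Longrightarrow> v k = w k) \<Longrightarrow> frag_eval v c = frag_eval w c"
  unfolding frag_eval_def by (rule sum.cong) auto

lemma frag_eval_scale: "frag_eval (\<lambda>k. a * v k) c = a * frag_eval v c"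
  unfolding frag_eval_def by (simp add: sum_distrib_left mult.left_commute)

abbreviation frag_group where
  "frag_group M N \<equiv> free_Abelian_group (carrier M \<times> carrier N)"

definition tensor_generators ::
  "'r ring \<Rightarrow> ('r, 'm) module \<Rightarrow> ('r, 'n) module \<Rightarrow> ('m \<times> 'n \<Rightarrow>\<^sub>0 int) set" where
  "tensor_generators R M N =
     {frag_of (m \<oplus>\<^bsub>M\<^esub> m', n) - frag_of (m, n) - frag_of (m', n) |m m' n.
         m \<in> carrier M \<and> m' \<in> carrier M \<and> n \<in> carrier N} \<union>
      {frag_of (m, n \<oplus>\<^bsub>N\<^esub> n') - frag_of (m, n) - frag_of (m, n') |m n n'.
         m \<in> carrier M \<and> n \<in> carrier N \<and> n' \<in> carrier N} \<union>
      {frag_of (r \<odot>\<^bsub>M\<^esub> m, n) - frag_of (m, r \<odot>\<^bsub>N\<^esub> n) |r m n.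
         r \<in> carrier R \<and> m \<in> carrier M \<and> n \<in> carrier N}"

definition tensor_class ::
  "'r ring \<Rightarrow> ('r, 'm) module \<Rightarrow> ('r, 'n) module \<Rightarrow> ('m \<times> 'n \<Rightarrow>\<^sub>0 int) \<Rightarrow> ('m \<times> 'n \<Rightarrow>\<^sub>0 int) set" where
  "tensor_class R M N c = (\<lambda>h. h + c) ` tensor_relations R M N"

lemma tensor_relations_generate:
  "tensor_relations R M N = generate (frag_group M N) (tensor_generators R M N)"
  by (simp add: tensor_relations_def tensor_generators_def)

text \<open>Closure under the operations places the bilinearity and balancing relations in the free
  abelian group on the pairs, so that they generate a subgroup of it.\<close>

locale closed_modules =
  fixes R :: "'r ring" and M :: "('r, 'm) module" and N :: "('r, 'n) module"
  assumes M_add: "\<And>m m'. m \<in> carrier M \<Longrightarrow> m' \<in> carrier M \<Longrightarrow> m \<oplus>\<^bsub>M\<^esub> m' \<in> carrier M"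
    and N_add: "\<And>m m'. m \<in> carrier N \<Longrightarrow> m' \<in> carrier N \<Longrightarrow> m \<oplus>\<^bsub>N\<^esub> m' \<in> carrier N"
    and M_smult: "\<And>r m. r \<in> carrier R \<Longrightarrow> m \<in> carrier M \<Longrightarrow> r \<odot>\<^bsub>M\<^esub> m \<in> carrier M"
    and N_smult: "\<And>r m. r \<in> carrier R \<Longrightarrow> m \<in> carrier N \<Longrightarrow> r \<odot>\<^bsub>N\<^esub> m \<in> carrier N"
begin

lemma generators_carrier: "tensor_generators R M N \<subseteq> carrier (frag_group M N)"
proof
  have D: "c - d \<in> carrier (frag_group M N)"
    if "c \<in> carrier (frag_group M N)" "d \<in> carrier (frag_group M N)" for c d
    using that keys_diff[of c d] by auto
  fix g assume "g \<in> tensor_generators R M N"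
  then show "g \<in> carrier (frag_group M N)"
    unfolding tensor_generators_def
    by (elim UnE CollectE exE conjE; simp only:)
      (intro D; simp only: frag_of_in_free_Abelian_group; simp add: M_add N_add M_smult N_smult)+
qed

lemma relations_subgroup: "subgroup (tensor_relations R M N) (frag_group M N)"
  unfolding tensor_relations_generate
  by (rule group.generate_is_subgroup[OF group_free_Abelian_group generators_carrier])

lemma relations_normal: "tensor_relations R M N \<lhd> frag_group M N"
  using comm_group.normal_iff_subgroup[OF abelian_free_Abelian_group] relations_subgroup by blast

lemma relations_carrier: "h \<in> tensor_relations R M N \<Longrightarrow> Poly_Mapping.keys h \<subseteq> carrier M \<times> carrier N"
  using subsetD[OF subgroup.subset[OF relations_subgroup], of h] by simp

lemma relations_zero: "0 \<in> tensor_relations R M N"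
  using subgroup.one_closed[OF relations_subgroup] by simp

lemma relations_add: "h \<in> tensor_relations R M N \<Longrightarrow> k \<in> tensor_relations R M N \<Longrightarrow> h + k \<in> tensor_relations R M N"
  using subgroup.m_closed[OF relations_subgroup] by force

lemma relations_uminus: "h \<in> tensor_relations R M N \<Longrightarrow> - h \<in> tensor_relations R M N"
  using subgroup.m_inv_closed[OF relations_subgroup] relations_carrier by force

lemma relations_diff: "h \<in> tensor_relations R M N \<Longrightarrow> k \<in> tensor_relations R M N \<Longrightarrow> h - k \<in> tensor_relations R M N"
  using relations_add[of h "- k"] relations_uminus by simp

lemma relations_generator: "g \<in> tensor_generators R M N \<Longrightarrow> g \<in> tensor_relations R M N"
  unfolding tensor_relations_generate by (rule generate.incl)

lemma relations_induct [consumes 1, case_names zero generator uminus add]: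
  assumes "h \<in> tensor_relations R M N" "P 0" "\<And>g. g \<in> tensor_generators R M N \<Longrightarrow> P g"
    "\<And>g. P g \<Longrightarrow> P (- g)" "\<And>g h. P g \<Longrightarrow> P h \<Longrightarrow> P (g + h)"
  shows "P h"
  using assms(1) unfolding tensor_relations_generate
proof (induction rule: generate.induct)
  case (inv h)
  then show ?case using generators_carrier assms(3,4) by force
qed (use assms in auto)

lemma tensor_class_eq_iff: "tensor_class R M N c = tensor_class R M N d \<longleftrightarrow> c - d \<in> tensor_relations R M N"
proof
  assume *: "tensor_class R M N c = tensor_class R M N d"
  have "0 + c \<in> tensor_class R M N c" unfolding tensor_class_def using relations_zero by blast
  then obtain h where "h \<in> tensor_relations R M N" "0 + c = h + d"
    unfolding * by (auto simp: tensor_class_def)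
  then show "c - d \<in> tensor_relations R M N" by (simp add: algebra_simps)
next
  assume cd: "c - d \<in> tensor_relations R M N"
  show "tensor_class R M N c = tensor_class R M N d"
  proof (intro Set.equalityI subsetI)
    fix e assume "e \<in> tensor_class R M N c"
    then obtain h where "h \<in> tensor_relations R M N" "e = h + c" by (auto simp: tensor_class_def)
    then have "h + (c - d) \<in> tensor_relations R M N" "e = (h + (c - d)) + d"
      using relations_add cd by auto
    then show "e \<in> tensor_class R M N d" unfolding tensor_class_def by blast
  next
    fix e assume "e \<in> tensor_class R M N d"
    then obtain h where "h \<in> tensor_relations R M N" "e = h + d" by (auto simp: tensor_class_def)
    then have "h - (c - d) \<in> tensor_relations R M N" "e = (h - (c - d)) + c"
      using relations_diff cd by auto
    then show "e \<in> tensor_class R M N c" unfolding tensor_class_def by blast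
  qed
qed

lemma tensor_class_coset:
  "tensor_relations R M N #>\<^bsub>frag_group M N\<^esub> c = tensor_class R M N c"
  by (auto simp: r_coset_def tensor_class_def)

lemma tensor_carrier:
  "carrier (tensor_module R M N) = tensor_class R M N ` {c. Poly_Mapping.keys c \<subseteq> carrier M \<times> carrier N}"
  by (auto simp: tensor_module_def tensor_group_def FactGroup_def RCOSETS_def tensor_class_coset)

lemma tensor_zero: "\<zero>\<^bsub>tensor_module R M N\<^esub> = tensor_class R M N 0"
  by (simp add: tensor_module_def tensor_group_def FactGroup_def tensor_class_def)

lemma tensor_add:
  assumes "Poly_Mapping.keys c \<subseteq> carrier M \<times> carrier N" "Poly_Mapping.keys d \<subseteq> carrier M \<times> carrier N"
  shows "tensor_class R M N c \<oplus>\<^bsub>tensor_module R M N\<^esub> tensor_class R M N d = tensor_class R M N (c + d)"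
  using normal.rcos_sum[OF relations_normal, of c d] assms
  by (simp add: tensor_module_def tensor_group_def FactGroup_def tensor_class_coset)

text \<open>An additive map that kills the generators of the relations kills all relations and
  therefore descends to the tensor product.\<close>

lemma frag_eval_tensor_class:
  assumes "\<And>g. g \<in> tensor_generators R M N \<Longrightarrow> frag_eval v g = 0" "e \<in> tensor_class R M N c"
  shows "frag_eval v e = frag_eval v c"
proof -
  have "frag_eval v h = 0" if "h \<in> tensor_relations R M N" for h
    using that by (induction rule: relations_induct) (auto simp: assms frag_eval_add frag_eval_uminus)
  then show ?thesis using assms(2) by (auto simp: tensor_class_def frag_eval_add)
qed

end

lemma tensor_lift_class:
  assumes 1: "closed_modules R M N" and 2: "closed_modules R' M' N'"
    and f: "\<And>g. g \<in> tensor_generators R M N \<Longrightarrow> frag_map f g \<in> tensor_relations R' M' N'"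
  shows "tensor_lift R' M' N' f (tensor_class R M N c) = tensor_class R' M' N' (frag_map f c)"
proof -
  interpret A: closed_modules R M N by (rule 1)
  interpret B: closed_modules R' M' N' by (rule 2)
  have rel: "frag_map f h \<in> tensor_relations R' M' N'" if "h \<in> tensor_relations R M N" for h
    using that by (induction rule: A.relations_induct)
      (auto simp: f frag_map_add frag_map_uminus B.relations_zero B.relations_add B.relations_uminus)
  have "tensor_class R' M' N' (frag_map f e) = tensor_class R' M' N' (frag_map f c)"
    if "e \<in> tensor_class R M N c" for e
    using that rel unfolding B.tensor_class_eq_iff by (auto simp: tensor_class_def frag_map_add)
  moreover have "c \<in> tensor_class R M N c"
    using A.relations_zero unfolding tensor_class_def by force
  ultimately show ?thesis
    unfolding tensor_lift_def B.tensor_class_coset frag_map_def[symmetric] by blast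
qed


section \<open>The twisted ideal sheaf\<close>

locale twisted_ideal =
  fixes I :: subscheme and b :: int
  assumes ideals: "sheaf_of_ideals I"
begin

lemma I_ideal: "zopen U \<Longrightarrow> ideal (I U) (OX U)"
  using ideals by (simp add: sheaf_of_ideals_def)

lemma I_sub: "zopen U \<Longrightarrow> s \<in> I U \<Longrightarrow> s \<in> twist_sections 0 U"
  using ideal.Icarr[OF I_ideal] by fastforce

lemma I_E:
  assumes "zopen U" "s \<in> I U"
  obtains r where "s = cst U r" "\<And>p. p \<in> U \<Longrightarrow> reg 0 p r"
  by (rule twist_sectionE[OF assms(1) I_sub[OF assms]]) (rule that)

lemma I_cst: "zopen U \<Longrightarrow> s \<in> I U \<Longrightarrow> \<exists>r. s = cst U r"
  by (erule (1) I_E) blast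

lemma I_add: "zopen U \<Longrightarrow> cst U r \<in> I U \<Longrightarrow> cst U s \<in> I U \<Longrightarrow> cst U (r + s) \<in> I U"
  using additive_subgroup.a_closed[OF ideal.axioms(1)[OF I_ideal], of U "cst U r" "cst U s"] by simp

lemma I_mult: "zopen U \<Longrightarrow> cst U r \<in> I U \<Longrightarrow> (\<And>p. p \<in> U \<Longrightarrow> reg 0 p c) \<Longrightarrow> cst U (c * r) \<in> I U"
  using ideal.I_l_closed[OF I_ideal, of U "cst U r" "cst U c"] cst_twist[of U 0 c] by simp

lemma I_zero: "zopen U \<Longrightarrow> cst U 0 \<in> I U"
  using additive_subgroup.zero_closed[OF ideal.axioms(1)[OF I_ideal]] by fastforce

lemma I_diff: assumes U: "zopen U" "cst U r \<in> I U" "cst U s \<in> I U" shows "cst U (r - s) \<in> I U"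
proof -
  have "cst U (- 1 * s) \<in> I U"
    using I_mult[OF U(1,3), of "- 1"] reg_uminus[OF _ reg_one] openin_sub[OF U(1)] by blast
  from I_add[OF U(1,2) this] show ?thesis by simp
qed

lemma I_restrict: "zopen U \<Longrightarrow> zopen V \<Longrightarrow> V \<subseteq> U \<Longrightarrow> s \<in> I U \<Longrightarrow> restrict s V \<in> I V"
  using ideals by (simp add: sheaf_of_ideals_def)

abbreviation "MI U \<equiv> sec (ideal_sheaf I) U"
abbreviation "NB U \<equiv> sec (twist b) U"
abbreviation "pairs U \<equiv> I U \<times> twist_sections b U"
abbreviation "rels U \<equiv> tensor_relations (OX U) (MI U) (NB U)"
abbreviation "cls U \<equiv> tensor_class (OX U) (MI U) (NB U)"
abbreviation "PT \<equiv> tensor_presheaf (ideal_sheaf I) (twist b)"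

lemma MI_simps [simp]: "carrier (MI U) = I U"
  "cst U r \<oplus>\<^bsub>MI U\<^esub> cst U s = cst U (r + s)"
  "cst U r \<odot>\<^bsub>MI U\<^esub> cst U s = cst U (r * s)"
  "res (ideal_sheaf I) U V = (\<lambda>s. restrict s V)"
  using twist_simps(3,4)[where n = 0] by (simp_all add: ideal_sheaf_def)

lemma closed: assumes U: "zopen U" shows "closed_modules (OX U) (MI U) (NB U)"
proof
  have P1: "p \<in> P1" if "p \<in> U" for p using that openin_sub[OF U] by blast
  show "m \<oplus>\<^bsub>MI U\<^esub> m' \<in> carrier (MI U)" if mm: "m \<in> carrier (MI U)" "m' \<in> carrier (MI U)" for m m'
  proof -
    obtain r r' where "m = cst U r" "m' = cst U r'" using mm I_cst[OF U] by (metis MI_simps(1))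
    then show ?thesis using mm I_add[OF U] by simp
  qed
  show "m \<oplus>\<^bsub>NB U\<^esub> m' \<in> carrier (NB U)" if "m \<in> carrier (NB U)" "m' \<in> carrier (NB U)" for m m'
    using that by (auto elim!: twist_sectionE[OF U] intro!: cst_twist[OF U] reg_add P1)
  show "r \<odot>\<^bsub>MI U\<^esub> m \<in> carrier (MI U)" if rm: "r \<in> carrier (OX U)" "m \<in> carrier (MI U)" for r m
  proof -
    obtain c where "r = cst U c" "\<And>p. p \<in> U \<Longrightarrow> reg 0 p c"
      by (rule twist_sectionE[OF U, of r 0]) (use rm in auto)
    moreover obtain r' where "m = cst U r'" using rm I_cst[OF U] by (metis MI_simps(1))
    ultimately show ?thesis using rm I_mult[OF U] by simp
  qed
  show "r \<odot>\<^bsub>NB U\<^esub> m \<in> carrier (NB U)" if "r \<in> carrier (OX U)" "m \<in> carrier (NB U)" for r m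
    using that by (auto elim!: twist_sectionE[OF U] intro!: cst_twist[OF U] reg_mult'[of _ 0 _ b] P1)
qed

text \<open>Rewrites the three kinds of relations in terms of constants, so that the module
  operations become sums and products of rational functions.\<close>

lemma generator_cases:
  assumes U: "zopen U" and g: "g \<in> tensor_generators (OX U) (MI U) (NB U)"
  obtains
    (left) r s t where "g = frag_of (cst U (r + s), cst U t) - frag_of (cst U r, cst U t) - frag_of (cst U s, cst U t)"
      "cst U r \<in> I U" "cst U s \<in> I U" "cst U t \<in> twist_sections b U"
  | (right) r s t where "g = frag_of (cst U r, cst U (s + t)) - frag_of (cst U r, cst U s) - frag_of (cst U r, cst U t)"
      "cst U r \<in> I U" "cst U s \<in> twist_sections b U" "cst U t \<in> twist_sections b U"
  | (balance) r s t where "g = frag_of (cst U (r * s), cst U t) - frag_of (cst U s, cst U (r * t))"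
      "cst U r \<in> twist_sections 0 U" "cst U s \<in> I U" "cst U t \<in> twist_sections b U"
proof -
  consider (1) m m' n where "g = frag_of (m \<oplus>\<^bsub>MI U\<^esub> m', n) - frag_of (m, n) - frag_of (m', n)"
      "m \<in> I U" "m' \<in> I U" "n \<in> twist_sections b U"
    | (2) m n n' where "g = frag_of (m, n \<oplus>\<^bsub>NB U\<^esub> n') - frag_of (m, n) - frag_of (m, n')"
      "m \<in> I U" "n \<in> twist_sections b U" "n' \<in> twist_sections b U"
    | (3) r m n where "g = frag_of (r \<odot>\<^bsub>MI U\<^esub> m, n) - frag_of (m, r \<odot>\<^bsub>NB U\<^esub> n)"
      "r \<in> twist_sections 0 U" "m \<in> I U" "n \<in> twist_sections b U"
    using g unfolding tensor_generators_def by auto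
  then show thesis
  proof cases
    case 1
    moreover obtain r s t where "m = cst U r" "m' = cst U s" "n = cst U t"
      using 1 by (metis I_cst[OF U] twist_cst[OF U])
    ultimately show thesis using left by simp
  next
    case 2
    moreover obtain r s t where "m = cst U r" "n = cst U s" "n' = cst U t"
      using 2 by (metis I_cst[OF U] twist_cst[OF U])
    ultimately show thesis using right by simp
  next
    case 3
    moreover obtain q s t where "r = cst U q" "m = cst U s" "n = cst U t"
      using 3 by (metis I_cst[OF U] twist_cst[OF U])
    ultimately show thesis using balance by simp
  qed
qed

lemma rels_left: "zopen U \<Longrightarrow> cst U r \<in> I U \<Longrightarrow> cst U s \<in> I U \<Longrightarrow> cst U t \<in> twist_sections b U \<Longrightarrow>
    frag_of (cst U (r + s), cst U t) - frag_of (cst U r, cst U t) - frag_of (cst U s, cst U t) \<in> rels U"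
  by (rule closed_modules.relations_generator[OF closed], assumption)
    (auto simp: tensor_generators_def simp flip: MI_simps(2))

lemma rels_right:
  assumes "zopen U" "cst U r \<in> I U" "cst U s \<in> twist_sections b U" "cst U t \<in> twist_sections b U"
  shows "frag_of (cst U r, cst U (s + t)) - frag_of (cst U r, cst U s) - frag_of (cst U r, cst U t) \<in> rels U"
proof (rule closed_modules.relations_generator[OF closed[OF assms(1)]])
  have "frag_of (cst U r, cst U (s + t)) - frag_of (cst U r, cst U s) - frag_of (cst U r, cst U t) =
    frag_of (cst U r, cst U s \<oplus>\<^bsub>NB U\<^esub> cst U t) - frag_of (cst U r, cst U s) - frag_of (cst U r, cst U t)"
    by simp
  then show "frag_of (cst U r, cst U (s + t)) - frag_of (cst U r, cst U s) - frag_of (cst U r, cst U t)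
      \<in> tensor_generators (OX U) (MI U) (NB U)"
    unfolding tensor_generators_def using assms by fastforce
qed

lemma rels_balance:
  assumes "zopen U" "cst U r \<in> twist_sections 0 U" "cst U s \<in> I U" "cst U t \<in> twist_sections b U"
  shows "frag_of (cst U (r * s), cst U t) - frag_of (cst U s, cst U (r * t)) \<in> rels U"
proof (rule closed_modules.relations_generator[OF closed[OF assms(1)]])
  have "frag_of (cst U (r * s), cst U t) - frag_of (cst U s, cst U (r * t)) =
    frag_of (cst U r \<odot>\<^bsub>MI U\<^esub> cst U s, cst U t) - frag_of (cst U s, cst U r \<odot>\<^bsub>NB U\<^esub> cst U t)" by simp
  then show "frag_of (cst U (r * s), cst U t) - frag_of (cst U s, cst U (r * t)) \<in> tensor_generators (OX U) (MI U) (NB U)"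
    unfolding tensor_generators_def using assms by fastforce
qed

text \<open>The multiplication map on formal sums of pairs. As sections are constant, their values
  at the generic point stand for them.\<close>

definition val :: "(fn \<times> fn \<Rightarrow>\<^sub>0 int) \<Rightarrow> rat_fun" where
  "val = frag_eval (\<lambda>k. fst k gpt * snd k gpt)"

lemma val_simps [simp]: "val 0 = 0" "val (frag_of k) = fst k gpt * snd k gpt"
  "val (c + d) = val c + val d" "val (c - d) = val c - val d"
  by (simp_all add: val_def frag_eval_add frag_eval_diff)

text \<open>The representative is arbitrary; over a nonempty open set the value does not depend on
  it.\<close>

definition class_val :: "(fn \<times> fn \<Rightarrow>\<^sub>0 int) set \<Rightarrow> rat_fun" where
  "class_val C = val (SOME c. c \<in> C)"

text \<open>Multiplication is bilinear and balanced, so it vanishes on the relations. A point of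
  \<open>U\<close> is required to have \<open>gpt\<close> in \<open>U\<close>: elsewhere a section
  has an unspecified value.\<close>

lemma class_val: assumes U: "zopen U" "x \<in> U" shows "class_val (cls U c) = val c"
proof -
  interpret closed_modules "OX U" "MI U" "NB U" by (rule closed[OF U(1)])
  have g: "gpt \<in> U" using gpt_in_open U by blast
  have "c \<in> cls U c" using relations_zero unfolding tensor_class_def by force
  then have S: "(SOME e. e \<in> cls U c) \<in> cls U c" by (rule someI)
  have "frag_eval (\<lambda>k. fst k gpt * snd k gpt) h = 0" if "h \<in> tensor_generators (OX U) (MI U) (NB U)" for h
    using generator_cases[OF U(1) that] g by cases (auto simp: frag_eval_diff distrib_left distrib_right)
  from frag_eval_tensor_class[OF this S] show ?thesis by (simp add: class_val_def val_def)
qed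

section \<open>Sections and restrictions of the tensor presheaf\<close>

lemma PT_carrier: "zopen U \<Longrightarrow> carrier (sec PT U) = cls U ` {c. Poly_Mapping.keys c \<subseteq> pairs U}"
  by (simp add: tensor_presheaf_def closed_modules.tensor_carrier[OF closed])

lemma PT_zero: "zopen U \<Longrightarrow> \<zero>\<^bsub>sec PT U\<^esub> = cls U 0"
  by (simp add: tensor_presheaf_def closed_modules.tensor_zero[OF closed])

lemma PT_add: "zopen U \<Longrightarrow> Poly_Mapping.keys c \<subseteq> pairs U \<Longrightarrow> Poly_Mapping.keys d \<subseteq> pairs U \<Longrightarrow>
    cls U c \<oplus>\<^bsub>sec PT U\<^esub> cls U d = cls U (c + d)"
  by (simp add: tensor_presheaf_def closed_modules.tensor_add[OF closed])

abbreviation "restrict_pair V \<equiv> map_prod (\<lambda>s. restrict s V) (\<lambda>s. restrict s V)"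

lemma PT_res:
  assumes UV: "zopen U" "zopen V" "V \<subseteq> U"
  shows "res PT U V (cls U c) = cls V (frag_map (restrict_pair V) c)"
proof -
  interpret closed_modules "OX V" "MI V" "NB V" by (rule closed[OF UV(2)])
  have t: "cst V t \<in> twist_sections n V" if "cst U t \<in> twist_sections n U" for t n
    using that UV cst_twist_iff by blast
  have i: "cst V t \<in> I V" if "cst U t \<in> I U" for t
    using I_restrict[OF UV that] UV(3) by simp
  have "frag_map (restrict_pair V) g \<in> rels V" if "g \<in> tensor_generators (OX U) (MI U) (NB U)" for g
    using UV(1) that
  proof (cases rule: generator_cases)
    case (left r s t)
    show ?thesis using rels_left[OF UV(2) i[OF left(2)] i[OF left(3)] t[OF left(4)]] UV(3)
      by (simp add: left(1) frag_map_diff)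
  next
    case (right r s t)
    show ?thesis using rels_right[OF UV(2) i[OF right(2)] t[OF right(3)] t[OF right(4)]] UV(3)
      by (simp add: right(1) frag_map_diff)
  next
    case (balance r s t)
    show ?thesis using rels_balance[OF UV(2) t[OF balance(2)] i[OF balance(3)] t[OF balance(4)]] UV(3)
      by (simp add: balance(1) frag_map_diff)
  qed
  from tensor_lift_class[OF closed[OF UV(1)] closed[OF UV(2)] this]
  show ?thesis by (simp add: tensor_presheaf_def)
qed

lemma keys_cut:
  assumes UV: "zopen U" "zopen V" "V \<subseteq> U" and c: "Poly_Mapping.keys c \<subseteq> pairs U"
  shows "Poly_Mapping.keys (frag_map (restrict_pair V) c) \<subseteq> pairs V"
proof -
  have "restrict_pair V k \<in> pairs V" if k: "k \<in> pairs U" for k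
  proof -
    obtain t where t: "snd k = cst U t" "\<And>p. p \<in> U \<Longrightarrow> reg b p t"
      using twist_sectionE[OF UV(1), of "snd k" b] k by (metis SigmaE snd_conv)
    have "restrict (fst k) V \<in> I V" using I_restrict[OF UV] k by auto
    moreover have "restrict (snd k) V \<in> twist_sections b V" using t UV by (auto intro!: cst_twist)
    ultimately show ?thesis by (cases k) auto
  qed
  then have "restrict_pair V ` Poly_Mapping.keys c \<subseteq> pairs V" using c by (meson image_subsetI subsetD)
  with keys_frag_map[of "restrict_pair V" c] show ?thesis by (rule order_trans)
qed

lemma val_cut: "gpt \<in> V \<Longrightarrow> val (frag_map (restrict_pair V) c) = val c"
  unfolding val_def frag_eval_map by (intro frag_eval_cong) auto

lemma PT_res_closed:
  assumes "zopen U" "zopen V" "V \<subseteq> U" "C \<in> carrier (sec PT U)"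
  shows "res PT U V C \<in> carrier (sec PT V)"
  using assms(4) keys_cut[OF assms(1-3)] by (auto simp: PT_carrier assms(1,2) PT_res[OF assms(1-3)])

lemma class_val_res:
  assumes "zopen U" "zopen V" "V \<subseteq> U" "x \<in> V" "C \<in> carrier (sec PT U)"
  shows "class_val (res PT U V C) = class_val C"
proof -
  have g: "gpt \<in> V" using gpt_in_open assms by blast
  have "gpt \<in> U" using g assms(3) by blast
  then show ?thesis using assms(5) g
    by (auto simp: PT_carrier assms(1,2) PT_res[OF assms(1-3)] class_val[OF assms(1)] class_val[OF assms(2)] val_cut)
qed

text \<open>On a subset of the chart O(b) is free with generator l^b. So the tensor of r and t
  equals that of (t / l^b) r and l^b, and tensors with the same second factor are combined in the
  first.\<close>

lemma normal_form:
  assumes U: "zopen U" "U \<subseteq> basic l" and l: "l \<in> form 1" "l \<noteq> 0" and c: "Poly_Mapping.keys c \<subseteq> pairs U"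
  shows "\<exists>m. cst U m \<in> I U \<and> c - frag_of (cst U m, cst U (lpow l b)) \<in> rels U"
proof -
  interpret closed_modules "OX U" "MI U" "NB U" by (rule closed[OF U(1)])
  let ?e = "cst U (lpow l b)"
  have e: "?e \<in> twist_sections b U"
    using U l by (intro cst_twist reg_lpow) (auto simp: basic_def)
  show ?thesis using c
  proof (induction c rule: frag_induction)
    case zero
    \<comment> \<open>Additivity for 0 + 0 = 0 says that the tensor of 0 with the generator is a
      relation.\<close>
    have "frag_of (cst U (0 + 0), ?e) - frag_of (cst U 0, ?e) - frag_of (cst U 0, ?e) \<in> rels U"
      by (intro rels_left U e I_zero)
    then show ?case using I_zero[OF U(1)] by (intro exI[of _ 0]) simp
  next
    case (one k)
    then obtain s s' where s: "k = (s, s')" "s \<in> I U" "s' \<in> twist_sections b U" by blast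
    obtain r where r: "s = cst U r" using I_cst[OF U(1) s(2)] by blast
    obtain t where t: "s' = cst U t" "\<And>p. p \<in> U \<Longrightarrow> reg b p t" by (rule twist_sectionE[OF U(1) s(3)]) (rule that)
    have k: "k = (cst U r, cst U t)" "cst U r \<in> I U" "\<And>p. p \<in> U \<Longrightarrow> reg b p t"
      using s r t by auto
    have u: "reg 0 p (t / lpow l b)" if "p \<in> U" for p
      using reg_div_lpow[of p l b t 0 b] k(3)[OF that] that U(2) l by (auto simp: basic_def)
    have "frag_of (cst U (t / lpow l b * r), ?e) - frag_of (cst U r, cst U (t / lpow l b * lpow l b)) \<in> rels U"
      by (intro rels_balance U k e cst_twist u)
    then have "- (frag_of (cst U (t / lpow l b * r), ?e) - frag_of (cst U r, cst U t)) \<in> rels U"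
      using lpow_nz[OF l(2)] by (intro relations_uminus) simp
    then show ?case using I_mult[OF U(1) k(2) u] unfolding k(1)
      by (intro exI[of _ "t / lpow l b * r"]) simp
  next
    case (diff c d)
    then obtain m m' where m: "cst U m \<in> I U" "c - frag_of (cst U m, ?e) \<in> rels U"
      "cst U m' \<in> I U" "d - frag_of (cst U m', ?e) \<in> rels U" by blast
    have d: "cst U (m - m') \<in> I U" using I_diff U m by blast
    \<comment> \<open>Differences are not among the generating relations; additivity is applied to
      (m - m') + m' = m instead.\<close>
    have "frag_of (cst U (m - m' + m'), ?e) - frag_of (cst U (m - m'), ?e) - frag_of (cst U m', ?e) \<in> rels U"
      by (intro rels_left U d m e)
    from relations_add[OF relations_diff[OF m(2,4)] this]
    have "(c - d) - frag_of (cst U (m - m'), ?e) \<in> rels U" by (simp add: algebra_simps)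
    then show ?case using d by blast
  qed
qed

lemma normal_class:
  assumes U: "zopen U" "U \<subseteq> basic l" and l: "l \<in> form 1" "l \<noteq> 0" and x: "x \<in> U"
    and C: "C \<in> carrier (sec PT U)"
  shows "\<exists>m. cst U m \<in> I U \<and> C = cls U (frag_of (cst U m, cst U (lpow l b))) \<and> class_val C = m * lpow l b"
proof -
  interpret closed_modules "OX U" "MI U" "NB U" by (rule closed[OF U(1)])
  obtain c where c: "C = cls U c" "Poly_Mapping.keys c \<subseteq> pairs U" using C by (auto simp: PT_carrier[OF U(1)])
  obtain m where m: "cst U m \<in> I U" "c - frag_of (cst U m, cst U (lpow l b)) \<in> rels U"
    using normal_form[OF U l c(2)] by blast
  have "C = cls U (frag_of (cst U m, cst U (lpow l b)))" using m(2) by (simp add: c tensor_class_eq_iff)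
  moreover have "gpt \<in> U" using gpt_in_open U x by blast
  ultimately show ?thesis using m(1) by (auto simp: class_val[OF U(1)])
qed

text \<open>For tensors in normal form the value m l^b determines m. Thus multiplication embeds the
  tensor product into O(b) over every nonempty open subset of a chart.\<close>

lemma class_eqI:
  assumes U: "zopen U" "U \<subseteq> basic l" and l: "l \<in> form 1" "l \<noteq> 0" and x: "x \<in> U"
    and C: "C \<in> carrier (sec PT U)" "D \<in> carrier (sec PT U)" "class_val C = class_val D"
  shows "C = D"
proof -
  obtain m m' where "C = cls U (frag_of (cst U m, cst U (lpow l b)))" "class_val C = m * lpow l b"
    "D = cls U (frag_of (cst U m', cst U (lpow l b)))" "class_val D = m' * lpow l b"
    using normal_class[OF U l x C(1)] normal_class[OF U l x C(2)] by blast
  then show ?thesis using C(3) lpow_nz[OF l(2)] by simp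
qed

text \<open>This holds because the tensor product is locally a subsheaf of the twist.\<close>
lemma germ_eqI:
  assumes V: "zopen V" "x \<in> V" "C \<in> carrier (sec PT V)"
    and V': "zopen V'" "x \<in> V'" "C' \<in> carrier (sec PT V')" and eq: "class_val C = class_val C'"
  shows "germ PT x V C = germ PT x V' C'"
proof -
  have "germ PT x V C \<subseteq> germ PT x V' C'"
    if V: "zopen V" "x \<in> V" "C \<in> carrier (sec PT V)"
      and V': "zopen V'" "x \<in> V'" "C' \<in> carrier (sec PT V')" and eq: "class_val C = class_val C'"
    for V V' C C'
  proof safe
    have x: "x \<in> P1" using V openin_sub by blast
    obtain l where l: "l \<in> form 1" "l \<noteq> 0" "x \<in> basic l" using chartE[OF x] by metis
    fix V'' t assume "(V'', t) \<in> germ PT x V C"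
    then obtain W where t: "zopen V''" "x \<in> V''" "t \<in> carrier (sec PT V'')"
      and W: "zopen W" "x \<in> W" "W \<subseteq> V" "W \<subseteq> V''" "res PT V W C = res PT V'' W t"
      by (auto simp: germ_def)
    \<comment> \<open>Inside a chart, classes can be compared by their values.\<close>
    define W' where "W' = W \<inter> V' \<inter> basic l"
    have W': "zopen W'" "x \<in> W'" "W' \<subseteq> V'" "W' \<subseteq> V''" "W' \<subseteq> basic l"
      using W V' basic_openin[OF l(1)] l(3) by (auto simp: W'_def)
    have "class_val t = class_val (res PT V'' W t)" using class_val_res t W by metis
    also have "\<dots> = class_val C'" using W(5) class_val_res[of V W x C] V W eq by simp
    finally have "class_val (res PT V' W' C') = class_val (res PT V'' W' t)"
      using class_val_res[of V' W' x C'] class_val_res[of V'' W' x t] W' V' t by simp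
    then have "res PT V' W' C' = res PT V'' W' t"
      using W' V' t by (intro class_eqI[OF W'(1,5) l(1,2) W'(2)] PT_res_closed) auto
    then show "(V'', t) \<in> germ PT x V' C'" unfolding germ_def using t W' by blast
  qed
  from this[OF V V' eq] this[OF V' V eq[symmetric]] show ?thesis by blast
qed

lemma germ_memD:
  assumes "zopen V" "x \<in> V" "C \<in> carrier (sec PT V)" "(W, D) \<in> germ PT x V C"
  shows "zopen W" "x \<in> W" "D \<in> carrier (sec PT W)" "class_val D = class_val C"
proof -
  from assms(4) obtain X where W: "zopen W" "x \<in> W" "D \<in> carrier (sec PT W)"
     and X: "zopen X" "x \<in> X" "X \<subseteq> V" "X \<subseteq> W" "res PT V X C = res PT W X D"
    by (auto simp: germ_def)
  show "zopen W" "x \<in> W" "D \<in> carrier (sec PT W)" by fact+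
  show "class_val D = class_val C"
    using class_val_res[OF W(1) X(1,4,2) W(3)] class_val_res[OF assms(1) X(1,3,2) assms(3)] X(5) by simp
qed

lemma germ_self: "zopen V \<Longrightarrow> x \<in> V \<Longrightarrow> C \<in> carrier (sec PT V) \<Longrightarrow> (V, C) \<in> germ PT x V C"
  by (auto simp: germ_def)

section \<open>Values of germs and of sections of the sheafification\<close>

definition germ_val :: "(pt set \<times> (fn \<times> fn \<Rightarrow>\<^sub>0 int) set) set \<Rightarrow> rat_fun" where
  "germ_val A = class_val (snd (SOME a. a \<in> A))"

lemma germ_val:
  assumes "zopen V" "x \<in> V" "C \<in> carrier (sec PT V)"
  shows "germ_val (germ PT x V C) = class_val C"
proof -
  have "(SOME a. a \<in> germ PT x V C) \<in> germ PT x V C" using germ_self[OF assms] by (rule someI)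
  then show ?thesis using germ_memD(4)[OF assms, of "fst (SOME a. a \<in> germ PT x V C)" "snd (SOME a. a \<in> germ PT x V C)"]
    by (simp add: germ_val_def)
qed

lemma PT_add_closed:
  assumes U: "zopen U" "x \<in> U" and C: "C \<in> carrier (sec PT U)" "D \<in> carrier (sec PT U)"
  shows "C \<oplus>\<^bsub>sec PT U\<^esub> D \<in> carrier (sec PT U)" "class_val (C \<oplus>\<^bsub>sec PT U\<^esub> D) = class_val C + class_val D"
proof -
  obtain c d where c: "C = cls U c" "Poly_Mapping.keys c \<subseteq> pairs U" "D = cls U d" "Poly_Mapping.keys d \<subseteq> pairs U"
    using C by (auto simp: PT_carrier[OF U(1)])
  have "Poly_Mapping.keys (c + d) \<subseteq> pairs U" using keys_add[of c d] c by (meson Un_least order_trans)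
  then show "C \<oplus>\<^bsub>sec PT U\<^esub> D \<in> carrier (sec PT U)"
    by (simp add: c PT_add[OF U(1)] PT_carrier[OF U(1)])
  show "class_val (C \<oplus>\<^bsub>sec PT U\<^esub> D) = class_val C + class_val D"
    by (simp add: c PT_add[OF U(1)] class_val[OF U])
qed

lemma PT_smult_closed:
  assumes U: "zopen U" "x \<in> U" and a: "\<And>p. p \<in> U \<Longrightarrow> reg 0 p a" and C: "C \<in> carrier (sec PT U)"
  shows "cst U a \<odot>\<^bsub>sec PT U\<^esub> C \<in> carrier (sec PT U)" "class_val (cst U a \<odot>\<^bsub>sec PT U\<^esub> C) = a * class_val C"
proof -
  interpret closed_modules "OX U" "MI U" "NB U" by (rule closed[OF U(1)])
  obtain c where c: "C = cls U c" "Poly_Mapping.keys c \<subseteq> pairs U"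
    using C by (auto simp: PT_carrier[OF U(1)])
  define f where "f = (\<lambda>(m, n :: fn). (cst U a \<odot>\<^bsub>MI U\<^esub> m, n))"
  have aU: "cst U a \<in> carrier (OX U)" using cst_twist[OF U(1) a] by simp
  have "frag_map f g \<in> rels U" if "g \<in> tensor_generators (OX U) (MI U) (NB U)" for g
    using U(1) that
  proof (cases rule: generator_cases)
    case (left r s t)
    show ?thesis using rels_left[OF U(1) I_mult[OF U(1) left(2) a] I_mult[OF U(1) left(3) a] left(4)]
      by (simp add: left(1) frag_map_diff f_def distrib_left)
  next
    case (right r s t)
    show ?thesis using rels_right[OF U(1) I_mult[OF U(1) right(2) a] right(3,4)]
      by (simp add: right(1) frag_map_diff f_def)
  next
    case (balance r s t)
    show ?thesis using rels_balance[OF U(1) balance(2) I_mult[OF U(1) balance(3) a] balance(4)]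
      by (simp add: balance(1) frag_map_diff f_def mult.left_commute)
  qed
  from tensor_lift_class[OF closed[OF U(1)] closed[OF U(1)] this]
  have eq: "cst U a \<odot>\<^bsub>sec PT U\<^esub> C = cls U (frag_map f c)"
    by (simp add: tensor_presheaf_def tensor_module_def c f_def)
  have "f ` Poly_Mapping.keys c \<subseteq> pairs U"
  proof safe
    fix m n m' n' assume "(m', n') \<in> Poly_Mapping.keys c" "(m, n) = f (m', n')"
    moreover have "m' \<in> I U" "n' \<in> twist_sections b U" using calculation c(2) by auto
    ultimately show "m \<in> I U" "n \<in> twist_sections b U" using M_smult[OF aU] by (auto simp: f_def)
  qed
  with keys_frag_map[of f c] have "Poly_Mapping.keys (frag_map f c) \<subseteq> pairs U" by (rule order_trans)
  then show "cst U a \<odot>\<^bsub>sec PT U\<^esub> C \<in> carrier (sec PT U)"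
    unfolding eq by (simp add: PT_carrier[OF U(1)])
  have "gpt \<in> U" using gpt_in_open U by blast
  have "val (frag_map f c) = frag_eval (\<lambda>k. a * (fst k gpt * snd k gpt)) c"
    unfolding val_def frag_eval_map
  proof (rule frag_eval_cong)
    fix k assume "k \<in> Poly_Mapping.keys c"
    then obtain r where "fst k = cst U r" using c(2) I_cst[OF U(1)] by fastforce
    then show "fst (f k) gpt * snd (f k) gpt = a * (fst k gpt * snd k gpt)"
      using \<open>gpt \<in> U\<close> by (cases k) (auto simp: f_def mult.assoc)
  qed
  then show "class_val (cst U a \<odot>\<^bsub>sec PT U\<^esub> C) = a * class_val C"
    unfolding eq class_val[OF U] by (simp add: c(1) class_val[OF U] val_def frag_eval_scale)
qed

abbreviation "TS \<equiv> twisted_ideal_sheaf I b"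

lemma TS_simps [simp]:
  "\<zero>\<^bsub>sec TS U\<^esub> = (\<lambda>x\<in>U. germ PT x U \<zero>\<^bsub>sec PT U\<^esub>)"
  "\<sigma> \<oplus>\<^bsub>sec TS U\<^esub> \<tau> = (\<lambda>x\<in>U. germ_add PT x (\<sigma> x) (\<tau> x))"
  "r \<odot>\<^bsub>sec TS U\<^esub> \<sigma> = (\<lambda>x\<in>U. germ_smult PT x U r (\<sigma> x))"
  "res TS U V = (\<lambda>\<sigma>. restrict \<sigma> V)"
  by (simp_all add: twisted_ideal_sheaf_def tensor_sheaf_def sheafification_def)

lemma TS_carrier: "\<sigma> \<in> carrier (sec TS U) \<longleftrightarrow> \<sigma> \<in> extensional U \<and> (\<forall>x\<in>U. \<exists>V. zopen V \<and> x \<in> V \<and> V \<subseteq> U \<and>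
         (\<exists>s\<in>carrier (sec PT V). \<forall>y\<in>V. \<sigma> y = germ PT y V s))"
  by (simp add: twisted_ideal_sheaf_def tensor_sheaf_def sheafification_def)

lemma TS_E:
  assumes "\<sigma> \<in> carrier (sec TS U)" "x \<in> U"
  obtains V s where "zopen V" "x \<in> V" "V \<subseteq> U" "s \<in> carrier (sec PT V)" "\<And>y. y \<in> V \<Longrightarrow> \<sigma> y = germ PT y V s"
proof -
  from bspec[OF conjunct2[OF assms(1)[unfolded TS_carrier]] assms(2)]
  obtain V s where V: "zopen V" "x \<in> V" "V \<subseteq> U" "s \<in> carrier (sec PT V)" "\<forall>y\<in>V. \<sigma> y = germ PT y V s"
    by (elim exE conjE bexE)
  show thesis by (rule that[OF V(1-4)]) (rule bspec[OF V(5)])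
qed

definition ts_val :: "pt set \<Rightarrow> (pt \<Rightarrow> (pt set \<times> (fn \<times> fn \<Rightarrow>\<^sub>0 int) set) set) \<Rightarrow> fn" where
  "ts_val U \<sigma> = (\<lambda>x\<in>U. germ_val (\<sigma> x))"

text \<open>The sections of I_Z(b) regarded as a subsheaf of O(b). A single product replaces a sum
  of products, because O(b) is locally generated by one element.\<close>

definition local_product :: "pt set \<Rightarrow> rat_fun \<Rightarrow> bool" where
  "local_product U r \<longleftrightarrow> (\<forall>x\<in>U. \<exists>V m e. zopen V \<and> x \<in> V \<and> V \<subseteq> U \<and> cst V m \<in> I V \<and>
     (\<forall>p\<in>V. reg b p e) \<and> r = m * e)"

lemma ts_val_cst:
  assumes \<sigma>: "\<sigma> \<in> carrier (sec TS U)"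
  shows "ts_val U \<sigma> = cst U (germ_val (\<sigma> gpt))" "local_product U (germ_val (\<sigma> gpt))"
proof -
  have *: "germ_val (\<sigma> x) = germ_val (\<sigma> gpt) \<and>
    (\<exists>V m e. zopen V \<and> x \<in> V \<and> V \<subseteq> U \<and> cst V m \<in> I V \<and> (\<forall>p\<in>V. reg b p e) \<and> germ_val (\<sigma> gpt) = m * e)"
    if x: "x \<in> U" for x
  proof -
    obtain V s where V: "zopen V" "x \<in> V" "V \<subseteq> U" "s \<in> carrier (sec PT V)"
      "\<And>y. y \<in> V \<Longrightarrow> \<sigma> y = germ PT y V s" using TS_E[OF \<sigma> x] by metis
    have g: "gpt \<in> V" using gpt_in_open V by blast
    \<comment> \<open>The class \<open>s\<close> represents \<sigma> on all of \<open>V\<close>, and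
      so at the generic point too; this makes the values of \<sigma> constant.\<close>
    have v: "germ_val (\<sigma> x) = class_val s" "germ_val (\<sigma> gpt) = class_val s" using V g germ_val by auto
    have "x \<in> P1" using V openin_sub by blast
    then obtain l where l: "l \<in> form 1" "l \<noteq> 0" "x \<in> basic l" using chartE by metis
    define W where "W = V \<inter> basic l"
    have W: "zopen W" "x \<in> W" "W \<subseteq> V" "W \<subseteq> basic l" using V l basic_openin by (auto simp: W_def)
    obtain m where m: "cst W m \<in> I W" "class_val (res PT V W s) = m * lpow l b"
      using normal_class[OF W(1,4) l(1,2) W(2) PT_res_closed[OF V(1) W(1,3) V(4)]] by blast
    have "\<forall>p\<in>W. reg b p (lpow l b)" using W(4) l(1) reg_lpow by (auto simp: basic_def)
    moreover have "class_val s = m * lpow l b" using m(2) class_val_res[OF V(1) W(1,3,2) V(4)] by simp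
    ultimately show ?thesis using v W m(1) V(3) by (metis order_trans)
  qed
  show "ts_val U \<sigma> = cst U (germ_val (\<sigma> gpt))" using * by (auto simp: ts_val_def cst_def)
  show "local_product U (germ_val (\<sigma> gpt))" using * unfolding local_product_def by blast
qed

lemma ts_val_inject:
  assumes \<sigma>: "\<sigma> \<in> carrier (sec TS U)" and \<tau>: "\<tau> \<in> carrier (sec TS U)" and eq: "ts_val U \<sigma> = ts_val U \<tau>"
  shows "\<sigma> = \<tau>"
proof
  fix x show "\<sigma> x = \<tau> x"
  proof (cases "x \<in> U")
    case True
    obtain V s where V: "zopen V" "x \<in> V" "s \<in> carrier (sec PT V)" "\<sigma> x = germ PT x V s"
      using TS_E[OF \<sigma> True] by metis
    obtain W t where W: "zopen W" "x \<in> W" "t \<in> carrier (sec PT W)" "\<tau> x = germ PT x W t"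
      using TS_E[OF \<tau> True] by metis
    have "germ_val (\<sigma> x) = germ_val (\<tau> x)" using fun_cong[OF eq, of x] True by (simp add: ts_val_def)
    then have "class_val s = class_val t" using germ_val V W by simp
    then show ?thesis using germ_eqI[OF V(1-3) W(1-3)] V(4) W(4) by simp
  next
    case False
    then show ?thesis using \<sigma> \<tau> by (auto simp: TS_carrier extensional_def)
  qed
qed

text \<open>Near each point the tensor of m and e has the value r. Since values determine germs, the
  local tensors have equal germs wherever they overlap, and so they define one section of the
  sheafification.\<close>

lemma ts_val_surj:
  assumes r: "local_product U r"
  shows "\<exists>\<sigma>\<in>carrier (sec TS U). ts_val U \<sigma> = cst U r"
proof -
  have "\<forall>x. \<exists>V m e. x \<in> U \<longrightarrow> zopen V \<and> x \<in> V \<and> V \<subseteq> U \<and> cst V m \<in> I V \<and> (\<forall>p\<in>V. reg b p e) \<and> r = m * e"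
    using r unfolding local_product_def by blast
  then obtain V m e where *: "\<forall>x. x \<in> U \<longrightarrow> zopen (V x) \<and> x \<in> V x \<and> V x \<subseteq> U \<and>
      cst (V x) (m x) \<in> I (V x) \<and> (\<forall>p\<in>V x. reg b p (e x)) \<and> r = m x * e x"
    unfolding choice_iff by (elim exE)
  have V: "\<And>x. x \<in> U \<Longrightarrow> zopen (V x)" "\<And>x. x \<in> U \<Longrightarrow> x \<in> V x"
    "\<And>x. x \<in> U \<Longrightarrow> V x \<subseteq> U" "\<And>x. x \<in> U \<Longrightarrow> cst (V x) (m x) \<in> I (V x)"
    "\<And>x. x \<in> U \<Longrightarrow> \<forall>p\<in>V x. reg b p (e x)" "\<And>x. x \<in> U \<Longrightarrow> r = m x * e x"
    using * by simp_all
  define C where "C x = cls (V x) (frag_of (cst (V x) (m x), cst (V x) (e x)))" for x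
  have C: "C x \<in> carrier (sec PT (V x))" if "x \<in> U" for x
    using V[OF that] cst_twist[of "V x" b "e x"] by (auto simp: C_def PT_carrier keys_frag_of)
  have v: "class_val (C x) = r" if x: "x \<in> U" for x
  proof -
    have "gpt \<in> V x" using gpt_in_open V x by blast
    then show ?thesis using class_val[OF V(1,2), OF x x] V(6)[OF x] by (simp add: C_def)
  qed
  define \<sigma> where "\<sigma> = (\<lambda>x\<in>U. germ PT x (V x) (C x))"
  have "\<sigma> \<in> carrier (sec TS U)" unfolding TS_carrier
  proof safe
    show "\<sigma> \<in> extensional U" by (simp add: \<sigma>_def)
    fix x assume x: "x \<in> U"
    have "\<sigma> y = germ PT y (V x) (C x)" if y: "y \<in> V x" for y
    proof -
      have yU: "y \<in> U" using V(3)[OF x] y by blast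
      show ?thesis using germ_eqI[OF V(1,2)[OF yU] C[OF yU] V(1)[OF x] y C[OF x]] v x yU
        by (simp add: \<sigma>_def)
    qed
    then show "\<exists>V. zopen V \<and> x \<in> V \<and> V \<subseteq> U \<and> (\<exists>s\<in>carrier (sec PT V). \<forall>y\<in>V. \<sigma> y = germ PT y V s)"
      using V(1-3)[OF x] C[OF x] by blast
  qed
  moreover have "ts_val U \<sigma> = cst U r"
    using germ_val[OF V(1,2) C] v by (auto simp: ts_val_def \<sigma>_def cst_def)
  ultimately show ?thesis by blast
qed

lemma zero_TS:
  assumes "zopen U"
  shows "\<zero>\<^bsub>sec TS U\<^esub> \<in> carrier (sec TS U)" "ts_val U \<zero>\<^bsub>sec TS U\<^esub> = cst U 0"
proof -
  have z: "\<zero>\<^bsub>sec PT U\<^esub> \<in> carrier (sec PT U)"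
    using assms by (auto simp: PT_zero PT_carrier)
  have v: "class_val \<zero>\<^bsub>sec PT U\<^esub> = 0" if "x \<in> U" for x using class_val[OF assms that] by (simp add: PT_zero assms)
  show "ts_val U \<zero>\<^bsub>sec TS U\<^esub> = cst U 0"
    using germ_val[OF assms _ z] v by (auto simp: ts_val_def cst_def)
  show "\<zero>\<^bsub>sec TS U\<^esub> \<in> carrier (sec TS U)"
    unfolding TS_carrier using assms z by (auto intro!: exI[of _ U] bexI[of _ "\<zero>\<^bsub>sec PT U\<^esub>"])
qed

text \<open>The union in \<open>germ_add\<close> runs over all representatives. A germ depends only
  on its value, which here is the sum of the two given values, so all members of the union are the
  same germ \<open>G\<close>.\<close>

lemma ts_val_add:
  assumes \<sigma>: "\<sigma> \<in> carrier (sec TS U)" and \<tau>: "\<tau> \<in> carrier (sec TS U)" and x: "x \<in> U"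
  shows "germ_val (germ_add PT x (\<sigma> x) (\<tau> x)) = germ_val (\<sigma> x) + germ_val (\<tau> x)"
proof -
  obtain V s where V: "zopen V" "x \<in> V" "s \<in> carrier (sec PT V)" "\<sigma> x = germ PT x V s"
    using TS_E[OF \<sigma> x] by metis
  obtain W t where W: "zopen W" "x \<in> W" "t \<in> carrier (sec PT W)" "\<tau> x = germ PT x W t"
    using TS_E[OF \<tau> x] by metis
  define S where "S V s W t = res PT V (V \<inter> W) s \<oplus>\<^bsub>sec PT (V \<inter> W)\<^esub> res PT W (V \<inter> W) t" for V s W t
  have S: "S V s W t \<in> carrier (sec PT (V \<inter> W)) \<and> class_val (S V s W t) = class_val s + class_val t"
    if "zopen V" "x \<in> V" "s \<in> carrier (sec PT V)" "zopen W" "x \<in> W" "t \<in> carrier (sec PT W)" for V s W t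
  proof -
    have o: "zopen (V \<inter> W)" "x \<in> V \<inter> W" using that by auto
    show ?thesis unfolding S_def
      using PT_add_closed[OF o PT_res_closed[OF that(1) o(1) _ that(3)] PT_res_closed[OF that(4) o(1) _ that(6)]]
        class_val_res[OF that(1) o(1) _ o(2) that(3)] class_val_res[OF that(4) o(1) _ o(2) that(6)] by auto
  qed
  define G where "G = germ PT x (V \<inter> W) (S V s W t)"
  have "germ PT x (V' \<inter> W') (S V' s' W' t') = G" if "(V', s') \<in> germ PT x V s" "(W', t') \<in> germ PT x W t" for V' s' W' t'
    unfolding G_def
    using germ_memD[OF V(1-3) that(1)] germ_memD[OF W(1-3) that(2)] V W S[of V s W t] S[of V' s' W' t']
    by (intro germ_eqI) auto
  then have "germ_add PT x (\<sigma> x) (\<tau> x) = (\<Union>(V', s')\<in>germ PT x V s. \<Union>(W', t')\<in>germ PT x W t. G)"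
    unfolding germ_add_def V(4) W(4) S_def by (intro SUP_cong refl) auto
  also have "\<dots> = G" using germ_self[OF V(1-3)] germ_self[OF W(1-3)] by auto
  also have "germ_val G = class_val s + class_val t"
    unfolding G_def using germ_val[of "V \<inter> W" x "S V s W t"] S[of V s W t] V W by auto
  finally show ?thesis using germ_val V W by simp
qed

lemma ts_val_smult:
  assumes U: "zopen U" and \<sigma>: "\<sigma> \<in> carrier (sec TS U)" and a: "\<And>p. p \<in> U \<Longrightarrow> reg 0 p a" and x: "x \<in> U"
  shows "germ_val (germ_smult PT x U (cst U a) (\<sigma> x)) = a * germ_val (\<sigma> x)"
proof -
  obtain V s where V: "zopen V" "x \<in> V" "s \<in> carrier (sec PT V)" "\<sigma> x = germ PT x V s"
    using TS_E[OF \<sigma> x] by metis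
  define S where "S V s = restrict (cst U a) (U \<inter> V) \<odot>\<^bsub>sec PT (U \<inter> V)\<^esub> res PT V (U \<inter> V) s" for V s
  have S: "S V s \<in> carrier (sec PT (U \<inter> V)) \<and> class_val (S V s) = a * class_val s"
    if "zopen V" "x \<in> V" "s \<in> carrier (sec PT V)" for V s
  proof -
    have o: "zopen (U \<inter> V)" "x \<in> U \<inter> V" using that U x by auto
    have c: "restrict (cst U a) (U \<inter> V) = cst (U \<inter> V) a" by simp
    show ?thesis unfolding S_def c
      using PT_smult_closed[OF o a PT_res_closed[OF that(1) o(1) _ that(3)]]
        class_val_res[OF that(1) o(1) _ o(2) that(3)] by auto
  qed
  define G where "G = germ PT x (U \<inter> V) (S V s)"
  have "germ PT x (U \<inter> V') (S V' s') = G" if "(V', s') \<in> germ PT x V s" for V' s'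
    unfolding G_def
    using germ_memD[OF V(1-3) that(1)] V S[of V s] S[of V' s'] U x
    by (intro germ_eqI) auto
  then have "germ_smult PT x U (cst U a) (\<sigma> x) = (\<Union>(V', s')\<in>germ PT x V s. G)"
    unfolding germ_smult_def V(4) S_def by (intro SUP_cong refl) auto
  also have "\<dots> = G" using germ_self[OF V(1-3)] by auto
  also have "germ_val G = a * class_val s"
    unfolding G_def using germ_val[of "U \<inter> V" x "S V s"] S[of V s] V U x by auto
  finally show ?thesis using germ_val V by simp
qed

lemma local_product_reg: "local_product U r \<Longrightarrow> p \<in> U \<Longrightarrow> reg b p r"
proof -
  assume r: "local_product U r" "p \<in> U"
  from bspec[OF r(1)[unfolded local_product_def] r(2)]
  obtain V m e where *: "zopen V" "p \<in> V" "cst V m \<in> I V" "\<forall>p\<in>V. reg b p e" "r = m * e"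
    by (elim exE conjE)
  then have V: "zopen V" "p \<in> V" "cst V m \<in> I V" "reg b p e" "r = m * e" by auto
  have "reg 0 p m" using I_sub[OF V(1,3)] V(2) by (simp add: cst_twist_iff[OF V(1)])
  then show ?thesis unfolding V(5) using openin_sub[OF V(1)] V(2,4) by (intro reg_mult'[of _ 0 _ b]) auto
qed

text \<open>The exact sequence seen inside O(b): the tensor sheaf is replaced by its image, the
  local products, so that both maps run between E and line bundles.\<close>

definition presents_extension where
  "presents_extension a E \<phi> \<psi> \<longleftrightarrow> morphism_on P1 (twist a) E \<phi> \<and> morphism_on P1 E (twist b) \<psi> \<and>
    (\<forall>U. zopen U \<longrightarrow> kernel_sections (twist a) E \<phi> U = {cst U 0} \<and>
      image_sections (twist a) E \<phi> U = kernel_sections E (twist b) \<psi> U \<and>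
      (\<forall>s\<in>carrier (sec E U). \<exists>r. \<psi> U s = cst U r \<and> local_product U r) \<and>
      (\<forall>r x. local_product U r \<and> x \<in> U \<longrightarrow>
        (\<exists>V s. zopen V \<and> x \<in> V \<and> V \<subseteq> U \<and> s \<in> carrier (sec E V) \<and> \<psi> V s = cst V r)))"

text \<open>The second map is followed by \<open>ts_val\<close>. Injectivity of
  \<open>ts_val\<close> preserves the kernel, and since its image consists of the local products,
  surjectivity onto the tensor sheaf becomes local liftability of these.\<close>

lemma exact_sequence_values:
  assumes "short_exact_sequence (twist a) E TS"
  shows "\<exists>\<phi> \<psi>. presents_extension a E \<phi> \<psi>"
proof -
  obtain \<phi> \<psi> where \<phi>: "morphism_on P1 (twist a) E \<phi>" and \<psi>: "morphism_on P1 E TS \<psi>"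
    and ex: "\<And>U. zopen U \<Longrightarrow> kernel_sections (twist a) E \<phi> U = {cst U 0}"
      "\<And>U. zopen U \<Longrightarrow> image_sections (twist a) E \<phi> U = kernel_sections E TS \<psi> U"
      "\<And>U. zopen U \<Longrightarrow> image_sections E TS \<psi> U = carrier (sec TS U)"
    using assms unfolding short_exact_sequence_def by auto
  have \<psi>1: "\<psi> U s \<in> carrier (sec TS U)" if "zopen U" "s \<in> carrier (sec E U)" for U s
    by (rule morphism_closed[OF \<psi> that(1) openin_sub[OF that(1)] that(2)])
  define \<mu> where "\<mu> U s = ts_val U (\<psi> U s)" for U s
  have \<mu>: "\<exists>r. \<mu> U s = cst U r \<and> local_product U r" if "zopen U" "s \<in> carrier (sec E U)" for U s
    using ts_val_cst[OF \<psi>1[OF that]] by (auto simp: \<mu>_def)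
  have "morphism_on P1 E (twist b) \<mu>"
  proof (rule morphism_onI)
    fix U s assume U: "zopen U" "U \<subseteq> P1" and s: "s \<in> carrier (sec E U)"
    note s' = \<psi>1[OF U(1) s]
    obtain q where "\<mu> U s = cst U q" "local_product U q" using \<mu>[OF U(1) s] by blast
    then show "\<mu> U s \<in> carrier (sec (twist b) U)" using local_product_reg cst_twist[OF U(1)] by auto
    show "\<mu> U (s \<oplus>\<^bsub>sec E U\<^esub> t) = \<mu> U s \<oplus>\<^bsub>sec (twist b) U\<^esub> \<mu> U t" if t: "t \<in> carrier (sec E U)" for t
    proof -
      have "\<mu> U (s \<oplus>\<^bsub>sec E U\<^esub> t) = (\<lambda>x\<in>U. germ_val (\<psi> U s x) + germ_val (\<psi> U t x))"
        unfolding \<mu>_def morphism_add[OF \<psi> U s t] using ts_val_add[OF s' \<psi>1[OF U(1) t]]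
        by (auto simp: ts_val_def)
      then show ?thesis by (simp add: \<mu>_def twist_def ts_val_def cong: restrict_cong)
    qed
    show "\<mu> U (r \<odot>\<^bsub>sec E U\<^esub> s) = r \<odot>\<^bsub>sec (twist b) U\<^esub> \<mu> U s" if r: "r \<in> carrier (OX U)" for r
    proof -
      obtain c where c: "r = cst U c" "\<And>p. p \<in> U \<Longrightarrow> reg 0 p c"
        by (rule twist_sectionE[OF U(1), of r 0]) (use r in auto)
      have "\<mu> U (r \<odot>\<^bsub>sec E U\<^esub> s) = (\<lambda>x\<in>U. c * germ_val (\<psi> U s x))"
        unfolding \<mu>_def morphism_smult[OF \<psi> U s r] using ts_val_smult[OF U(1) s' c(2)]
        by (auto simp: ts_val_def c(1))
      then show ?thesis by (simp add: \<mu>_def twist_def ts_val_def c(1) cong: restrict_cong)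
    qed
    show "\<mu> V (res E U V s) = res (twist b) U V (\<mu> U s)" if V: "zopen V" "V \<subseteq> U" for V
      using V(2) unfolding \<mu>_def morphism_res[OF \<psi> U(1) V U(2) s]
      by (auto simp: ts_val_def restrict_def fun_eq_iff)
  qed
  moreover have "kernel_sections E (twist b) \<mu> U = kernel_sections E TS \<psi> U" if U: "zopen U" for U
  proof -
    have "\<mu> U s = cst U 0 \<longleftrightarrow> \<psi> U s = \<zero>\<^bsub>sec TS U\<^esub>" if "s \<in> carrier (sec E U)" for s
      unfolding \<mu>_def zero_TS(2)[OF U, symmetric]
      by (rule iffI) (erule ts_val_inject[OF \<psi>1[OF U that] zero_TS(1)[OF U]], erule arg_cong)
    then show ?thesis unfolding kernel_sections_def twist_simps(2) by (intro Collect_cong conj_cong refl) simp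
  qed
  moreover have "\<exists>V s. zopen V \<and> x \<in> V \<and> V \<subseteq> U \<and> s \<in> carrier (sec E V) \<and> \<mu> V s = cst V r"
    if U: "zopen U" and r: "local_product U r" "x \<in> U" for U r x
  proof -
    obtain \<sigma> where \<sigma>: "\<sigma> \<in> carrier (sec TS U)" "ts_val U \<sigma> = cst U r" using ts_val_surj r by blast
    then have "\<sigma> \<in> image_sections E TS \<psi> U" using ex(3)[OF U] by blast
    then have "\<forall>x\<in>U. \<exists>V. zopen V \<and> x \<in> V \<and> V \<subseteq> U \<and> restrict \<sigma> V \<in> \<psi> V ` carrier (sec E V)"
      unfolding image_sections_def TS_simps by simp
    from bspec[OF this r(2)]
    obtain V s where V: "zopen V" "x \<in> V" "V \<subseteq> U" "s \<in> carrier (sec E V)" "restrict \<sigma> V = \<psi> V s"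
      by (elim exE conjE imageE)
    have "\<mu> V s = restrict (ts_val U \<sigma>) V"
      using V(3) by (auto simp: \<mu>_def V(5)[symmetric] ts_val_def restrict_def fun_eq_iff)
    then show ?thesis using V \<sigma>(2) by auto
  qed
  ultimately show ?thesis unfolding presents_extension_def
    by (intro exI[of _ \<phi>] exI[of _ \<mu>] conjI allI impI ballI \<phi> \<mu>) (simp_all add: ex)
qed

end


section \<open>Morphisms between twists\<close>

lemma morphism_comp:
  assumes "morphism_on W F G \<phi>" "morphism_on W G H \<psi>"
  shows "morphism_on W F H (\<lambda>U s. \<psi> U (\<phi> U s))"
  by (rule morphism_onI)
    (simp_all add: morphism_closed[OF assms(1)] morphism_closed[OF assms(2)] morphism_add[OF assms(1)]
      morphism_add[OF assms(2)] morphism_smult[OF assms(1)] morphism_smult[OF assms(2)]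
      morphism_res[OF assms(1)] morphism_res[OF assms(2)] subset_trans del: OX_simps)

lemma direct_sum_simps [simp]:
  "carrier (sec (direct_sum F G) U) = carrier (sec F U) \<times> carrier (sec G U)"
  "\<zero>\<^bsub>sec (direct_sum F G) U\<^esub> = (\<zero>\<^bsub>sec F U\<^esub>, \<zero>\<^bsub>sec G U\<^esub>)"
  "(s, t) \<oplus>\<^bsub>sec (direct_sum F G) U\<^esub> (s', t') = (s \<oplus>\<^bsub>sec F U\<^esub> s', t \<oplus>\<^bsub>sec G U\<^esub> t')"
  "r \<odot>\<^bsub>sec (direct_sum F G) U\<^esub> (s, t) = (r \<odot>\<^bsub>sec F U\<^esub> s, r \<odot>\<^bsub>sec G U\<^esub> t)"
  "res (direct_sum F G) U V = map_prod (res F U V) (res G U V)"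
  by (simp_all add: direct_sum_def)

lemma morphism_fst: "morphism_on W (direct_sum F G) F (\<lambda>U. fst)"
  and morphism_snd: "morphism_on W (direct_sum F G) G (\<lambda>U. snd)"
  by (rule morphism_onI; auto)+

text \<open>The closure properties required for inverting a bijective morphism. Isolating them lets
  E and the sums of twists share one argument.\<close>

definition closed_presheaf :: "'m omod \<Rightarrow> bool" where
  "closed_presheaf F \<longleftrightarrow> (\<forall>U s. zopen U \<and> s \<in> carrier (sec F U) \<longrightarrow>
     (\<forall>t\<in>carrier (sec F U). s \<oplus>\<^bsub>sec F U\<^esub> t \<in> carrier (sec F U)) \<and>
     (\<forall>r\<in>carrier (OX U). r \<odot>\<^bsub>sec F U\<^esub> s \<in> carrier (sec F U)) \<and>
     (\<forall>V. zopen V \<and> V \<subseteq> U \<longrightarrow> res F U V s \<in> carrier (sec F V)))"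

lemma closed_presheaf: assumes F: "presheaf_of_modules F" shows "closed_presheaf F"
  unfolding closed_presheaf_def
proof (intro allI impI; elim conjE)
  fix U s assume U: "zopen U" and s: "s \<in> carrier (sec F U)"
  interpret Module.module "OX U" "sec F U" using F U by (simp add: presheaf_of_modules_def)
  show "(\<forall>t\<in>carrier (sec F U). s \<oplus>\<^bsub>sec F U\<^esub> t \<in> carrier (sec F U)) \<and>
     (\<forall>r\<in>carrier (OX U). r \<odot>\<^bsub>sec F U\<^esub> s \<in> carrier (sec F U)) \<and>
     (\<forall>V. zopen V \<and> V \<subseteq> U \<longrightarrow> res F U V s \<in> carrier (sec F V))"
    using F U s smult_closed by (simp add: presheaf_of_modules_def Pi_iff del: OX_simps)
qed

lemma closed_presheaf_twists: "closed_presheaf (direct_sum (twist m) (twist n))"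
  unfolding closed_presheaf_def
proof (intro allI impI; elim conjE)
  fix U :: "pt set" and s assume U: "zopen U" and "s \<in> carrier (sec (direct_sum (twist m) (twist n)) U)"
  then obtain x y where s: "s = (cst U x, cst U y)" "\<And>p. p \<in> U \<Longrightarrow> reg m p x" "\<And>p. p \<in> U \<Longrightarrow> reg n p y"
    by (auto elim!: twist_sectionE[OF U])
  note P = subsetD[OF openin_sub[OF U]]
  show "(\<forall>t\<in>carrier (sec (direct_sum (twist m) (twist n)) U).
      s \<oplus>\<^bsub>sec (direct_sum (twist m) (twist n)) U\<^esub> t \<in> carrier (sec (direct_sum (twist m) (twist n)) U)) \<and>
    (\<forall>r\<in>carrier (OX U). r \<odot>\<^bsub>sec (direct_sum (twist m) (twist n)) U\<^esub> s \<in> carrier (sec (direct_sum (twist m) (twist n)) U)) \<and>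
    (\<forall>V. zopen V \<and> V \<subseteq> U \<longrightarrow> res (direct_sum (twist m) (twist n)) U V s \<in> carrier (sec (direct_sum (twist m) (twist n)) V))"
  proof (intro conjI ballI allI impI; (elim conjE)?)
    fix t assume "t \<in> carrier (sec (direct_sum (twist m) (twist n)) U)"
    then obtain x' y' where t: "t = (cst U x', cst U y')" "\<And>p. p \<in> U \<Longrightarrow> reg m p x'" "\<And>p. p \<in> U \<Longrightarrow> reg n p y'"
      by (auto elim!: twist_sectionE[OF U])
    show "s \<oplus>\<^bsub>sec (direct_sum (twist m) (twist n)) U\<^esub> t \<in> carrier (sec (direct_sum (twist m) (twist n)) U)"
      using s t P by (auto intro!: cst_twist[OF U] reg_add)
  next
    fix r assume "r \<in> carrier (OX U)"
    then obtain k where k: "r = cst U k" "\<And>p. p \<in> U \<Longrightarrow> reg 0 p k" by (auto elim!: twist_sectionE[OF U])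
    show "r \<odot>\<^bsub>sec (direct_sum (twist m) (twist n)) U\<^esub> s \<in> carrier (sec (direct_sum (twist m) (twist n)) U)"
      using s k P by (auto intro!: cst_twist[OF U] reg_mult'[of _ 0])
  next
    fix V assume "zopen V" "V \<subseteq> U"
    then show "res (direct_sum (twist m) (twist n)) U V s \<in> carrier (sec (direct_sum (twist m) (twist n)) V)"
      using s by (auto intro!: cst_twist)
  qed
qed

text \<open>Besides the inverse morphism the cancellation law is exported, by which a section of E
  is recovered from its two components.\<close>

lemma isomorphism_inverse:
  assumes F: "closed_presheaf F" and \<phi>: "morphism_on W F G \<phi>"
    and bij: "\<And>U. zopen U \<Longrightarrow> U \<subseteq> W \<Longrightarrow> bij_betw (\<phi> U) (carrier (sec F U)) (carrier (sec G U))"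
  obtains \<psi> where "morphism_on W G F \<psi>"
    "\<And>U. zopen U \<Longrightarrow> U \<subseteq> W \<Longrightarrow> bij_betw (\<psi> U) (carrier (sec G U)) (carrier (sec F U))"
    "\<And>U s. zopen U \<Longrightarrow> U \<subseteq> W \<Longrightarrow> s \<in> carrier (sec F U) \<Longrightarrow> \<psi> U (\<phi> U s) = s"
proof
  have F_add: "s \<oplus>\<^bsub>sec F U\<^esub> t \<in> carrier (sec F U)"
    if "zopen U" "s \<in> carrier (sec F U)" "t \<in> carrier (sec F U)" for U s t
    using F that by (simp add: closed_presheaf_def)
  have F_smult: "r \<odot>\<^bsub>sec F U\<^esub> s \<in> carrier (sec F U)"
    if "zopen U" "s \<in> carrier (sec F U)" "r \<in> carrier (OX U)" for U s r
    using F that by (simp add: closed_presheaf_def)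
  have F_res: "res F U V s \<in> carrier (sec F V)"
    if "zopen U" "s \<in> carrier (sec F U)" "zopen V" "V \<subseteq> U" for U V s
    using F that by (simp add: closed_presheaf_def)
  define \<psi> where "\<psi> U = inv_into (carrier (sec F U)) (\<phi> U)" for U
  show left: "\<psi> U (\<phi> U s) = s" if "zopen U" "U \<subseteq> W" "s \<in> carrier (sec F U)" for U s
    using bij[OF that(1,2)] that(3) by (simp add: \<psi>_def bij_betw_def)
  have right: "\<phi> U (\<psi> U t) = t" if "zopen U" "U \<subseteq> W" "t \<in> carrier (sec G U)" for U t
    using bij[OF that(1,2)] that(3) by (simp add: \<psi>_def bij_betw_inv_into_right)
  show bij': "bij_betw (\<psi> U) (carrier (sec G U)) (carrier (sec F U))" if "zopen U" "U \<subseteq> W" for U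
    using bij[OF that] unfolding \<psi>_def by (rule bij_betw_inv_into)
  have cl: "\<psi> U t \<in> carrier (sec F U)" if "zopen U" "U \<subseteq> W" "t \<in> carrier (sec G U)" for U t
    using bij'[OF that(1,2)] that(3) by (simp add: bij_betw_apply)
  show "morphism_on W G F \<psi>"
  proof (rule morphism_onI)
    fix U t assume U: "zopen U" "U \<subseteq> W" and t: "t \<in> carrier (sec G U)"
    note ct = cl[OF U t]
    show "\<psi> U t \<in> carrier (sec F U)" by (rule ct)
    show "\<psi> U (t \<oplus>\<^bsub>sec G U\<^esub> t') = \<psi> U t \<oplus>\<^bsub>sec F U\<^esub> \<psi> U t'" if t': "t' \<in> carrier (sec G U)" for t'
    proof -
      have "\<phi> U (\<psi> U t \<oplus>\<^bsub>sec F U\<^esub> \<psi> U t') = t \<oplus>\<^bsub>sec G U\<^esub> t'"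
        by (simp add: morphism_add[OF \<phi> U ct cl[OF U t']] right[OF U] t t')
      then show ?thesis using left[OF U F_add[OF U(1) ct cl[OF U t']]] by simp
    qed
    show "\<psi> U (r \<odot>\<^bsub>sec G U\<^esub> t) = r \<odot>\<^bsub>sec F U\<^esub> \<psi> U t" if r: "r \<in> carrier (OX U)" for r
    proof -
      have "\<phi> U (r \<odot>\<^bsub>sec F U\<^esub> \<psi> U t) = r \<odot>\<^bsub>sec G U\<^esub> t"
        by (simp add: morphism_smult[OF \<phi> U ct r] right[OF U] t)
      then show ?thesis using left[OF U F_smult[OF U(1) ct r]] by simp
    qed
    show "\<psi> V (res G U V t) = res F U V (\<psi> U t)" if V: "zopen V" "V \<subseteq> U" for V
    proof -
      have "\<phi> V (res F U V (\<psi> U t)) = res G U V t"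
        by (simp add: morphism_res[OF \<phi> U(1) V U(2) ct] right[OF U] t)
      moreover have "V \<subseteq> W" using U V by blast
      ultimately show ?thesis using left[OF V(1) _ F_res[OF U(1) ct V]] by simp
    qed
  qed
qed

lemma cst_empty: "cst {} r = cst {} s"
  by (simp add: cst_def fun_eq_iff)

text \<open>On a chart O(m) is free with generator l^m, so linearity makes \<phi> the multiplication
  by the quotient of the image of the generator by the generator.\<close>

lemma morphism_twist:
  assumes \<phi>: "morphism_on P1 (twist m) (twist n) \<phi>"
  obtains \<kappa> where "\<And>p. p \<in> P1 \<Longrightarrow> reg (n - m) p \<kappa>"
    "\<And>U r. zopen U \<Longrightarrow> (\<And>p. p \<in> U \<Longrightarrow> reg m p r) \<Longrightarrow> \<phi> U (cst U r) = cst U (\<kappa> * r)"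
proof -
  have on_chart: "\<exists>\<kappa>. (\<forall>p\<in>basic l. reg (n - m) p \<kappa>) \<and>
      (\<forall>U x r. zopen U \<longrightarrow> x \<in> U \<longrightarrow> (\<forall>p\<in>U. reg m p r) \<longrightarrow> \<phi> U (cst U r) = cst U (\<kappa> * r))"
    if l: "l \<in> form 1" "l \<noteq> 0" for l
  proof -
    have B: "zopen (basic l)" using basic_openin l by blast
    have L: "reg m p (lpow l m)" "p \<in> P1" if "p \<in> basic l" for p
      using that reg_lpow l by (auto simp: basic_def)
    have gB: "gpt \<in> basic l" using gpt_P1 l(2) by (simp add: basic_def gpt_def)
    have Lc: "cst (basic l) (lpow l m) \<in> carrier (sec (twist m) (basic l))"
      using cst_twist[OF B L(1)] by simp
    then have "\<phi> (basic l) (cst (basic l) (lpow l m)) \<in> twist_sections n (basic l)"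
      using morphism_closed[OF \<phi> B openin_sub[OF B]] by simp
    then obtain k where k: "\<phi> (basic l) (cst (basic l) (lpow l m)) = cst (basic l) k"
      "\<And>p. p \<in> basic l \<Longrightarrow> reg n p k" using twist_sectionE[OF B] by metis
    define \<kappa> where "\<kappa> = k / lpow l m"
    have "reg (n - m) p \<kappa>" if "p \<in> basic l" for p
      unfolding \<kappa>_def using that k(2)[OF that] l(1) by (intro reg_div_lpow) (auto simp: basic_def)
    moreover have "\<phi> U (cst U r) = cst U (\<kappa> * r)"
      if U: "zopen U" "x \<in> U" and r: "\<forall>p\<in>U. reg m p r" for U x r
    proof -
      have rc: "cst U r \<in> carrier (sec (twist m) U)" using cst_twist[OF U(1), of m r] r by simp
      then have "\<phi> U (cst U r) \<in> twist_sections n U"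
        using morphism_closed[OF \<phi> U(1) openin_sub[OF U(1)]] by simp
      then obtain s where s: "\<phi> U (cst U r) = cst U s" using twist_sectionE[OF U(1)] by metis
      \<comment> \<open>The open set \<open>U\<close> need not lie in the chart, but a section over
        \<open>U\<close> is a constant and is determined by its restriction to
        \<open>W\<close>.\<close>
      define W where "W = U \<inter> basic l"
      have W: "zopen W" "W \<subseteq> U" "W \<subseteq> basic l" "gpt \<in> W"
        using U B gpt_in_open gB by (auto simp: W_def)
      have c: "cst W (r / lpow l m) \<in> carrier (OX W)"
        using W(2,3) r l by (auto simp: basic_def intro!: cst_twist[OF W(1)] reg_div_lpow[where n = m])
      have "cst W s = \<phi> W (cst W r)"
        using morphism_res[OF \<phi> U(1) W(1,2) openin_sub[OF U(1)] rc] W(2) by (simp add: s)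
      also have "cst W r = cst W (r / lpow l m) \<odot>\<^bsub>sec (twist m) W\<^esub> cst W (lpow l m)"
        using lpow_nz[OF l(2)] by simp
      also have "\<phi> W \<dots> = cst W (r / lpow l m) \<odot>\<^bsub>sec (twist n) W\<^esub> \<phi> W (cst W (lpow l m))"
        using W L by (intro morphism_smult[OF \<phi> W(1) openin_sub[OF W(1)] _ c]) (auto intro!: cst_twist)
      also have "\<phi> W (cst W (lpow l m)) = cst W k"
        using morphism_res[OF \<phi> B W(1,3) openin_sub[OF B] Lc] W(3) by (simp add: k)
      finally have "cst W s = cst W (\<kappa> * r)" by (simp add: \<kappa>_def mult.commute)
      then show ?thesis using cst_inject[OF W(4)] s by simp
    qed
    ultimately show ?thesis by blast
  qed
  obtain \<kappa> where x: "\<forall>p\<in>basic xv. reg (n - m) p \<kappa>"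
    "\<And>U x r. zopen U \<Longrightarrow> x \<in> U \<Longrightarrow> (\<forall>p\<in>U. reg m p r) \<Longrightarrow> \<phi> U (cst U r) = cst U (\<kappa> * r)"
    using on_chart[OF xv_form xv_nz] by metis
  obtain \<kappa>' where y: "\<forall>p\<in>basic yv. reg (n - m) p \<kappa>'"
    "\<And>U x r. zopen U \<Longrightarrow> x \<in> U \<Longrightarrow> (\<forall>p\<in>U. reg m p r) \<Longrightarrow> \<phi> U (cst U r) = cst U (\<kappa>' * r)"
    using on_chart[OF yv_form yv_nz] by metis
  have B: "zopen (basic xv)" using basic_openin xv_form by blast
  have gB: "gpt \<in> basic xv" using gpt_P1 by (simp add: basic_def gpt_def)
  have L: "\<forall>p\<in>basic xv. reg m p (lpow xv m)" using reg_lpow xv_form by (auto simp: basic_def)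
  \<comment> \<open>The factor found on the chart y \<noteq> 0 applies to the chart x \<noteq> 0 as
    well, because \<open>on_chart\<close> covers all nonempty open sets.\<close>
  have "\<kappa> * lpow xv m = \<kappa>' * lpow xv m" using x(2)[OF B gB L] y(2)[OF B gB L] by (simp only: cst_inject[OF gB])
  then have eq: "\<kappa>' = \<kappa>" using lpow_nz[OF xv_nz, of m] by simp
  show thesis
  proof (rule that)
    show "reg (n - m) p \<kappa>" if "p \<in> P1" for p
      using pt_chart[OF that] x(1) y(1) that by (auto simp: basic_def eq)
    show "\<phi> U (cst U r) = cst U (\<kappa> * r)" if U: "zopen U" "\<And>p. p \<in> U \<Longrightarrow> reg m p r" for U r
    proof (cases "U = {}")
      case True
      have "\<phi> U (cst U r) \<in> twist_sections n U"
        using morphism_closed[OF \<phi> U(1) openin_sub[OF U(1)]] cst_twist[OF U(1), of m r] U(2) by simp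
      then obtain s where "\<phi> U (cst U r) = cst U s" using twist_cst[OF U(1)] by blast
      then show ?thesis unfolding True using cst_empty[of s "\<kappa> * r"] by simp
    next
      case False
      then show ?thesis using x(2)[OF U(1)] U(2) by blast
    qed
  qed
qed

section \<open>Principal stalks\<close>

lemma local_ring_simps [simp]:
  "carrier (local_ring p) = {r. reg 0 p r}" "\<zero>\<^bsub>local_ring p\<^esub> = 0" "\<one>\<^bsub>local_ring p\<^esub> = 1"
  "r \<oplus>\<^bsub>local_ring p\<^esub> s = r + s" "r \<otimes>\<^bsub>local_ring p\<^esub> s = r * s"
  by (auto simp: local_ring_def reg_def)

lemma cring_local_ring: assumes p: "p \<in> P1" shows "cring (local_ring p)"
proof (rule cringI)
  show "abelian_group (local_ring p)"
  proof (rule abelian_groupI)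
    fix r assume "r \<in> carrier (local_ring p)"
    then show "\<exists>s\<in>carrier (local_ring p). s \<oplus>\<^bsub>local_ring p\<^esub> r = \<zero>\<^bsub>local_ring p\<^esub>"
      using reg_uminus[OF p] by (intro bexI[of _ "- r"]) auto
  qed (auto simp: p reg_add[OF p])
  show "Group.comm_monoid (local_ring p)"
    by (rule comm_monoidI) (auto simp: p intro: reg_mult'[OF p])
qed (simp add: distrib_right)

text \<open>Let f = \<alpha> h and g = \<beta> h. Then g \<alpha> = \<beta> f lies in the ideal of
  f, so by regularity \<alpha> = \<gamma> f. Hence f = \<gamma> h f, and cancelling f makes h a
  unit, against properness of J.\<close>

lemma principal_not_regular:
  assumes x: "x \<in> P1" and reg: "regular_sequence (local_ring x) [f, g]" and J: "J = Idl\<^bsub>local_ring x\<^esub> {f, g}"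
    and h: "h \<in> J" "\<And>m. m \<in> J \<Longrightarrow> \<exists>w. reg 0 x w \<and> m = w * h"
  shows False
proof -
  interpret cring "local_ring x" by (rule cring_local_ring[OF x])
  have fg: "{f, g} \<subseteq> carrier (local_ring x)" and ne: "J \<noteq> carrier (local_ring x)"
    and 0: "\<And>h. reg 0 x h \<Longrightarrow> f * h \<in> Idl\<^bsub>local_ring x\<^esub> {} \<Longrightarrow> h \<in> Idl\<^bsub>local_ring x\<^esub> {}"
    and 1: "\<And>h. reg 0 x h \<Longrightarrow> g * h \<in> Idl\<^bsub>local_ring x\<^esub> {f} \<Longrightarrow> h \<in> Idl\<^bsub>local_ring x\<^esub> {f}"
    using reg unfolding regular_sequence_def J by (auto simp: less_Suc_eq all_conj_distrib imp_conjR)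
  have J': "ideal J (local_ring x)" unfolding J using fg by (rule genideal_ideal)
  \<comment> \<open>For i = 0 regularity is taken modulo the ideal generated by nothing: if f = 0,
    then 1 would lie in the zero ideal.\<close>
  have f: "f \<noteq> 0"
  proof
    assume "f = 0"
    moreover have "0 \<in> Idl\<^bsub>local_ring x\<^esub> {}"
      using additive_subgroup.zero_closed[OF ideal.axioms(1)[OF genideal_ideal[of "{}"]]] by simp
    ultimately have "1 \<in> Idl\<^bsub>local_ring x\<^esub> {}" using 0[of 1] x by simp
    moreover have "Idl\<^bsub>local_ring x\<^esub> {} \<subseteq> {0}" using genideal_minimal[OF zeroideal, of "{}"] by simp
    ultimately show False by auto
  qed
  have "f \<in> J" "g \<in> J" unfolding J using genideal_self[OF fg] by auto
  then obtain \<alpha> \<beta> where ab: "reg 0 x \<alpha>" "f = \<alpha> * h" "reg 0 x \<beta>" "g = \<beta> * h" using h(2) by metis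
  have Idl_f: "Idl\<^bsub>local_ring x\<^esub> {f} = {w * f |w. reg 0 x w}"
    using cgenideal_eq_genideal[of f] fg by (simp add: cgenideal_def)
  have "g * \<alpha> = \<beta> * f" by (simp add: ab(2,4))
  then have "\<alpha> \<in> Idl\<^bsub>local_ring x\<^esub> {f}" using 1[OF ab(1)] ab(3) unfolding Idl_f by blast
  then obtain \<gamma> where \<gamma>: "\<alpha> = \<gamma> * f" "reg 0 x \<gamma>" unfolding Idl_f by blast
  have "f * 1 = f * (\<gamma> * h)" using ab(2) \<gamma>(1) by (metis mult.commute mult.left_commute mult_1)
  then have "\<gamma> * h = 1" using f by (metis mult_left_cancel)
  moreover have "\<gamma> * h \<in> J" using ideal.I_l_closed[OF J' h(1), of \<gamma>] \<gamma>(2) by simp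
  ultimately show False using ideal.one_imp_carrier[OF J'] ne by simp
qed

section \<open>Stalks of the ideal of Z for decomposable E\<close>

context twisted_ideal
begin

text \<open>Near \<open>x\<close> the power l^b generates O(b), so multiplying and dividing by it
  passes between the stalk of I and local products.\<close>

lemma local_product_stalk:
  assumes x: "x \<in> P1" and l: "l \<in> form 1" "l \<noteq> 0" "l \<notin> x"
  shows "m \<in> ideal_stalk I x \<Longrightarrow> \<exists>W. zopen W \<and> x \<in> W \<and> local_product W (m * lpow l b)"
    and "zopen U \<Longrightarrow> x \<in> U \<Longrightarrow> local_product U r \<Longrightarrow> r / lpow l b \<in> ideal_stalk I x"
proof -
  have B: "zopen (basic l)" "x \<in> basic l" using basic_openin l x by (auto simp: basic_def)
  have L: "reg c p (lpow l c)" "p \<in> P1" "l \<notin> p" if "p \<in> basic l" for p c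
    using that reg_lpow l(1) by (auto simp: basic_def)
  show "\<exists>W. zopen W \<and> x \<in> W \<and> local_product W (m * lpow l b)" if m: "m \<in> ideal_stalk I x"
  proof -
    from m obtain s V where V: "zopen V" "x \<in> V" "s \<in> I V" "m = s x" by (auto simp: ideal_stalk_def)
    have s: "s = cst V m" using I_cst[OF V(1,3)] V(2,4) by auto
    have W: "zopen (V \<inter> basic l)" "V \<inter> basic l \<subseteq> V" using V B by auto
    have "cst (V \<inter> basic l) m \<in> I (V \<inter> basic l)" using I_restrict[OF V(1) W V(3)] by (simp add: s)
    then have "local_product (V \<inter> basic l) (m * lpow l b)" unfolding local_product_def
      using W L(1) by (intro ballI exI[of _ "V \<inter> basic l"] exI[of _ m] exI[of _ "lpow l b"]) auto
    then show ?thesis using W(1) V(2) B(2) by blast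
  qed
  show "r / lpow l b \<in> ideal_stalk I x" if U: "zopen U" "x \<in> U" "local_product U r"
  proof -
    from bspec[OF U(3)[unfolded local_product_def] U(2)]
    obtain V m e where V: "zopen V" "x \<in> V" "cst V m \<in> I V" "\<forall>p\<in>V. reg b p e" "r = m * e"
      by (elim exE conjE)
    have W: "zopen (V \<inter> basic l)" "V \<inter> basic l \<subseteq> V" using V B by auto
    have r0: "reg 0 p (e / lpow l b)" if "p \<in> V \<inter> basic l" for p
      using that V(4) L l(1) by (intro reg_div_lpow[of p l b]) auto
    have "cst (V \<inter> basic l) m \<in> I (V \<inter> basic l)" using I_restrict[OF V(1) W V(3)] by simp
    then have "cst (V \<inter> basic l) (e / lpow l b * m) \<in> I (V \<inter> basic l)"
      by (rule I_mult[OF W(1)]) (rule r0)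
    moreover have "cst (V \<inter> basic l) (e / lpow l b * m) x = r / lpow l b" using V(2,5) B(2) by simp
    ultimately show ?thesis unfolding ideal_stalk_def using W(1) V(2) B(2) by (metis (mono_tags, lifting) IntI mem_Collect_eq)
  qed
qed

lemma decomposable_principal_stalks:
  assumes ab: "a \<ge> b" and E: "presheaf_of_modules E" and dec: "decomposable E"
    and ses: "short_exact_sequence (twist a) E TS" and x: "x \<in> P1"
  shows "\<exists>h\<in>ideal_stalk I x. \<forall>m\<in>ideal_stalk I x. \<exists>w. reg 0 x w \<and> m = w * h"
proof -
  obtain \<phi> \<psi> where ext: "presents_extension a E \<phi> \<psi>"
    using exact_sequence_values[OF ses] by (elim exE)
  then have \<phi>: "morphism_on P1 (twist a) E \<phi>" and \<psi>: "morphism_on P1 E (twist b) \<psi>"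
    by (simp_all add: presents_extension_def)
  have ker: "kernel_sections (twist a) E \<phi> U = {cst U 0}"
    and im: "image_sections (twist a) E \<phi> U = kernel_sections E (twist b) \<psi> U"
    and lp: "\<And>s. s \<in> carrier (sec E U) \<Longrightarrow> \<exists>r. \<psi> U s = cst U r \<and> local_product U r"
    and lift: "\<And>r x. local_product U r \<Longrightarrow> x \<in> U \<Longrightarrow>
        \<exists>V s. zopen V \<and> x \<in> V \<and> V \<subseteq> U \<and> s \<in> carrier (sec E V) \<and> \<psi> V s = cst V r"
    if "zopen U" for U using ext that by (simp_all add: presents_extension_def)
  obtain r s \<theta> where \<theta>: "morphism_on P1 E (direct_sum (twist r) (twist s)) \<theta>"
    and bij: "\<And>U. zopen U \<Longrightarrow> U \<subseteq> P1 \<Longrightarrow>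
        bij_betw (\<theta> U) (carrier (sec E U)) (carrier (sec (direct_sum (twist r) (twist s)) U))"
    using dec unfolding decomposable_def isomorphic_on_def by metis
  obtain \<theta>' where \<theta>': "morphism_on P1 (direct_sum (twist r) (twist s)) E \<theta>'"
    and \<theta>'\<theta>: "\<And>U s. zopen U \<Longrightarrow> U \<subseteq> P1 \<Longrightarrow> s \<in> carrier (sec E U) \<Longrightarrow> \<theta>' U (\<theta> U s) = s"
    using isomorphism_inverse[OF closed_presheaf[OF E] \<theta> bij] by metis
  have inl: "morphism_on P1 (twist r) (direct_sum (twist r) (twist s)) (\<lambda>U t. (t, cst U 0))"
    by (rule morphism_onI) (auto simp: cst_twist_iff dest!: twist_cst intro: reg_zero dest: openin_sub subsetD)
  have inr: "morphism_on P1 (twist s) (direct_sum (twist r) (twist s)) (\<lambda>U t. (cst U 0, t))"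
    by (rule morphism_onI) (auto simp: cst_twist_iff dest!: twist_cst intro: reg_zero dest: openin_sub subsetD)
  obtain f where f: "\<And>p. p \<in> P1 \<Longrightarrow> reg (r - a) p f"
    "\<And>U c. zopen U \<Longrightarrow> (\<And>p. p \<in> U \<Longrightarrow> reg a p c) \<Longrightarrow> fst (\<theta> U (\<phi> U (cst U c))) = cst U (f * c)"
    using morphism_twist[OF morphism_comp[OF morphism_comp[OF \<phi> \<theta>] morphism_fst]] by metis
  obtain g where g: "\<And>p. p \<in> P1 \<Longrightarrow> reg (s - a) p g"
    "\<And>U c. zopen U \<Longrightarrow> (\<And>p. p \<in> U \<Longrightarrow> reg a p c) \<Longrightarrow> snd (\<theta> U (\<phi> U (cst U c))) = cst U (g * c)"
    using morphism_twist[OF morphism_comp[OF morphism_comp[OF \<phi> \<theta>] morphism_snd]] by metis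
  obtain p where p: "\<And>z. z \<in> P1 \<Longrightarrow> reg (b - r) z p"
    "\<And>U c. zopen U \<Longrightarrow> (\<And>z. z \<in> U \<Longrightarrow> reg r z c) \<Longrightarrow> \<psi> U (\<theta>' U (cst U c, cst U 0)) = cst U (p * c)"
    using morphism_twist[OF morphism_comp[OF morphism_comp[OF inl \<theta>'] \<psi>]] by metis
  obtain q where q: "\<And>z. z \<in> P1 \<Longrightarrow> reg (b - s) z q"
    "\<And>U c. zopen U \<Longrightarrow> (\<And>z. z \<in> U \<Longrightarrow> reg s z c) \<Longrightarrow> \<psi> U (\<theta>' U (cst U 0, cst U c)) = cst U (q * c)"
    using morphism_twist[OF morphism_comp[OF morphism_comp[OF inr \<theta>'] \<psi>]] by metis
  have pq: "\<psi> U (\<theta>' U (cst U u, cst U v)) = cst U (p * u + q * v)" "\<theta>' U (cst U u, cst U v) \<in> carrier (sec E U)"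
    if U: "zopen U" and u: "\<And>z. z \<in> U \<Longrightarrow> reg r z u" and v: "\<And>z. z \<in> U \<Longrightarrow> reg s z v" for U u v
  proof -
    note UP = openin_sub[OF U]
    have c: "(cst U u, cst U 0) \<in> carrier (sec (direct_sum (twist r) (twist s)) U)"
      "(cst U 0, cst U v) \<in> carrier (sec (direct_sum (twist r) (twist s)) U)"
      using U u v UP by (auto simp: cst_twist_iff)
    have "(cst U u, cst U v) = (cst U u, cst U 0) \<oplus>\<^bsub>sec (direct_sum (twist r) (twist s)) U\<^esub> (cst U 0, cst U v)"
      by simp
    then show "\<psi> U (\<theta>' U (cst U u, cst U v)) = cst U (p * u + q * v)"
      by (simp only: morphism_add[OF \<theta>' U UP c] morphism_closed[OF \<theta>' U UP c(1)] morphism_closed[OF \<theta>' U UP c(2)]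
          morphism_add[OF \<psi> U UP] p(2)[OF U u] q(2)[OF U v] twist_simps(3))
    show "\<theta>' U (cst U u, cst U v) \<in> carrier (sec E U)"
      by (rule morphism_closed[OF \<theta>' U UP]) (use c in auto)
  qed
  obtain l where l: "l \<in> form 1" "l \<noteq> 0" "l \<notin> x" using chartE[OF x] by metis
  \<comment> \<open>Together with \<open>stalk_I\<close>: the stalk of I at x, multiplied by l^b,
    consists of all p u + q v with u and v in the stalks of O(r) and O(s). All three cases below
    read off a generator from this.\<close>
  have stalk_E: "\<exists>u v. reg r x u \<and> reg s x v \<and> m * lpow l b = p * u + q * v" if m: "m \<in> ideal_stalk I x" for m
  proof -
    obtain W where W: "zopen W" "x \<in> W" "local_product W (m * lpow l b)"
      using local_product_stalk(1)[OF x l m] by blast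
    obtain V t where V: "zopen V" "x \<in> V" "t \<in> carrier (sec E V)" "\<psi> V t = cst V (m * lpow l b)"
      using lift[OF W(1,3,2)] by blast
    note VP = openin_sub[OF V(1)]
    obtain t1 t2 where t: "\<theta> V t = (t1, t2)" by (cases "\<theta> V t")
    have "t1 \<in> twist_sections r V" "t2 \<in> twist_sections s V"
      using morphism_closed[OF \<theta> V(1) VP V(3)] by (auto simp: t)
    then obtain u v where u: "t1 = cst V u" "\<And>p. p \<in> V \<Longrightarrow> reg r p u" and v: "t2 = cst V v" "\<And>p. p \<in> V \<Longrightarrow> reg s p v"
      using twist_sectionE[OF V(1)] by metis
    have "cst V (m * lpow l b) = cst V (p * u + q * v)"
      using pq(1)[OF V(1) u(2) v(2)] \<theta>'\<theta>[OF V(1) VP V(3)] by (simp add: t u(1) v(1) V(4))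
    then show ?thesis using cst_inject[OF V(2)] u(2) v(2) V(2) by blast
  qed
  have stalk_I: "(p * u + q * v) / lpow l b \<in> ideal_stalk I x" if u: "reg r x u" and v: "reg s x v" for u v
  proof -
    obtain V V' where V: "zopen V" "x \<in> V" "\<forall>q\<in>V. reg r q u" "zopen V'" "x \<in> V'" "\<forall>q\<in>V'. reg s q v"
      using reg_open[OF x u] reg_open[OF x v] by blast
    have W: "zopen (V \<inter> V')" "x \<in> V \<inter> V'" using V by auto
    have "\<exists>c. \<psi> (V \<inter> V') (\<theta>' (V \<inter> V') (cst (V \<inter> V') u, cst (V \<inter> V') v)) = cst (V \<inter> V') c \<and> local_product (V \<inter> V') c"
      using lp[OF W(1) pq(2)[OF W(1)]] V(3,6) by blast
    then have "local_product (V \<inter> V') (p * u + q * v)"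
      using pq(1)[OF W(1), of u v] V(3,6) cst_inject[OF W(2)] by auto
    from local_product_stalk(2)[OF x l W this] show ?thesis .
  qed
  \<comment> \<open>If these elements are the multiples of one \<open>h\<close> by the stalk of
    O(n), a generator is obtained for w = l^n, which generates that stalk.\<close>
  have principal: ?thesis
    if S: "\<And>m. m \<in> ideal_stalk I x \<Longrightarrow> \<exists>w. reg n x w \<and> m * lpow l b = h * w"
      and H: "h * lpow l n / lpow l b \<in> ideal_stalk I x" for h n
  proof (intro bexI[OF _ H] ballI)
    fix m assume "m \<in> ideal_stalk I x"
    then obtain w where w: "reg n x w" "m * lpow l b = h * w" using S by blast
    have "m = (w / lpow l n) * (h * lpow l n / lpow l b)"
      using w(2) lpow_nz[OF l(2), of b] lpow_nz[OF l(2), of n] by (simp add: field_simps)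
    then show "\<exists>w. reg 0 x w \<and> m = w * (h * lpow l n / lpow l b)"
      using reg_div_lpow[OF x l(1,3) w(1), of 0 n] by auto
  qed
  show ?thesis
  proof (cases "p = 0 \<or> q = 0")
    case True
    then show ?thesis
    proof
      assume "q = 0"
      then show ?thesis
        using stalk_E stalk_I[OF reg_lpow[OF x l(1,3)] reg_zero[OF x]] by (intro principal[of r p]) auto
    next
      assume "p = 0"
      then show ?thesis
        using stalk_E stalk_I[OF reg_zero[OF x] reg_lpow[OF x l(1,3)]] by (intro principal[of s q]) auto
    qed
  next
    case False
    have B: "zopen (basic l)" "gpt \<in> basic l"
      using basic_openin l gpt_P1 by (auto simp: basic_def gpt_def)
    note BP = openin_sub[OF B(1)]
    have L: "\<And>p. p \<in> basic l \<Longrightarrow> reg a p (lpow l a)" using reg_lpow l(1) by (auto simp: basic_def)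
    \<comment> \<open>A nonzero section of O(a), on which the vanishing of the composition and the
      injectivity of \<phi> are tested.\<close>
    define e where "e = cst (basic l) (lpow l a)"
    have e: "e \<in> carrier (sec (twist a) (basic l))" using cst_twist[OF B(1) L] by (simp add: e_def)
    have \<theta>e: "\<theta> (basic l) (\<phi> (basic l) e) = (cst (basic l) (f * lpow l a), cst (basic l) (g * lpow l a))"
      unfolding e_def using f(2)[OF B(1) L] g(2)[OF B(1) L] by (metis prod.collapse)
    note \<phi>e = morphism_closed[OF \<phi> B(1) BP e]
    have fr: "\<And>z. z \<in> basic l \<Longrightarrow> reg r z (f * lpow l a)" and gs: "\<And>z. z \<in> basic l \<Longrightarrow> reg s z (g * lpow l a)"
      using reg_mult'[OF _ f(1) L] reg_mult'[OF _ g(1) L] BP by auto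
    have "\<phi> (basic l) e \<in> image_sections (twist a) E \<phi> (basic l)"
    proof -
      have "res E (basic l) (basic l) (\<phi> (basic l) e) = \<phi> (basic l) (res (twist a) (basic l) (basic l) e)"
        using morphism_res[OF \<phi> B(1,1) order_refl BP e] by simp
      also have "\<dots> = \<phi> (basic l) e" by (simp add: e_def)
      finally show ?thesis using \<phi>e e B(1) unfolding image_sections_def
        by (intro CollectI conjI ballI exI[of _ "basic l"]) simp_all
    qed
    then have "\<psi> (basic l) (\<phi> (basic l) e) = cst (basic l) 0"
      unfolding im[OF B(1)] kernel_sections_def by simp
    moreover have "\<psi> (basic l) (\<phi> (basic l) e) = cst (basic l) (p * (f * lpow l a) + q * (g * lpow l a))"
      using pq(1)[OF B(1) fr gs] \<theta>'\<theta>[OF B(1) BP \<phi>e] by (simp add: \<theta>e)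
    ultimately have "(p * f + q * g) * lpow l a = 0"
      using cst_inject[OF B(2)] by (simp add: algebra_simps)
    then have rel: "p * f + q * g = 0" using lpow_nz[OF l(2)] by simp
    \<comment> \<open>If both vanished, \<open>e\<close> and the zero section would have the same
      image under \<phi>.\<close>
    have "f \<noteq> 0 \<or> g \<noteq> 0"
    proof (rule ccontr)
      assume "\<not> ?thesis"
      then have 0: "f = 0" "g = 0" by auto
      have z: "cst (basic l) 0 \<in> carrier (sec (twist a) (basic l))" "\<phi> (basic l) (cst (basic l) 0) = \<zero>\<^bsub>sec E (basic l)\<^esub>"
        using ker[OF B(1)] by (auto simp: kernel_sections_def)
      have "\<theta> (basic l) (\<phi> (basic l) (cst (basic l) 0)) = (cst (basic l) (f * 0), cst (basic l) (g * 0))"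
        using f(2)[OF B(1), of 0] g(2)[OF B(1), of 0] BP by (metis prod.collapse reg_zero subsetD)
      then have "\<theta> (basic l) (\<phi> (basic l) (cst (basic l) 0)) = \<theta> (basic l) (\<phi> (basic l) e)" by (simp add: \<theta>e 0)
      then have "\<phi> (basic l) e = \<phi> (basic l) (cst (basic l) 0)"
        using \<theta>'\<theta>[OF B(1) BP \<phi>e] \<theta>'\<theta>[OF B(1) BP morphism_closed[OF \<phi> B(1) BP z(1)]] by metis
      then have "e \<in> kernel_sections (twist a) E \<phi> (basic l)" using z(2) e by (simp add: kernel_sections_def)
      then have "e = cst (basic l) 0" using ker[OF B(1)] by simp
      then show False using cst_inject[OF B(2)] lpow_nz[OF l(2)] by (simp add: e_def)
    qed
    \<comment> \<open>As p and q are nonzero, the relation p f + q g = 0 lets f and g vanish only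
      together.\<close>
    then have nz: "f \<noteq> 0" "g \<noteq> 0" "p \<noteq> 0" "q \<noteq> 0" using rel False by auto
    have "r - a \<ge> 0" "s - a \<ge> 0" "b - r \<ge> 0" "b - s \<ge> 0"
      using reg_global[OF f(1)] reg_global[OF g(1)] reg_global[OF p(1)] reg_global[OF q(1)] nz by auto
    then have eq: "r = a" "s = a" "b = a" using ab by linarith+
    obtain P where "p = to_fract P" "P \<in> form 0" using reg_global[OF p(1)] nz(3) eq by auto
    then obtain P where P: "p = to_fract [:[:P:]:]" using form_0_const by metis
    obtain Q where "q = to_fract Q" "Q \<in> form 0" using reg_global[OF q(1)] nz(4) eq by auto
    then obtain Q where Q: "q = to_fract [:[:Q:]:]" using form_0_const by metis
    define c where "c n = to_fract [:[:n:]:]" for n :: int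
    have cadd: "c (m + n) = c m + c n" and cmult: "c (m * n) = c m * c n" for m n by (simp_all add: c_def flip: to_fract_add to_fract_mult)
    have creg: "reg k x (c n * w)" if "reg k x w" for n w k
      using reg_mult'[OF x reg_of_form[OF x const_form[of n]] that] by (simp add: c_def)
    \<comment> \<open>The constants P and Q need not be units of the local ring. Their greatest
      common divisor generates the same ideal already over Z.\<close>
    obtain u v where uv: "u * P + v * Q = gcd P Q" using bezout_int by blast
    obtain P' Q' where P': "P = gcd P Q * P'" "Q = gcd P Q * Q'" by (meson dvdE gcd_dvd1 gcd_dvd2)
    have pc: "p = c (gcd P Q) * c P'" "q = c (gcd P Q) * c Q'"
      unfolding P Q cmult[symmetric] P'[symmetric] by (simp_all add: c_def)
    show ?thesis
    proof (rule principal[of a "c (gcd P Q)"])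
      fix m assume "m \<in> ideal_stalk I x"
      then obtain w w' where w: "reg a x w" "reg a x w'" "m * lpow l b = p * w + q * w'" using stalk_E eq by blast
      have "m * lpow l b = c (gcd P Q) * (c P' * w + c Q' * w')" unfolding w(3) pc by (simp add: algebra_simps)
      then show "\<exists>w. reg a x w \<and> m * lpow l b = c (gcd P Q) * w" using reg_add[OF x creg[OF w(1)] creg[OF w(2)]] by blast
    next
      \<comment> \<open>The Bezout coefficients exhibit the greatest common divisor, times l^a, as
        one of the elements p u + q v.\<close>
      have "p * (c u * lpow l a) + q * (c v * lpow l a) = c (gcd P Q) * lpow l a"
        unfolding uv[symmetric] cadd cmult by (simp add: P Q c_def algebra_simps)
      then show "c (gcd P Q) * lpow l a / lpow l b \<in> ideal_stalk I x"
        using stalk_I[of "c u * lpow l a" "c v * lpow l a"] creg[OF reg_lpow[OF x l(1,3)]] eq by simp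
    qed
  qed
qed

end


section \<open>Splitting of extensions of twists\<close>

text \<open>Here \<open>lift\<close> is surjectivity onto all of O(b), the situation for empty Z,
  and \<open>ab\<close> is the bound under which \<open>cousin\<close> solves problems of degree a -
  b.\<close>

locale twist_extension =
  fixes E :: "'m omod" and a b :: int and \<phi> :: "pt set \<Rightarrow> fn \<Rightarrow> 'm" and \<psi> :: "pt set \<Rightarrow> 'm \<Rightarrow> fn"
  assumes sheaf: "sheaf_of_modules E"
    and phi: "morphism_on P1 (twist a) E \<phi>" and psi: "morphism_on P1 E (twist b) \<psi>"
    and ker: "\<And>U. zopen U \<Longrightarrow> kernel_sections (twist a) E \<phi> U = {cst U 0}"
    and im: "\<And>U. zopen U \<Longrightarrow> image_sections (twist a) E \<phi> U = kernel_sections E (twist b) \<psi> U"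
    and lift: "\<And>U r x. zopen U \<Longrightarrow> (\<And>p. p \<in> U \<Longrightarrow> reg b p r) \<Longrightarrow> x \<in> U \<Longrightarrow>
        \<exists>V s. zopen V \<and> x \<in> V \<and> V \<subseteq> U \<and> s \<in> carrier (sec E V) \<and> \<psi> V s = cst V r"
    and ab: "a - b \<ge> -1"
begin

abbreviation "EC U \<equiv> carrier (sec E U)"
abbreviation "addE U s t \<equiv> s \<oplus>\<^bsub>sec E U\<^esub> t"
abbreviation "scaleE U k s \<equiv> cst U k \<odot>\<^bsub>sec E U\<^esub> s"
abbreviation "regs n U r \<equiv> \<forall>p\<in>U. reg n p r"

lemma E_module: "zopen U \<Longrightarrow> Module.module (OX U) (sec E U)"
  using sheaf by (simp add: sheaf_of_modules_def presheaf_of_modules_def)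

lemma regsD: "zopen U \<Longrightarrow> p \<in> U \<Longrightarrow> p \<in> P1"
  using openin_sub by blast

lemma regs_OX: "zopen U \<Longrightarrow> regs 0 U k \<Longrightarrow> cst U k \<in> carrier (OX U)"
  by (simp add: cst_twist_iff)

lemma plus_closed: "zopen U \<Longrightarrow> s \<in> EC U \<Longrightarrow> t \<in> EC U \<Longrightarrow> addE U s t \<in> EC U"
proof -
  assume U: "zopen U" "s \<in> EC U" "t \<in> EC U"
  interpret Module.module "OX U" "sec E U" by (rule E_module[OF U(1)])
  show ?thesis using U by simp
qed

lemma scale_closed: "zopen U \<Longrightarrow> regs 0 U k \<Longrightarrow> s \<in> EC U \<Longrightarrow> scaleE U k s \<in> EC U"
proof -
  assume U: "zopen U" "regs 0 U k" "s \<in> EC U"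
  interpret Module.module "OX U" "sec E U" by (rule E_module[OF U(1)])
  show ?thesis by (rule smult_closed[OF regs_OX[OF U(1,2)] U(3)])
qed

lemma plus_ac:
  assumes U: "zopen U" "s \<in> EC U" "t \<in> EC U" "u \<in> EC U"
  shows "addE U (addE U s t) u = addE U s (addE U t u)" "addE U s t = addE U t s"
    "addE U s (addE U t u) = addE U t (addE U s u)"
proof -
  interpret Module.module "OX U" "sec E U" by (rule E_module[OF U(1)])
  show "addE U (addE U s t) u = addE U s (addE U t u)" "addE U s t = addE U t s"
    "addE U s (addE U t u) = addE U t (addE U s u)"
    using U by (simp_all add: M.a_ac)
qed

lemma plus_cancel:
  assumes U: "zopen U" "s \<in> EC U" "t \<in> EC U" "u \<in> EC U"
  shows "addE U s t = addE U s u \<longleftrightarrow> t = u"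
proof -
  interpret Module.module "OX U" "sec E U" by (rule E_module[OF U(1)])
  show ?thesis using U by simp
qed

lemma plus_complement:
  assumes U: "zopen U" "s \<in> EC U" "t \<in> EC U"
  shows "\<exists>d\<in>EC U. s = addE U t d"
proof -
  interpret Module.module "OX U" "sec E U" by (rule E_module[OF U(1)])
  show ?thesis using U by (intro bexI[of _ "s \<ominus>\<^bsub>sec E U\<^esub> t"]) (auto simp: M.minus_eq M.a_lcomm M.r_neg)
qed

lemma scale_plus:
  assumes U: "zopen U" "regs 0 U k" "s \<in> EC U" "t \<in> EC U"
  shows "scaleE U k (addE U s t) = addE U (scaleE U k s) (scaleE U k t)"
proof -
  interpret Module.module "OX U" "sec E U" by (rule E_module[OF U(1)])
  show ?thesis by (rule smult_r_distr[OF regs_OX[OF U(1,2)] U(3,4)])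
qed

lemma scale_add:
  assumes U: "zopen U" "regs 0 U k" "regs 0 U k'" "s \<in> EC U"
  shows "scaleE U (k + k') s = addE U (scaleE U k s) (scaleE U k' s)"
proof -
  interpret Module.module "OX U" "sec E U" by (rule E_module[OF U(1)])
  show ?thesis using smult_l_distr[OF regs_OX[OF U(1,2)] regs_OX[OF U(1,3)] U(4)] by simp
qed

lemma scale_scale:
  assumes U: "zopen U" "regs 0 U k" "regs 0 U k'" "s \<in> EC U"
  shows "scaleE U k (scaleE U k' s) = scaleE U (k * k') s"
proof -
  interpret Module.module "OX U" "sec E U" by (rule E_module[OF U(1)])
  show ?thesis using smult_assoc1[OF regs_OX[OF U(1,2)] regs_OX[OF U(1,3)] U(4)] by simp
qed

lemma presheaf: "presheaf_of_modules E"
  using sheaf by (simp add: sheaf_of_modules_def)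

lemma res_closed: "zopen U \<Longrightarrow> zopen V \<Longrightarrow> V \<subseteq> U \<Longrightarrow> s \<in> EC U \<Longrightarrow> res E U V s \<in> EC V"
  using presheaf by (simp add: presheaf_of_modules_def Pi_iff)

lemma res_plus: "zopen U \<Longrightarrow> zopen V \<Longrightarrow> V \<subseteq> U \<Longrightarrow> s \<in> EC U \<Longrightarrow> t \<in> EC U \<Longrightarrow>
    res E U V (addE U s t) = addE V (res E U V s) (res E U V t)"
  using presheaf by (simp add: presheaf_of_modules_def)

lemma res_scale:
  assumes "zopen U" "zopen V" "V \<subseteq> U" "s \<in> EC U" "regs 0 U k"
  shows "res E U V (scaleE U k s) = scaleE V k (res E U V s)"
proof -
  have "\<forall>r\<in>carrier (OX U). \<forall>s\<in>EC U. res E U V (r \<odot>\<^bsub>sec E U\<^esub> s) = restrict r V \<odot>\<^bsub>sec E V\<^esub> res E U V s"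
    using presheaf assms(1-3) by (simp add: presheaf_of_modules_def del: OX_simps)
  then show ?thesis using regs_OX[OF assms(1,5)] assms(3,4) by (metis restrict_cst)
qed

lemma res_id: "zopen U \<Longrightarrow> s \<in> EC U \<Longrightarrow> res E U U s = s"
  using presheaf by (simp add: presheaf_of_modules_def)

lemma res_res: "zopen U \<Longrightarrow> zopen V \<Longrightarrow> zopen W \<Longrightarrow> W \<subseteq> V \<Longrightarrow> V \<subseteq> U \<Longrightarrow> s \<in> EC U \<Longrightarrow>
    res E V W (res E U V s) = res E U W s"
  using presheaf by (simp add: presheaf_of_modules_def)

section \<open>Separatedness and gluing\<close>

lemma separated:
  assumes U: "zopen U" and s: "s \<in> EC U" "t \<in> EC U"
    and eq: "\<And>x. x \<in> U \<Longrightarrow> \<exists>V. zopen V \<and> x \<in> V \<and> V \<subseteq> U \<and> res E U V s = res E U V t"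
  shows "s = t"
proof -
  define C where "C = {V. zopen V \<and> V \<subseteq> U \<and> res E U V s = res E U V t}"
  have UC: "\<Union>C = U" using eq by (auto simp: C_def)
  have "\<forall>s\<in>carrier (sec E (\<Union>C)). \<forall>t\<in>carrier (sec E (\<Union>C)).
           (\<forall>V\<in>C. res E (\<Union>C) V s = res E (\<Union>C) V t) \<longrightarrow> s = t"
  proof -
    have "\<forall>V\<in>C. zopen V" by (simp add: C_def)
    from mp[OF spec[OF conjunct2[OF sheaf[unfolded sheaf_of_modules_def]], of C] this] show ?thesis by (rule conjunct1)
  qed
  then show ?thesis unfolding UC using s by (simp add: C_def)
qed

text \<open>The sheaf axiom for covers indexed by points. Different points may have the same
  neighbourhood; compatibility on it shows that they carry the same section, so one of them can be
  chosen.\<close>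

lemma glue:
  assumes U: "zopen U" and V: "\<And>x. x \<in> U \<Longrightarrow> zopen (V x)" "\<And>x. x \<in> U \<Longrightarrow> x \<in> V x"
      "\<And>x. x \<in> U \<Longrightarrow> V x \<subseteq> U"
    and \<sigma>: "\<And>x. x \<in> U \<Longrightarrow> \<sigma> x \<in> EC (V x)"
    and comp: "\<And>x y. x \<in> U \<Longrightarrow> y \<in> U \<Longrightarrow> res E (V x) (V x \<inter> V y) (\<sigma> x) = res E (V y) (V x \<inter> V y) (\<sigma> y)"
  shows "\<exists>s\<in>EC U. \<forall>x\<in>U. res E U (V x) s = \<sigma> x"
proof -
  define C where "C = V ` U"
  have UC: "\<Union>C = U" using V(2,3) by (auto simp: C_def)
  have same: "\<sigma> x = \<sigma> y" if "x \<in> U" "y \<in> U" "V x = V y" for x y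
    using comp[OF that(1,2)] that(3) res_id[OF V(1)[OF that(1)] \<sigma>[OF that(1)]] res_id[OF V(1)[OF that(2)] \<sigma>[OF that(2)]]
    by simp
  define \<tau> where "\<tau> W = \<sigma> (SOME x. x \<in> U \<and> V x = W)" for W
  have \<tau>: "\<tau> (V x) = \<sigma> x" if x: "x \<in> U" for x
  proof -
    have "(SOME y. y \<in> U \<and> V y = V x) \<in> U \<and> V (SOME y. y \<in> U \<and> V y = V x) = V x"
      by (rule someI[of "\<lambda>y. y \<in> U \<and> V y = V x" x]) (use x in auto)
    then show ?thesis unfolding \<tau>_def using same x by blast
  qed
  have C: "\<forall>V\<in>C. zopen V" using V(1) by (auto simp: C_def)
  have "\<forall>\<sigma>. (\<forall>V\<in>C. \<sigma> V \<in> EC V) \<and> (\<forall>V\<in>C. \<forall>W\<in>C. res E V (V \<inter> W) (\<sigma> V) = res E W (V \<inter> W) (\<sigma> W)) \<longrightarrow>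
       (\<exists>s\<in>carrier (sec E (\<Union>C)). \<forall>V\<in>C. res E (\<Union>C) V s = \<sigma> V)"
    by (rule conjunct2[OF mp[OF spec[OF conjunct2[OF sheaf[unfolded sheaf_of_modules_def]], of C] C]])
  then have "\<exists>s\<in>carrier (sec E (\<Union>C)). \<forall>V\<in>C. res E (\<Union>C) V s = \<tau> V"
  proof (rule mp[OF spec[of _ \<tau>]], intro conjI)
    show "\<forall>V\<in>C. \<tau> V \<in> EC V" "\<forall>V\<in>C. \<forall>W\<in>C. res E V (V \<inter> W) (\<tau> V) = res E W (V \<inter> W) (\<tau> W)"
      using \<sigma> comp by (auto simp: C_def \<tau>)
  qed
  then show ?thesis unfolding UC by (auto simp: C_def \<tau>)
qed

section \<open>The inclusion of O(a) and the projection to O(b)\<close>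

definition ph :: "pt set \<Rightarrow> rat_fun \<Rightarrow> 'm" where "ph U c = \<phi> U (cst U c)"

lemma ph_closed: "zopen U \<Longrightarrow> regs a U c \<Longrightarrow> ph U c \<in> EC U"
  unfolding ph_def by (rule morphism_closed[OF phi _ openin_sub]) (simp_all add: cst_twist_iff)

lemma ph_add: "zopen U \<Longrightarrow> regs a U c \<Longrightarrow> regs a U d \<Longrightarrow> ph U (c + d) = addE U (ph U c) (ph U d)"
  unfolding ph_def using morphism_add[OF phi _ openin_sub, of U "cst U c" "cst U d"] by (simp add: cst_twist_iff)

lemma ph_scale: "zopen U \<Longrightarrow> regs 0 U k \<Longrightarrow> regs a U c \<Longrightarrow> ph U (k * c) = scaleE U k (ph U c)"
  unfolding ph_def using morphism_smult[OF phi _ openin_sub, of U "cst U c" "cst U k"] by (simp add: cst_twist_iff)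

lemma ph_res: "zopen U \<Longrightarrow> zopen V \<Longrightarrow> V \<subseteq> U \<Longrightarrow> regs a U c \<Longrightarrow> res E U V (ph U c) = ph V c"
  unfolding ph_def using morphism_res[OF phi _ _ _ openin_sub, of U V "cst U c"] by (simp add: cst_twist_iff)

lemma ph_zero: assumes U: "zopen U" and s: "s \<in> EC U" shows "addE U s (ph U 0) = s"
proof -
  interpret Module.module "OX U" "sec E U" by (rule E_module[OF U])
  have "ph U 0 = \<zero>\<^bsub>sec E U\<^esub>" using ker[OF U] by (auto simp: kernel_sections_def ph_def)
  then show ?thesis using s by simp
qed

lemma ph_inject:
  assumes U: "zopen U" "x \<in> U" and c: "regs a U c" "regs a U d" and eq: "ph U c = ph U d"
  shows "c = d"
proof -
  have cd: "regs a U (c - d)" using reg_diff c regsD[OF U(1)] by blast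
  have 0: "regs a U 0" using regsD[OF U(1)] by simp
  have "addE U (ph U d) (ph U (c - d)) = addE U (ph U d) (ph U 0)"
    using ph_add[OF U(1) c(2) cd] eq ph_zero[OF U(1) ph_closed[OF U(1) c(2)]] by simp
  then have "ph U (c - d) = ph U 0"
    by (simp add: plus_cancel[OF U(1) ph_closed[OF U(1) c(2)] ph_closed[OF U(1) cd] ph_closed[OF U(1) 0]])
  moreover have "ph U 0 = \<zero>\<^bsub>sec E U\<^esub>" using ker[OF U(1)] by (auto simp: kernel_sections_def ph_def)
  ultimately have "cst U (c - d) \<in> kernel_sections (twist a) E \<phi> U"
    using cd U(1) by (simp add: kernel_sections_def ph_def cst_twist_iff)
  then show ?thesis using ker[OF U(1)] cst_inject[OF U(2)] by simp
qed

lemma psi_cst: assumes U: "zopen U" and s: "s \<in> EC U"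
  shows "\<exists>w. \<psi> U s = cst U w \<and> regs b U w"
proof -
  have "\<psi> U s \<in> twist_sections b U" using morphism_closed[OF psi U openin_sub[OF U] s] by simp
  then obtain w where "\<psi> U s = cst U w" "\<And>p. p \<in> U \<Longrightarrow> reg b p w" by (rule twist_sectionE[OF U]) (rule that)
  then show ?thesis by blast
qed

lemma psi_plus: "zopen U \<Longrightarrow> s \<in> EC U \<Longrightarrow> t \<in> EC U \<Longrightarrow> \<psi> U s = cst U w \<Longrightarrow> \<psi> U t = cst U v \<Longrightarrow>
    \<psi> U (addE U s t) = cst U (w + v)"
  using morphism_add[OF psi _ openin_sub, of U s t] by simp

lemma psi_scale: "zopen U \<Longrightarrow> s \<in> EC U \<Longrightarrow> \<psi> U s = cst U w \<Longrightarrow> regs 0 U k \<Longrightarrow>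
    \<psi> U (scaleE U k s) = cst U (k * w)"
  using morphism_smult[OF psi _ openin_sub, of U s "cst U k"] by (simp add: cst_twist_iff)

lemma psi_res: "zopen U \<Longrightarrow> zopen V \<Longrightarrow> V \<subseteq> U \<Longrightarrow> s \<in> EC U \<Longrightarrow> \<psi> U s = cst U w \<Longrightarrow>
    \<psi> V (res E U V s) = cst V w"
  using morphism_res[OF psi _ _ _ openin_sub, of U V s] by simp

lemma psi_ph: assumes U: "zopen U" and c: "regs a U c" shows "\<psi> U (ph U c) = cst U 0"
proof -
  have "ph U c \<in> image_sections (twist a) E \<phi> U"
    unfolding image_sections_def
    using U c ph_closed[OF U c] res_id[OF U ph_closed[OF U c]]
    by (intro CollectI conjI ballI exI[of _ U]) (auto simp: ph_def cst_twist_iff)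
  then show ?thesis using im[OF U] by (simp add: kernel_sections_def)
qed

text \<open>Exactness provides preimages only locally. They are constants, and by injectivity each
  agrees with the one near the generic point; so a single constant works on all of \<open>U\<close>,
  and separatedness concludes.\<close>

lemma kernel_ph:
  assumes U: "zopen U" and e: "e \<in> EC U" "\<psi> U e = cst U 0"
  shows "\<exists>c. regs a U c \<and> e = ph U c"
proof -
  have "e \<in> image_sections (twist a) E \<phi> U" using im[OF U] e by (simp add: kernel_sections_def)
  then have "\<forall>x\<in>U. \<exists>V. zopen V \<and> x \<in> V \<and> V \<subseteq> U \<and> res E U V e \<in> \<phi> V ` twist_sections a V"
    by (simp add: image_sections_def)
  have loc: "\<exists>V c. zopen V \<and> x \<in> V \<and> V \<subseteq> U \<and> regs a V c \<and> res E U V e = ph V c" if x: "x \<in> U" for x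
  proof -
    from bspec[OF \<open>\<forall>x\<in>U. _ x\<close> x] obtain V s where V: "zopen V" "x \<in> V" "V \<subseteq> U" "s \<in> twist_sections a V" "res E U V e = \<phi> V s"
      by (elim exE conjE imageE)
    obtain c where "s = cst V c" "\<And>p. p \<in> V \<Longrightarrow> reg a p c" by (rule twist_sectionE[OF V(1,4)]) (rule that)
    then show ?thesis using V by (auto simp: ph_def)
  qed
  have "\<exists>c. regs a U c \<and> (\<forall>x\<in>U. \<exists>V. zopen V \<and> x \<in> V \<and> V \<subseteq> U \<and> res E U V e = ph V c)"
  proof (cases "U = {}")
    case False
    then have gU: "gpt \<in> U" using gpt_in_open U by blast
    from loc[OF gU] obtain V0 c where 0: "zopen V0" "gpt \<in> V0" "V0 \<subseteq> U" "regs a V0 c" "res E U V0 e = ph V0 c"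
      by (elim exE conjE)
    have "reg a x c \<and> (\<exists>V. zopen V \<and> x \<in> V \<and> V \<subseteq> U \<and> res E U V e = ph V c)" if x: "x \<in> U" for x
    proof -
      from loc[OF x] obtain V d where V: "zopen V" "x \<in> V" "V \<subseteq> U" "regs a V d" "res E U V e = ph V d"
        by (elim exE conjE)
      have W: "zopen (V \<inter> V0)" "gpt \<in> V \<inter> V0" "V \<inter> V0 \<subseteq> V" "V \<inter> V0 \<subseteq> V0"
        using V(1,2) 0(1,2) gpt_in_open by auto
      have "ph (V \<inter> V0) d = ph (V \<inter> V0) c"
        using res_res[OF U V(1) W(1,3) V(3) e(1)] res_res[OF U 0(1) W(1,4) 0(3) e(1)]
          ph_res[OF V(1) W(1,3) V(4)] ph_res[OF 0(1) W(1,4) 0(4)] V(5) 0(5) by simp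
      moreover have "regs a (V \<inter> V0) d" "regs a (V \<inter> V0) c" using V(4) 0(4) by auto
      ultimately have "d = c" by (intro ph_inject[OF W(1,2)])
      then show ?thesis using V by blast
    qed
    then show ?thesis by blast
  qed auto
  then obtain c where c: "regs a U c" "\<And>x. x \<in> U \<Longrightarrow> \<exists>V. zopen V \<and> x \<in> V \<and> V \<subseteq> U \<and> res E U V e = ph V c"
    by blast
  have "e = ph U c"
  proof (rule separated[OF U e(1) ph_closed[OF U c(1)]])
    fix x assume "x \<in> U"
    from c(2)[OF this] obtain V where V: "zopen V" "x \<in> V" "V \<subseteq> U" "res E U V e = ph V c" by blast
    then show "\<exists>V. zopen V \<and> x \<in> V \<and> V \<subseteq> U \<and> res E U V e = res E U V (ph U c)"
      using ph_res[OF U V(1,3) c(1)] by auto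
  qed
  then show ?thesis using c(1) by blast
qed

text \<open>The difference of \<open>s\<close> and \<open>t\<close> lies in the kernel of
  \<psi>.\<close>

lemma same_image:
  assumes U: "zopen U" and s: "s \<in> EC U" "t \<in> EC U" "\<psi> U s = \<psi> U t"
  shows "\<exists>c. regs a U c \<and> s = addE U t (ph U c)"
proof -
  obtain d where d: "d \<in> EC U" "s = addE U t d" using plus_complement[OF U s(1,2)] by blast
  obtain w where w: "\<psi> U t = cst U w" using psi_cst[OF U s(2)] by blast
  obtain v where v: "\<psi> U d = cst U v" using psi_cst[OF U d(1)] by blast
  have "cst U w = cst U (w + v)" using psi_plus[OF U s(2) d(1) w v] s(3) d(2) w by simp
  then have "cst U v = cst U 0"
    using cst_inject[of _ U w "w + v"] cst_empty[of v 0] by (cases "U = {}") auto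
  then have "\<psi> U d = cst U 0" by (simp add: v)
  from kernel_ph[OF U d(1) this] d(2) show ?thesis by blast
qed

end

text \<open>A lift of a local generator g of O(b) near p is recorded as the family of the lifts L p U w of
  all sections w = (w/g) g.\<close>
locale local_lifts = twist_extension +
  fixes V :: "pt \<Rightarrow> pt set" and L :: "pt \<Rightarrow> pt set \<Rightarrow> rat_fun \<Rightarrow> 'a"
  assumes V: "\<And>p. p \<in> P1 \<Longrightarrow> zopen (V p)" "\<And>p. p \<in> P1 \<Longrightarrow> p \<in> V p"
    and gen: "\<And>p. p \<in> P1 \<Longrightarrow> \<exists>g. g \<noteq> 0 \<and> regs b (V p) g \<and>
          (\<forall>q\<in>V p. \<forall>n r. reg n q r \<longrightarrow> reg (n - b) q (r / g))"
    and L_closed: "\<And>p U w. p \<in> P1 \<Longrightarrow> zopen U \<Longrightarrow> U \<subseteq> V p \<Longrightarrow> regs b U w \<Longrightarrow> L p U w \<in> EC U"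
    and L_psi: "\<And>p U w. p \<in> P1 \<Longrightarrow> zopen U \<Longrightarrow> U \<subseteq> V p \<Longrightarrow> regs b U w \<Longrightarrow> \<psi> U (L p U w) = cst U w"
    and L_add: "\<And>p U w v. p \<in> P1 \<Longrightarrow> zopen U \<Longrightarrow> U \<subseteq> V p \<Longrightarrow> regs b U w \<Longrightarrow> regs b U v \<Longrightarrow>
        L p U (w + v) = addE U (L p U w) (L p U v)"
    and L_scale: "\<And>p U k w. p \<in> P1 \<Longrightarrow> zopen U \<Longrightarrow> U \<subseteq> V p \<Longrightarrow> regs 0 U k \<Longrightarrow> regs b U w \<Longrightarrow>
        L p U (k * w) = scaleE U k (L p U w)"
    and L_res: "\<And>p U W w. p \<in> P1 \<Longrightarrow> zopen U \<Longrightarrow> zopen W \<Longrightarrow> W \<subseteq> U \<Longrightarrow> U \<subseteq> V p \<Longrightarrow> regs b U w \<Longrightarrow>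
        res E U W (L p U w) = L p W w"

text \<open>Choose a lift of l^b near each point; a section w then lifts to the multiple of it by w
  / l^b, which is a regular function there.\<close>

lemma (in twist_extension) local_lifts_exist: "\<exists>V L. local_lifts E a b \<phi> \<psi> V L"
proof -
  have "\<forall>p. \<exists>W l s. p \<in> P1 \<longrightarrow> zopen W \<and> p \<in> W \<and> l \<in> form 1 \<and> l \<noteq> 0 \<and> W \<subseteq> basic l \<and>
      s \<in> EC W \<and> \<psi> W s = cst W (lpow l b)"
  proof
    fix p
    show "\<exists>W l s. p \<in> P1 \<longrightarrow> zopen W \<and> p \<in> W \<and> l \<in> form 1 \<and> l \<noteq> 0 \<and> W \<subseteq> basic l \<and>
      s \<in> EC W \<and> \<psi> W s = cst W (lpow l b)"
    proof (cases "p \<in> P1")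
      case True
      obtain l where l: "l \<in> form 1" "l \<noteq> 0" "p \<in> basic l" using chartE[OF True] by metis
      have "\<exists>W s. zopen W \<and> p \<in> W \<and> W \<subseteq> basic l \<and> s \<in> EC W \<and> \<psi> W s = cst W (lpow l b)"
        by (rule lift[OF basic_openin[OF l(1)] _ l(3)]) (use reg_lpow l(1) in \<open>auto simp: basic_def\<close>)
      then obtain W s where W: "zopen W" "p \<in> W" "W \<subseteq> basic l" "s \<in> EC W" "\<psi> W s = cst W (lpow l b)"
        by (elim exE conjE)
      show ?thesis by (intro exI[of _ W] exI[of _ l] exI[of _ s] impI conjI W l(1,2))
    qed simp
  qed
  then obtain V l s where "\<forall>p. p \<in> P1 \<longrightarrow> zopen (V p) \<and> p \<in> V p \<and> l p \<in> form 1 \<and> l p \<noteq> 0 \<and>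
      V p \<subseteq> basic (l p) \<and> s p \<in> EC (V p) \<and> \<psi> (V p) (s p) = cst (V p) (lpow (l p) b)"
    unfolding choice_iff by (elim exE)
  then have V: "\<And>p. p \<in> P1 \<Longrightarrow> zopen (V p)" "\<And>p. p \<in> P1 \<Longrightarrow> p \<in> V p"
    and l: "\<And>p. p \<in> P1 \<Longrightarrow> l p \<in> form 1" "\<And>p. p \<in> P1 \<Longrightarrow> l p \<noteq> 0" "\<And>p. p \<in> P1 \<Longrightarrow> V p \<subseteq> basic (l p)"
    and s: "\<And>p. p \<in> P1 \<Longrightarrow> s p \<in> EC (V p)" "\<And>p. p \<in> P1 \<Longrightarrow> \<psi> (V p) (s p) = cst (V p) (lpow (l p) b)"
    by simp_all
  define g where "g p = lpow (l p) b" for p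
  define L where "L p U w = scaleE U (w / g p) (res E (V p) U (s p))" for p U w
  have g0: "g p \<noteq> 0" if "p \<in> P1" for p using lpow_nz l(2)[OF that] by (simp add: g_def)
  have g1: "reg b q (g p)" "reg (n - b) q (r / g p)" if "p \<in> P1" "q \<in> V p" "reg n q r" for p q n r
    using l(1,3)[OF that(1)] that(2,3) reg_lpow reg_div_lpow[of q "l p" n r "n - b" b]
    by (auto simp: g_def basic_def)
  have k: "regs 0 U (w / g p)" if "p \<in> P1" "U \<subseteq> V p" "regs b U w" for p U w
    using g1(2)[OF that(1), of _ b w] that(2,3) by auto
  have "local_lifts E a b \<phi> \<psi> V L"
  proof (intro local_lifts.intro twist_extension_axioms local_lifts_axioms.intro)
    show "zopen (V p)" "p \<in> V p" if "p \<in> P1" for p using V that by auto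
    show "\<exists>g. g \<noteq> 0 \<and> regs b (V p) g \<and> (\<forall>q\<in>V p. \<forall>n r. reg n q r \<longrightarrow> reg (n - b) q (r / g))" if p: "p \<in> P1" for p
      using g0[OF p] g1[OF p] reg_one regsD[OF V(1)[OF p]] by (intro exI[of _ "g p"]) blast
    fix p U w assume p: "p \<in> P1" and U: "zopen U" "U \<subseteq> V p" and w: "regs b U w"
    note r = res_closed[OF V(1)[OF p] U s(1)[OF p]]
    show "L p U w \<in> EC U" unfolding L_def by (rule scale_closed[OF U(1) k[OF p U(2) w] r])
    show "\<psi> U (L p U w) = cst U w"
      unfolding L_def using psi_scale[OF U(1) r psi_res[OF V(1)[OF p] U s(1)[OF p] s(2)[OF p]] k[OF p U(2) w]] g0[OF p]
      by (simp add: g_def)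
    show "L p U (w + v) = addE U (L p U w) (L p U v)" if v: "regs b U v" for v
      unfolding L_def add_divide_distrib by (rule scale_add[OF U(1) k[OF p U(2) w] k[OF p U(2) v] r])
    show "L p U (c * w) = scaleE U c (L p U w)" if c: "regs 0 U c" for c
      unfolding L_def scale_scale[OF U(1) c k[OF p U(2) w] r] by simp
    show "res E U W (L p U w) = L p W w" if W: "zopen W" "W \<subseteq> U" for W
      unfolding L_def res_scale[OF U(1) W r k[OF p U(2) w]] res_res[OF V(1)[OF p] U(1) W(1,2) U(2) s(1)[OF p]] ..
  qed
  then show ?thesis by blast
qed

section \<open>Correcting the local lifts and gluing them\<close>

context local_lifts
begin

text \<open>Here w tau p compares the lift of w at p with its lift at the generic point.\<close>
lemma lift_differences:
  obtains \<tau> where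
    "\<And>p U w. p \<in> P1 \<Longrightarrow> zopen U \<Longrightarrow> U \<subseteq> V p \<inter> V gpt \<Longrightarrow> regs b U w \<Longrightarrow>
       regs a U (w * \<tau> p) \<and> L p U w = addE U (L gpt U w) (ph U (w * \<tau> p))"
    "\<And>p q z. p \<in> P1 \<Longrightarrow> q \<in> P1 \<Longrightarrow> z \<in> V p \<Longrightarrow> z \<in> V q \<Longrightarrow> reg (a - b) z (\<tau> p - \<tau> q)"
proof -
  note G = gpt_P1
  obtain g where g: "g \<noteq> 0" "regs b (V gpt) g" "\<forall>q\<in>V gpt. \<forall>n r. reg n q r \<longrightarrow> reg (n - b) q (r / g)"
    using gen[OF G] by blast
  \<comment> \<open>On the common domain the two lifts of the generator \<open>g\<close> have the
    same image, so they differ by a section of O(a).\<close>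
  have "\<exists>c. regs a (V p \<inter> V gpt) c \<and> L p (V p \<inter> V gpt) g = addE (V p \<inter> V gpt) (L gpt (V p \<inter> V gpt) g) (ph (V p \<inter> V gpt) c)"
    if p: "p \<in> P1" for p
  proof (rule same_image)
    show U: "zopen (V p \<inter> V gpt)" using V(1)[OF p] V(1)[OF G] by blast
    have gr: "regs b (V p \<inter> V gpt) g" using g(2) by blast
    show "L p (V p \<inter> V gpt) g \<in> EC (V p \<inter> V gpt)" "L gpt (V p \<inter> V gpt) g \<in> EC (V p \<inter> V gpt)"
      using L_closed[OF p U _ gr] L_closed[OF G U _ gr] by auto
    show "\<psi> (V p \<inter> V gpt) (L p (V p \<inter> V gpt) g) = \<psi> (V p \<inter> V gpt) (L gpt (V p \<inter> V gpt) g)"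
      using L_psi[OF p U _ gr] L_psi[OF G U _ gr] by auto
  qed
  then obtain c where c: "\<And>p. p \<in> P1 \<Longrightarrow> regs a (V p \<inter> V gpt) (c p)"
    "\<And>p. p \<in> P1 \<Longrightarrow> L p (V p \<inter> V gpt) g = addE (V p \<inter> V gpt) (L gpt (V p \<inter> V gpt) g) (ph (V p \<inter> V gpt) (c p))"
    by metis
  \<comment> \<open>Division by g turns the discrepancy of an arbitrary section w into w \<tau> p,
    so that \<tau> p has degree a - b.\<close>
  define \<tau> where "\<tau> p = c p / g" for p
  have 1: "regs a U (w * \<tau> p) \<and> L p U w = addE U (L gpt U w) (ph U (w * \<tau> p))"
    if p: "p \<in> P1" and U: "zopen U" "U \<subseteq> V p \<inter> V gpt" and w: "regs b U w" for p U w
  proof -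
    have U': "U \<subseteq> V p" "U \<subseteq> V gpt" using U(2) by auto
    have X: "zopen (V p \<inter> V gpt)" using V(1)[OF p] V(1)[OF G] by blast
    have gU: "regs b U g" and gX: "regs b (V p \<inter> V gpt) g" using g(2) U' by auto
    have cU: "regs a U (c p)" using c(1)[OF p] U(2) by auto
    have k: "regs 0 U (w / g)"
    proof
      fix z assume "z \<in> U"
      then show "reg 0 z (w / g)" using g(3) w U'(2) by (metis diff_self subsetD)
    qed
    have eq: "w / g * c p = w * \<tau> p" "w / g * g = w" using g(1) by (simp_all add: \<tau>_def)
    have "regs a U (w / g * c p)" using reg_mult'[OF regsD[OF U(1)], of _ 0 "w / g" a "c p" a] k cU by auto
    then have 1: "regs a U (w * \<tau> p)" by (simp only: eq)
    have "L p U g = res E (V p \<inter> V gpt) U (L p (V p \<inter> V gpt) g)"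
      using L_res[OF p X U(1,2) _ gX] by auto
    also have "\<dots> = addE U (L gpt U g) (ph U (c p))"
    proof -
      have "L gpt (V p \<inter> V gpt) g \<in> EC (V p \<inter> V gpt)" using L_closed[OF G X _ gX] by auto
      then show ?thesis
        unfolding c(2)[OF p] using L_res[OF G X U(1,2) _ gX] ph_res[OF X U(1,2) c(1)[OF p]]
        by (simp add: res_plus[OF X U(1,2) _ ph_closed[OF X c(1)[OF p]]])
    qed
    finally have "scaleE U (w / g) (L p U g) = addE U (scaleE U (w / g) (L gpt U g)) (scaleE U (w / g) (ph U (c p)))"
      by (simp add: scale_plus[OF U(1) k L_closed[OF G U(1) U'(2) gU] ph_closed[OF U(1) cU]])
    then have "L p U w = addE U (L gpt U w) (ph U (w * \<tau> p))"
      unfolding L_scale[OF p U(1) U'(1) k gU, symmetric] L_scale[OF G U(1) U'(2) k gU, symmetric]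
        ph_scale[OF U(1) k cU, symmetric] eq .
    with 1 show ?thesis by blast
  qed
  have 2: "reg (a - b) z (\<tau> p - \<tau> q)" if p: "p \<in> P1" and q: "q \<in> P1" and z: "z \<in> V p" "z \<in> V q" for p q z
  proof -
    \<comment> \<open>A generator of O(b) near z: the discrepancy d of its lifts at p and q is
      regular at z, and hence so is d / h, in degree a - b.\<close>
    obtain h where h: "h \<noteq> 0" "regs b (V q) h" "\<forall>z\<in>V q. \<forall>n r. reg n z r \<longrightarrow> reg (n - b) z (r / h)"
      using gen[OF q] by blast
    define U where "U = V p \<inter> V q"
    have U: "zopen U" "U \<subseteq> V p" "U \<subseteq> V q" using V(1)[OF p] V(1)[OF q] by (auto simp: U_def)
    have hU: "regs b U h" using h(2) U(3) by auto
    obtain d where d: "regs a U d" "L p U h = addE U (L q U h) (ph U d)"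
      using same_image[OF U(1) L_closed[OF p U(1,2) hU] L_closed[OF q U(1,3) hU]]
        L_psi[OF p U(1,2) hU] L_psi[OF q U(1,3) hU] by auto
    \<comment> \<open>The point z may lie outside \<open>V gpt\<close>. But d / h = \<tau> p -
      \<tau> q is an identity of rational functions, so it can be checked on \<open>W\<close>, while
      regularity at z comes from \<open>U\<close>.\<close>
    define W where "W = U \<inter> V gpt"
    have gW: "gpt \<in> W" using gpt_in_open[OF U(1)] V(2)[OF G] z by (auto simp: W_def U_def)
    have W: "zopen W" "W \<subseteq> U" "W \<subseteq> V p \<inter> V gpt" "W \<subseteq> V q \<inter> V gpt" "W \<subseteq> V gpt"
      using U V(1)[OF G] by (auto simp: W_def)
    have hW: "regs b W h" and dW: "regs a W d" using hU d(1) W(2) by auto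
    note p1 = 1[OF p W(1,3) hW] and q1 = 1[OF q W(1,4) hW]
    note gl = L_closed[OF G W(1,5) hW]
    have "L p W h = addE W (L q W h) (ph W d)"
      using arg_cong[OF d(2), of "res E U W"] L_res[OF p U(1) W(1,2) U(2) hU] L_res[OF q U(1) W(1,2) U(3) hU]
        ph_res[OF U(1) W(1,2) d(1)] res_plus[OF U(1) W(1,2) L_closed[OF q U(1,3) hU] ph_closed[OF U(1) d(1)]] by simp
    then have "addE W (L gpt W h) (ph W (h * \<tau> p)) = addE W (L gpt W h) (addE W (ph W (h * \<tau> q)) (ph W d))"
      using p1 q1 plus_ac(1)[OF W(1) gl ph_closed[OF W(1)] ph_closed[OF W(1) dW]] by simp
    then have "ph W (h * \<tau> p) = ph W (h * \<tau> q + d)"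
      using plus_cancel[OF W(1) gl ph_closed[OF W(1)] plus_closed[OF W(1) ph_closed[OF W(1)] ph_closed[OF W(1) dW]]]
        ph_add[OF W(1) _ dW] p1 q1 by simp
    moreover have "regs a W (h * \<tau> q + d)" using q1 dW reg_add regsD[OF W(1)] by blast
    ultimately have "h * \<tau> p = h * \<tau> q + d" using ph_inject[OF W(1) gW] p1 by blast
    then have "d / h = \<tau> p - \<tau> q" using h(1) by (simp add: field_simps)
    moreover have "reg (a - b) z (d / h)" using h(3) d(1) z by (auto simp: U_def)
    ultimately show ?thesis by simp
  qed
  show thesis using that 1 2 by blast
qed

text \<open>Subtracting a global solution of the additive Cousin problem from the tau p makes the lifts compatible.\<close>
lemma corrected_lifts:
  "\<exists>V' L'. local_lifts E a b \<phi> \<psi> V' L' \<and>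
    (\<forall>p\<in>P1. \<forall>q\<in>P1. \<forall>U w. zopen U \<longrightarrow> U \<subseteq> V' p \<inter> V' q \<longrightarrow> gpt \<in> U \<longrightarrow> regs b U w \<longrightarrow> L' p U w = L' q U w)"
proof -
  obtain \<tau> where \<tau>: "\<And>p U w. p \<in> P1 \<Longrightarrow> zopen U \<Longrightarrow> U \<subseteq> V p \<inter> V gpt \<Longrightarrow> regs b U w \<Longrightarrow>
       regs a U (w * \<tau> p) \<and> L p U w = addE U (L gpt U w) (ph U (w * \<tau> p))"
    "\<And>p q z. p \<in> P1 \<Longrightarrow> q \<in> P1 \<Longrightarrow> z \<in> V p \<Longrightarrow> z \<in> V q \<Longrightarrow> reg (a - b) z (\<tau> p - \<tau> q)"
    by (rule lift_differences) (rule that)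
  have "\<exists>t. \<forall>p\<in>P1. reg (a - b) p (\<tau> p - t)"
    by (rule cousin[OF ab, of V]) (use V \<tau>(2) in auto)
  then obtain t where t: "\<And>p. p \<in> P1 \<Longrightarrow> reg (a - b) p (\<tau> p - t)" by blast
  \<comment> \<open>The Cousin solution makes \<tau> p - t regular at p alone, so the neighbourhoods
    shrink to where it stays regular.\<close>
  have "\<forall>p. \<exists>W. p \<in> P1 \<longrightarrow> zopen W \<and> p \<in> W \<and> W \<subseteq> V p \<and> regs (a - b) W (t - \<tau> p)"
  proof
    fix p
    show "\<exists>W. p \<in> P1 \<longrightarrow> zopen W \<and> p \<in> W \<and> W \<subseteq> V p \<and> regs (a - b) W (t - \<tau> p)"
    proof (cases "p \<in> P1")
      case True
      have "reg (a - b) p (t - \<tau> p)" using reg_uminus[OF True t[OF True]] by simp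
      from reg_open[OF True this] obtain W where W: "zopen W" "p \<in> W" "regs (a - b) W (t - \<tau> p)"
        by (elim exE conjE)
      show ?thesis by (intro exI[of _ "W \<inter> V p"]) (use W V[OF True] in auto)
    qed simp
  qed
  then obtain V' where "\<forall>p. p \<in> P1 \<longrightarrow> zopen (V' p) \<and> p \<in> V' p \<and> V' p \<subseteq> V p \<and> regs (a - b) (V' p) (t - \<tau> p)"
    unfolding choice_iff by (elim exE)
  then have V': "\<And>p. p \<in> P1 \<Longrightarrow> zopen (V' p)" "\<And>p. p \<in> P1 \<Longrightarrow> p \<in> V' p" "\<And>p. p \<in> P1 \<Longrightarrow> V' p \<subseteq> V p"
    "\<And>p. p \<in> P1 \<Longrightarrow> regs (a - b) (V' p) (t - \<tau> p)"
    by simp_all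
  define L' where "L' p U w = addE U (L p U w) (ph U (w * (t - \<tau> p)))" for p U w
  have r: "regs a U (w * (t - \<tau> p))" if "p \<in> P1" "zopen U" "U \<subseteq> V' p" "regs b U w" for p U w
  proof
    fix z assume z: "z \<in> U"
    show "reg a z (w * (t - \<tau> p))"
      by (rule reg_mult'[OF regsD[OF that(2) z], of b _ "a - b"]) (use z that V'(4)[OF that(1)] in auto)
  qed
  have LL: "local_lifts E a b \<phi> \<psi> V' L'"
  proof (intro local_lifts.intro twist_extension_axioms local_lifts_axioms.intro)
    show "zopen (V' p)" "p \<in> V' p" if "p \<in> P1" for p using V' that by auto
    show "\<exists>g. g \<noteq> 0 \<and> regs b (V' p) g \<and> (\<forall>q\<in>V' p. \<forall>n r. reg n q r \<longrightarrow> reg (n - b) q (r / g))" if p: "p \<in> P1" for p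
      using gen[OF p] V'(3)[OF p] by (meson subsetD)
    fix p U w assume p: "p \<in> P1" and U: "zopen U" "U \<subseteq> V' p" and w: "regs b U w"
    have UV: "U \<subseteq> V p" using U(2) V'(3)[OF p] by blast
    note Lc = L_closed[OF p U(1) UV w] and rw = r[OF p U w]
    note phc = ph_closed[OF U(1) rw]
    show "L' p U w \<in> EC U" unfolding L'_def by (rule plus_closed[OF U(1) Lc phc])
    show "\<psi> U (L' p U w) = cst U w"
      unfolding L'_def using psi_plus[OF U(1) Lc phc L_psi[OF p U(1) UV w] psi_ph[OF U(1) rw]] by simp
    show "L' p U (w + v) = addE U (L' p U w) (L' p U v)" if v: "regs b U v" for v
    proof -
      note Lv = L_closed[OF p U(1) UV v] and rv = r[OF p U v]
      note phv = ph_closed[OF U(1) rv]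
      show ?thesis
        unfolding L'_def distrib_right L_add[OF p U(1) UV w v] ph_add[OF U(1) rw rv]
        by (simp add: plus_ac[OF U(1)] plus_closed[OF U(1)] Lc Lv phc phv)
    qed
    show "L' p U (k * w) = scaleE U k (L' p U w)" if k: "regs 0 U k" for k
      unfolding L'_def mult.assoc L_scale[OF p U(1) UV k w] ph_scale[OF U(1) k rw] scale_plus[OF U(1) k Lc phc] ..
    show "res E U W (L' p U w) = L' p W w" if W: "zopen W" "W \<subseteq> U" for W
      unfolding L'_def res_plus[OF U(1) W Lc phc] L_res[OF p U(1) W UV w] ph_res[OF U(1) W rw] ..
  qed
  moreover have "L' p U w = L' q U w"
    if p: "p \<in> P1" and q: "q \<in> P1" and U: "zopen U" "U \<subseteq> V' p \<inter> V' q" and g: "gpt \<in> U" and w: "regs b U w" for p q U w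
  proof -
    interpret N: local_lifts E a b \<phi> \<psi> V' L' by (rule LL)
    have U': "U \<subseteq> V' p" "U \<subseteq> V' q" using U(2) by auto
    note cp = N.L_closed[OF p U(1) U'(1) w] and cq = N.L_closed[OF q U(1) U'(2) w]
    obtain c where c: "regs a U c" "L' p U w = addE U (L' q U w) (ph U c)"
      using same_image[OF U(1) cp cq] N.L_psi[OF p U(1) U'(1) w] N.L_psi[OF q U(1) U'(2) w] by auto
    \<comment> \<open>On \<open>W\<close> each corrected lift is the generic lift plus the image of
      w t, which does not depend on the point; the discrepancy c is a constant, so its vanishing on
      \<open>W\<close> suffices.\<close>
    define W where "W = U \<inter> V gpt"
    have W: "zopen W" "W \<subseteq> U" "gpt \<in> W" "W \<subseteq> V gpt" using U(1) V[OF gpt_P1] g by (auto simp: W_def)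
    have wW: "regs b W w" and cW: "regs a W c" using w c(1) W(2) by auto
    have eq: "L' p W w = addE W (L gpt W w) (ph W (w * t)) \<and> regs a W (w * t)" if p: "p \<in> P1" and UV: "U \<subseteq> V' p" for p
    proof -
      have WV: "W \<subseteq> V' p" "W \<subseteq> V p \<inter> V gpt" using W(2,4) UV V'(3)[OF p] by auto
      note t1 = \<tau>(1)[OF p W(1) WV(2) wW] and t2 = r[OF p W(1) WV(1) wW]
      note gl = L_closed[OF gpt_P1 W(1,4) wW]
      have sum: "w * \<tau> p + w * (t - \<tau> p) = w * t" by (simp add: algebra_simps)
      have "regs a W (w * \<tau> p + w * (t - \<tau> p))" using t1 t2 reg_add regsD[OF W(1)] by blast
      moreover have "L' p W w = addE W (L gpt W w) (ph W (w * \<tau> p + w * (t - \<tau> p)))"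
        unfolding L'_def using t1 t2 by (simp add: plus_ac(1)[OF W(1) gl ph_closed[OF W(1)] ph_closed[OF W(1)]] ph_add[OF W(1)])
      ultimately show ?thesis unfolding sum by blast
    qed
    have "L' p W w = addE W (L' q W w) (ph W c)"
      using arg_cong[OF c(2), of "res E U W"] N.L_res[OF p U(1) W(1,2) U'(1) w] N.L_res[OF q U(1) W(1,2) U'(2) w]
        ph_res[OF U(1) W(1,2) c(1)] res_plus[OF U(1) W(1,2) cq ph_closed[OF U(1) c(1)]] by simp
    moreover have "L' p W w = L' q W w" using eq[OF p U'(1)] eq[OF q U'(2)] by simp
    moreover have cqW: "L' q W w \<in> EC W" using N.L_closed[OF q W(1) _ wW] W(2) U'(2) by auto
    ultimately have "addE W (L' q W w) (ph W c) = addE W (L' q W w) (ph W 0)"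
      using ph_zero[OF W(1)] by simp
    moreover have z: "regs a W 0" "regs a U 0" using regsD[OF W(1)] regsD[OF U(1)] by auto
    ultimately have "ph W c = ph W 0"
      using plus_cancel[OF W(1) cqW ph_closed[OF W(1) cW] ph_closed[OF W(1) z(1)]] by simp
    then have "c = 0" using ph_inject[OF W(1,3) cW z(1)] by blast
    then show ?thesis using c(2) ph_zero[OF U(1) cq] by simp
  qed
  ultimately show ?thesis by blast
qed

text \<open>Compatible lifts glue to a right inverse \<sigma> of \<psi>, and adding \<phi> and
  \<sigma> gives an isomorphism from the direct sum of O(a) and O(b) onto E.\<close>

lemma compatible_lifts_split:
  assumes compat: "\<And>p q U w. p \<in> P1 \<Longrightarrow> q \<in> P1 \<Longrightarrow> zopen U \<Longrightarrow> U \<subseteq> V p \<inter> V q \<Longrightarrow> gpt \<in> U \<Longrightarrow>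
    regs b U w \<Longrightarrow> L p U w = L q U w"
  shows "decomposable E"
proof -
  \<comment> \<open>The graph of the splitting: gluing shows that some \<open>e\<close> belongs to
    each w (\<open>ex\<close>), separatedness that there is only one (\<open>uniq\<close>).
    Additivity and linearity of \<sigma> then follow from uniqueness.\<close>
  define spl where "spl U w e \<longleftrightarrow> e \<in> EC U \<and> (\<forall>p\<in>U. res E U (U \<inter> V p) e = L p (U \<inter> V p) w)" for U w e
  have UV: "zopen (U \<inter> V p)" "U \<inter> V p \<subseteq> U" "U \<inter> V p \<subseteq> V p" "p \<in> U \<inter> V p" "p \<in> P1" "regs b U w \<Longrightarrow> regs b (U \<inter> V p) w"
    if "zopen U" "p \<in> U" for U p w
    using that V regsD[OF that] by auto
  have ex: "\<exists>e. spl U w e" if U: "zopen U" and w: "regs b U w" for U w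
  proof -
    have "\<exists>e\<in>EC U. \<forall>p\<in>U. res E U (U \<inter> V p) e = L p (U \<inter> V p) w"
    proof (rule glue[OF U])
      show "L p (U \<inter> V p) w \<in> EC (U \<inter> V p)" if "p \<in> U" for p
        by (rule L_closed) (use UV[OF U that] w in auto)
      fix p q assume p: "p \<in> U" and q: "q \<in> U"
      let ?W = "(U \<inter> V p) \<inter> (U \<inter> V q)"
      have W: "zopen ?W" "?W \<subseteq> U \<inter> V p" "?W \<subseteq> U \<inter> V q" using UV[OF U p] UV[OF U q] by auto
      \<comment> \<open>Two nonempty open sets always meet in the generic point, so compatibility
        applies on every overlap.\<close>
      have g: "gpt \<in> ?W" using gpt_in_open[OF UV(1)[OF U p] UV(4)[OF U p]] gpt_in_open[OF UV(1)[OF U q] UV(4)[OF U q]] by blast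
      have "L p ?W w = L q ?W w"
        by (rule compat[OF UV(5)[OF U p] UV(5)[OF U q] W(1) _ g]) (use w in auto)
      then show "res E (U \<inter> V p) ?W (L p (U \<inter> V p) w) = res E (U \<inter> V q) ?W (L q (U \<inter> V q) w)"
        using L_res[OF UV(5)[OF U p] UV(1)[OF U p] W(1,2) UV(3)[OF U p] UV(6)[OF U p w]]
          L_res[OF UV(5)[OF U q] UV(1)[OF U q] W(1,3) UV(3)[OF U q] UV(6)[OF U q w]] by simp
    qed (use UV[OF U] in auto)
    then show ?thesis unfolding spl_def by blast
  qed
  have uniq: "e = e'" if U: "zopen U" and e: "spl U w e" "spl U w e'" for U w e e'
  proof (rule separated[OF U])
    show "e \<in> EC U" "e' \<in> EC U" using e by (simp_all add: spl_def)
    fix x assume "x \<in> U"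
    then show "\<exists>V. zopen V \<and> x \<in> V \<and> V \<subseteq> U \<and> res E U V e = res E U V e'"
      using e UV(1,2,4)[OF U] by (intro exI[of _ "U \<inter> V x"]) (simp add: spl_def)
  qed
  have spl_psi: "\<psi> U e = cst U w" if U: "zopen U" and w: "regs b U w" and e: "spl U w e" for U w e
  proof -
    have ec: "e \<in> EC U" using e by (simp add: spl_def)
    obtain v where v: "\<psi> U e = cst U v" using psi_cst[OF U ec] by blast
    show ?thesis
    proof (cases "U = {}")
      case True
      then show ?thesis using v cst_empty[of v w] by simp
    next
      case False
      then obtain p where p: "p \<in> U" by blast
      have "cst (U \<inter> V p) v = cst (U \<inter> V p) w"
        using psi_res[OF U UV(1,2)[OF U p] ec v] L_psi[OF UV(5,1,3)[OF U p] UV(6)[OF U p w]] e p by (simp add: spl_def)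
      then show ?thesis using cst_inject[OF UV(4)[OF U p]] v by simp
    qed
  qed
  have spl_add: "spl U (w + v) (addE U e e')"
    if U: "zopen U" and w: "regs b U w" "regs b U v" and e: "spl U w e" "spl U v e'" for U w v e e'
    unfolding spl_def
  proof (intro conjI ballI)
    have ec: "e \<in> EC U" "e' \<in> EC U" using e by (simp_all add: spl_def)
    show "addE U e e' \<in> EC U" by (rule plus_closed[OF U ec])
    fix p assume p: "p \<in> U"
    show "res E U (U \<inter> V p) (addE U e e') = L p (U \<inter> V p) (w + v)"
      using e p by (simp add: spl_def res_plus[OF U UV(1,2)[OF U p] ec]
          L_add[OF UV(5,1,3)[OF U p] UV(6)[OF U p w(1)] UV(6)[OF U p w(2)]])
  qed
  have spl_scale: "spl U (k * w) (scaleE U k e)"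
    if U: "zopen U" and w: "regs b U w" and k: "regs 0 U k" and e: "spl U w e" for U w k e
    unfolding spl_def
  proof (intro conjI ballI)
    have ec: "e \<in> EC U" using e by (simp add: spl_def)
    show "scaleE U k e \<in> EC U" by (rule scale_closed[OF U k ec])
    fix p assume p: "p \<in> U"
    have kp: "regs 0 (U \<inter> V p) k" using k by blast
    show "res E U (U \<inter> V p) (scaleE U k e) = L p (U \<inter> V p) (k * w)"
      using e p by (simp add: spl_def res_scale[OF U UV(1,2)[OF U p] ec k]
          L_scale[OF UV(5,1,3)[OF U p] kp UV(6)[OF U p w]])
  qed
  have spl_res: "spl W w (res E U W e)"
    if U: "zopen U" "zopen W" "W \<subseteq> U" and w: "regs b U w" and e: "spl U w e" for U W w e
    unfolding spl_def
  proof (intro conjI ballI)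
    have ec: "e \<in> EC U" using e by (simp add: spl_def)
    show "res E U W e \<in> EC W" by (rule res_closed[OF U ec])
    fix p assume p: "p \<in> W"
    then have pU: "p \<in> U" using U(3) by blast
    have WU: "W \<inter> V p \<subseteq> U \<inter> V p" using U(3) by blast
    have "res E W (W \<inter> V p) (res E U W e) = res E (U \<inter> V p) (W \<inter> V p) (res E U (U \<inter> V p) e)"
      using res_res[OF U(1,2) UV(1,2)[OF U(2) p] U(3) ec] res_res[OF U(1) UV(1)[OF U(1) pU] UV(1)[OF U(2) p] WU UV(2)[OF U(1) pU] ec]
      by simp
    also have "\<dots> = L p (W \<inter> V p) w"
      using e pU L_res[OF UV(5,1)[OF U(1) pU] UV(1)[OF U(2) p] WU UV(3)[OF U(1) pU] UV(6)[OF U(1) pU w]] by (simp add: spl_def)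
    finally show "res E W (W \<inter> V p) (res E U W e) = L p (W \<inter> V p) w" .
  qed
  \<comment> \<open>The argument is the section and not its constant, which is undetermined over the
    empty set; there \<open>spl\<close> does not depend on w.\<close>
  define \<sigma> where "\<sigma> U s = (SOME e. \<exists>w. s = cst U w \<and> regs b U w \<and> spl U w e)" for U s
  have \<sigma>: "spl U w (\<sigma> U (cst U w))" if U: "zopen U" and w: "regs b U w" for U w
  proof -
    have "\<exists>v. cst U w = cst U v \<and> regs b U v \<and> spl U v (\<sigma> U (cst U w))"
      unfolding \<sigma>_def by (rule someI_ex) (use ex[OF U w] w in blast)
    then obtain v where v: "cst U w = cst U v" "spl U v (\<sigma> U (cst U w))" by blast
    have "v = w" if "x \<in> U" for x using v(1) cst_inject[OF that, of w v] by simp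
    then have "U = {} \<or> v = w" by blast
    then show ?thesis using v(2) by (auto simp: spl_def)
  qed
  define \<Lambda> where "\<Lambda> U s = addE U (\<phi> U (fst s)) (\<sigma> U (snd s))" for U s
  let ?D = "direct_sum (twist a) (twist b)"
  have \<Lambda>: "\<Lambda> U (cst U c, cst U w) = addE U (ph U c) (\<sigma> U (cst U w))" for U c w
    by (simp add: \<Lambda>_def ph_def)
  have \<sigma>c: "\<sigma> U (cst U w) \<in> EC U" if "zopen U" "regs b U w" for U w
    using \<sigma>[OF that] by (simp add: spl_def)
  have D: "\<exists>c w. s = (cst U c, cst U w) \<and> regs a U c \<and> regs b U w" if U: "zopen U" and s: "s \<in> carrier (sec ?D U)" for U s
  proof -
    have s': "fst s \<in> twist_sections a U" "snd s \<in> twist_sections b U" using s by auto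
    obtain c where "fst s = cst U c" "\<And>p. p \<in> U \<Longrightarrow> reg a p c" by (rule twist_sectionE[OF U s'(1)]) (rule that)
    moreover obtain w where "snd s = cst U w" "\<And>p. p \<in> U \<Longrightarrow> reg b p w" by (rule twist_sectionE[OF U s'(2)]) (rule that)
    ultimately show ?thesis by (intro exI[of _ c] exI[of _ w]) (simp add: prod_eq_iff)
  qed
  have mor: "morphism_on P1 ?D E \<Lambda>"
  proof (rule morphism_onI)
    fix U s assume U: "zopen U" and s: "s \<in> carrier (sec ?D U)"
    obtain c w where cw: "s = (cst U c, cst U w)" "regs a U c" "regs b U w" using D[OF U s] by blast
    note pc = ph_closed[OF U cw(2)] and sc = \<sigma>c[OF U cw(3)]
    show "\<Lambda> U s \<in> EC U" unfolding cw(1) \<Lambda> by (rule plus_closed[OF U pc sc])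
    show "\<Lambda> U (s \<oplus>\<^bsub>sec ?D U\<^esub> t) = addE U (\<Lambda> U s) (\<Lambda> U t)" if t: "t \<in> carrier (sec ?D U)" for t
    proof -
      obtain d v where dv: "t = (cst U d, cst U v)" "regs a U d" "regs b U v" using D[OF U t] by blast
      note pd = ph_closed[OF U dv(2)] and sd = \<sigma>c[OF U dv(3)]
      have wv: "regs b U (w + v)" using cw(3) dv(3) reg_add regsD[OF U] by blast
      have e: "\<sigma> U (cst U (w + v)) = addE U (\<sigma> U (cst U w)) (\<sigma> U (cst U v))"
        by (rule uniq[OF U \<sigma>[OF U wv] spl_add[OF U cw(3) dv(3) \<sigma>[OF U cw(3)] \<sigma>[OF U dv(3)]]])
      have "\<Lambda> U (s \<oplus>\<^bsub>sec ?D U\<^esub> t) = \<Lambda> U (cst U (c + d), cst U (w + v))" by (simp add: cw(1) dv(1))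
      also have "\<dots> = addE U (addE U (ph U c) (ph U d)) (addE U (\<sigma> U (cst U w)) (\<sigma> U (cst U v)))"
        unfolding \<Lambda> e ph_add[OF U cw(2) dv(2)] ..
      also have "\<dots> = addE U (\<Lambda> U s) (\<Lambda> U t)"
        unfolding cw(1) dv(1) \<Lambda> by (simp add: plus_ac[OF U] plus_closed[OF U] pc pd sc sd)
      finally show ?thesis .
    qed
    show "\<Lambda> U (r \<odot>\<^bsub>sec ?D U\<^esub> s) = r \<odot>\<^bsub>sec E U\<^esub> \<Lambda> U s" if r: "r \<in> carrier (OX U)" for r
    proof -
      obtain k where k: "r = cst U k" "\<And>p. p \<in> U \<Longrightarrow> reg 0 p k"
        by (rule twist_sectionE[OF U, of r 0]) (use r in auto)
      have kU: "regs 0 U k" using k(2) by blast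
      have kw: "regs b U (k * w)"
      proof
        fix p assume "p \<in> U"
        then show "reg b p (k * w)" using reg_mult'[OF regsD[OF U], of p 0 k b w b] k(2) cw(3) by simp
      qed
      have e: "\<sigma> U (cst U (k * w)) = scaleE U k (\<sigma> U (cst U w))"
        by (rule uniq[OF U \<sigma>[OF U kw] spl_scale[OF U cw(3) kU \<sigma>[OF U cw(3)]]])
      have "\<Lambda> U (r \<odot>\<^bsub>sec ?D U\<^esub> s) = \<Lambda> U (cst U (k * c), cst U (k * w))" by (simp add: cw(1) k(1))
      also have "\<dots> = scaleE U k (\<Lambda> U s)"
        unfolding cw(1) \<Lambda> e ph_scale[OF U kU cw(2)] scale_plus[OF U kU pc sc] ..
      finally show ?thesis by (simp only: k(1))
    qed
    show "\<Lambda> W (res ?D U W s) = res E U W (\<Lambda> U s)" if W: "zopen W" "W \<subseteq> U" for W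
    proof -
      have wW: "regs b W w" using cw(3) W(2) by blast
      have e: "\<sigma> W (cst W w) = res E U W (\<sigma> U (cst U w))"
        by (rule uniq[OF W(1) \<sigma>[OF W(1) wW] spl_res[OF U W cw(3) \<sigma>[OF U cw(3)]]])
      have "\<Lambda> W (res ?D U W s) = \<Lambda> W (cst W c, cst W w)" using W(2) by (simp add: cw(1))
      also have "\<dots> = res E U W (\<Lambda> U s)"
        unfolding cw(1) \<Lambda> e res_plus[OF U W pc sc] ph_res[OF U W cw(2)] ..
      finally show ?thesis .
    qed
  qed
  have bij: "bij_betw (\<Lambda> U) (carrier (sec ?D U)) (EC U)" if U: "zopen U" for U
    unfolding bij_betw_def
  proof
    \<comment> \<open>The projection recovers the second component; cancellation in E and
      injectivity of \<phi> then recover the first.\<close>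
    have \<psi>\<Lambda>: "\<psi> U (\<Lambda> U (cst U c, cst U w)) = cst U w" if "regs a U c" "regs b U w" for c w
      unfolding \<Lambda> using psi_plus[OF U ph_closed[OF U that(1)] \<sigma>c[OF U that(2)] psi_ph[OF U that(1)] spl_psi[OF U that(2) \<sigma>[OF U that(2)]]]
      by simp
    show "inj_on (\<Lambda> U) (carrier (sec ?D U))"
    proof (rule inj_onI)
      fix s t assume st: "s \<in> carrier (sec ?D U)" "t \<in> carrier (sec ?D U)" and eq: "\<Lambda> U s = \<Lambda> U t"
      obtain c w where cw: "s = (cst U c, cst U w)" "regs a U c" "regs b U w" using D[OF U st(1)] by blast
      obtain d v where dv: "t = (cst U d, cst U v)" "regs a U d" "regs b U v" using D[OF U st(2)] by blast
      have wv: "cst U w = cst U v" using \<psi>\<Lambda>[OF cw(2,3)] \<psi>\<Lambda>[OF dv(2,3)] eq cw(1) dv(1) by simp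
      note sc = \<sigma>c[OF U cw(3)]
      have "addE U (\<sigma> U (cst U w)) (ph U c) = addE U (\<sigma> U (cst U w)) (ph U d)"
        using eq wv plus_ac(2)[OF U sc ph_closed[OF U cw(2)] sc] plus_ac(2)[OF U sc ph_closed[OF U dv(2)] sc]
        unfolding cw(1) dv(1) \<Lambda> by simp
      then have "ph U c = ph U d"
        using plus_cancel[OF U sc ph_closed[OF U cw(2)] ph_closed[OF U dv(2)]] by simp
      then have "cst U c = cst U d" using ph_inject[OF U _ cw(2) dv(2)] cst_empty[of c d] by (cases "U = {}") auto
      then show "s = t" using wv by (simp add: cw(1) dv(1))
    qed
    show "\<Lambda> U ` carrier (sec ?D U) = EC U"
    proof
      show "\<Lambda> U ` carrier (sec ?D U) \<subseteq> EC U" using morphism_closed[OF mor U openin_sub[OF U]] by blast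
      show "EC U \<subseteq> \<Lambda> U ` carrier (sec ?D U)"
      proof
        fix e assume e: "e \<in> EC U"
        obtain w where w: "\<psi> U e = cst U w" "regs b U w" using psi_cst[OF U e] by blast
        note sc = \<sigma>c[OF U w(2)]
        obtain c where c: "regs a U c" "e = addE U (\<sigma> U (cst U w)) (ph U c)"
          using same_image[OF U e sc] spl_psi[OF U w(2) \<sigma>[OF U w(2)]] w(1) by auto
        have "e = \<Lambda> U (cst U c, cst U w)"
          unfolding \<Lambda> c(2) by (rule plus_ac(2)[OF U sc ph_closed[OF U c(1)] sc])
        moreover have "(cst U c, cst U w) \<in> carrier (sec ?D U)" using U c(1) w(2) by (simp add: cst_twist_iff)
        ultimately show "e \<in> \<Lambda> U ` carrier (sec ?D U)" by blast
      qed
    qed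
  qed
  \<comment> \<open>\<Lambda> maps the direct sum to E, whereas \<open>decomposable\<close> asks for
    an isomorphism out of E.\<close>
  obtain \<theta> where "morphism_on P1 E ?D \<theta>"
    "\<And>U. zopen U \<Longrightarrow> U \<subseteq> P1 \<Longrightarrow> bij_betw (\<theta> U) (EC U) (carrier (sec ?D U))"
    by (rule isomorphism_inverse[OF closed_presheaf_twists mor], erule bij, rule that)
  then show ?thesis unfolding decomposable_def isomorphic_on_def by blast
qed

end

lemma (in twist_extension) split: "decomposable E"
proof -
  obtain V L where "local_lifts E a b \<phi> \<psi> V L" using local_lifts_exist by (elim exE)
  from local_lifts.corrected_lifts[OF this] obtain V' L' where L': "local_lifts E a b \<phi> \<psi> V' L'"
    "\<forall>p\<in>P1. \<forall>q\<in>P1. \<forall>U w. zopen U \<longrightarrow> U \<subseteq> V' p \<inter> V' q \<longrightarrow> gpt \<in> U \<longrightarrow> regs b U w \<longrightarrow> L' p U w = L' q U w"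
    by (elim exE conjE)
  show ?thesis by (rule local_lifts.compatible_lifts_split[OF L'(1)]) (rule L'(2)[THEN bspec, THEN bspec, THEN spec, THEN spec, THEN mp, THEN mp, THEN mp, THEN mp])
qed

section \<open>The case of empty Z\<close>

context twisted_ideal
begin

text \<open>Every stalk of I contains 1, so 1 is a section of I near each point, and r = 1 * r is
  the required product.\<close>

lemma empty_local_product:
  assumes "points I = {}" "zopen U" "\<And>p. p \<in> U \<Longrightarrow> reg b p r"
  shows "local_product U r"
  unfolding local_product_def
proof
  fix x assume x: "x \<in> U"
  then have P: "x \<in> P1" using openin_sub[OF assms(2)] by blast
  then have "ideal_stalk I x = carrier (local_ring x)" using assms(1) by (auto simp: points_def)
  then have "1 \<in> ideal_stalk I x" using P by simp
  then obtain s W where W: "zopen W" "x \<in> W" "s \<in> I W" "s x = 1" by (auto simp: ideal_stalk_def)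
  have s: "s = cst W 1" using I_cst[OF W(1,3)] W(2,4) by auto
  have X: "zopen (W \<inter> U)" "W \<inter> U \<subseteq> W" using W(1) assms(2) by auto
  have "cst (W \<inter> U) 1 \<in> I (W \<inter> U)" using I_restrict[OF W(1) X W(3)] by (simp add: s)
  then show "\<exists>V m e. zopen V \<and> x \<in> V \<and> V \<subseteq> U \<and> cst V m \<in> I V \<and> (\<forall>p\<in>V. reg b p e) \<and> r = m * e"
    using X(1) x W(2) assms(3) by (intro exI[of _ "W \<inter> U"] exI[of _ 1] exI[of _ r]) auto
qed

lemma empty_imp_decomposable:
  assumes "points I = {}" "a \<ge> b" "sheaf_of_modules E" "short_exact_sequence (twist a) E TS"
  shows "decomposable E"
proof -
  obtain \<phi> \<psi> where ext: "presents_extension a E \<phi> \<psi>"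
    using exact_sequence_values[OF assms(4)] by (elim exE)
  interpret twist_extension E a b \<phi> \<psi>
  proof
    fix U r x assume U: "zopen U" "x \<in> U" and r: "\<And>p. p \<in> U \<Longrightarrow> reg b p r"
    have "local_product U r" by (rule empty_local_product[OF assms(1) U(1) r])
    then show "\<exists>V s. zopen V \<and> x \<in> V \<and> V \<subseteq> U \<and> s \<in> carrier (sec E V) \<and> \<psi> V s = cst V r"
      using ext U by (simp add: presents_extension_def)
  qed (use assms(2,3) ext in \<open>simp_all add: presents_extension_def\<close>)
  show ?thesis by (rule split)
qed

end

theorem theorem1p13:
  fixes E :: "'m omod" and a b :: int and Z :: subscheme
  assumes "locally_free_rank_two E"
    and "associated_triple E a b Z"
  shows "indecomposable E \<longleftrightarrow> points Z \<noteq> {}"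
proof -
  have ab: "a \<ge> b" and Z: "lci_codim_two Z"
    and ses: "short_exact_sequence (twist a) E (twisted_ideal_sheaf Z b)"
    using assms(2) by (simp_all add: associated_triple_def)
  have E: "sheaf_of_modules E" using assms(1) by (simp add: locally_free_rank_two_def)
  then have E': "presheaf_of_modules E" by (simp add: sheaf_of_modules_def)
  interpret twisted_ideal Z b
    using Z by unfold_locales (simp add: lci_codim_two_def closed_subscheme_def)
  have "points Z = {}" if dec: "decomposable E"
  proof (rule ccontr)
    assume "points Z \<noteq> {}"
    then obtain x where x: "x \<in> points Z" by blast
    then have P: "x \<in> P1" by (simp add: points_def)
    obtain f g where fg: "regular_sequence (local_ring x) [f, g]" "ideal_stalk Z x = Idl\<^bsub>local_ring x\<^esub> {f, g}"
      using Z x unfolding lci_codim_two_def by blast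
    from decomposable_principal_stalks[OF ab E' dec ses P]
    obtain h where h: "h \<in> ideal_stalk Z x" "\<forall>m\<in>ideal_stalk Z x. \<exists>w. reg 0 x w \<and> m = w * h" by (elim bexE)
    show False by (rule principal_not_regular[OF P fg h(1)]) (rule bspec[OF h(2)])
  qed
  moreover have "decomposable E" if "points Z = {}"
    by (rule empty_imp_decomposable[OF that ab E ses])
  ultimately show ?thesis by blast
qed

end
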